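(* Let $F$ be a satisfiable XOR-clause-set and let $F^* := \{\oplus F' : F'\subseteq F\}$. Then $F^*$ is computable in time $O(\ell(F)\cdot 2^{c(F)})$, $c(F^* )\le 2^{c(F)}$, and $X_1(F^* )$ is a forcing representation of $F$.
   Context: Literals, clauses (finite sets of literals without complementary pair, $\bot$ the empty clause), clause-sets (finite sets of clauses read as CNF, $\top$ the empty clause-set), $\mathrm{var}$, $c(F)=|F|$, $\ell(F)=\sum_{C\in F}|C|$, partial assignments $\varphi$ and their application $\varphi*F$ (delete satisfied clauses, delete falsified literals) are standard; $F$ is satisfiable iff $\varphi*F=\top$ for some $\varphi$. A literal $x$ is forced for $F$ if $\langle x\to0\rangle*F$ is unsatisfiable. Reductions $r_k$: $r_0(F)=\{\bot\}$ if $\bot\in F$, else $F$; $r_{k+1}(F)=r_{k+1}(\langle x\to1\rangle*F)$ if there is a literal $x$ over $\mathrm{var}(F)$ with $r_k(\langle x\to0\rangle*F)=\{\bot\}$, else $r_{k+1}(F)=F$ (well defined). $r_1$ is unit-clause propagation. For a set $V$ of variables, the p-hardness $\mathrm{phd}^V(F)$ is the least $k$ such that for every partial assignment $\varphi$ with $\mathrm{var}(\varphi)\subseteq V$: if $\varphi*F$ is unsatisfiable then $r_k(\varphi*F)=\{\bot\}$, and if $\varphi*F$ is satisfiable then $r_k(\varphi*F)$ has no forced literal whose variable lies in $V$. An XOR-clause $C$ denotes the constraint $\bigoplus_{x\in C}x=0$ over $\mathbb{Z}_2$ ($\overline{v}$ having value $1\oplus v$); an XOR-clause-set is a conjunction of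 these, with underlying boolean function on $\mathrm{var}(F)$. For an XOR-clause-set $G$, the sum $\oplus G$: let $W$ be the set of variables occurring in an odd number of clauses of $G$, and $\pi$ the parity of the total number of complemented literal occurrences in $G$; if $W=\emptyset$ and $\pi=1$ then $\oplus G$ is inconsistent (undefined), otherwise $\oplus G$ is a clause $E$ with $\mathrm{var}(E)=W$ whose number of complemented literals has parity $\pi$ (chosen by some fixed rule; such $E$ is equivalent as XOR-constraint to the sum of the constraints of $G$; $\oplus\top=\bot$). $X_0(C)$ for a clause $C$ is the set of all clauses $D$ with $\mathrm{var}(D)=\mathrm{var}(C)$ whose number of complemented literals has parity different from that of $C$ (the unique CNF equivalent to the XOR-clause $C$); $X_0(F)=\bigcup_{C\in F}X_0(C)$. The natural splitting of an XOR-clause $C=\{x_1,\dots,x_n\}$ (in some linear order) is $\{C\}$ if $n\le2$, and otherwise $\{\{x_1,x_2,y_2\}\}\cup\{\{y_{i-1},x_i,y_i\}: 3\le i\le n-1\}\cup\{\{y_{n-1},x_n\}\}$ with new variables $y_2,\dots,y_{n-1}$; $X_1(C)$ is $X_0$ of the natural splitting, and $X_1(F)=\bigcup_{C\in F}X_1(C)$, with some order chosen for each clause and new variables for different clauses pairwise disjoint and disjoint from the original ones. A CNF-representation of $F$ is a clause-set $F'$ with $\mathrm{var}(F)\subseteq\mathrm{var}(F')$ such that for every total assignment $\varphi$ of $\mathrm{var}(F)$, $\varphi*F'$ is satisfiable iff $\varphi$ satisfies $F$. It is a forcing representation if $\mathrm{phd}^{\mathrm{var}(F)}(F')\le1$ and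 for every total assignment $\varphi$ of $\mathrm{var}(F)$ with $\varphi*F'$ satisfiable we have $r_1(\varphi*F')=\top$. *)

theory Defs
  imports Main
begin

subsection \<open>Clause-sets and partial assignments\<close>

datatype 'v literal = Pos (lvar: 'v) | Neg (lvar: 'v)

type_synonym 'v clause = "'v literal set"
type_synonym 'v clauses = "'v clause set"
type_synonym 'v passignment = "'v \<rightharpoonup> bool"

definition is_clause :: "'v clause \<Rightarrow> bool" where
  "is_clause C \<longleftrightarrow> finite C \<and> \<not> (\<exists>v. Pos v \<in> C \<and> Neg v \<in> C)"

definition clause_set :: "'v clauses \<Rightarrow> bool" where
  "clause_set F \<longleftrightarrow> finite F \<and> (\<forall>C\<in>F. is_clause C)"

definition cvars :: "'v clause \<Rightarrow> 'v set" where
  "cvars C = lvar ` C"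

definition vars :: "'v clauses \<Rightarrow> 'v set" where
  "vars F = (\<Union>C\<in>F. cvars C)"

definition num_literals :: "'v clauses \<Rightarrow> nat" where
  "num_literals F = (\<Sum>C\<in>F. card C)"

fun lit_value :: "'v passignment \<Rightarrow> 'v literal \<Rightarrow> bool option" where
  "lit_value \<phi> (Pos v) = \<phi> v"
| "lit_value \<phi> (Neg v) = map_option Not (\<phi> v)"

definition apply_pass :: "'v passignment \<Rightarrow> 'v clauses \<Rightarrow> 'v clauses" (infixr "\<star>" 70) where
  "\<phi> \<star> F = {{x \<in> C. lit_value \<phi> x \<noteq> Some False} | C.
              C \<in> F \<and> (\<forall>x\<in>C. lit_value \<phi> x \<noteq> Some True)}"

fun lit_assign :: "'v literal \<Rightarrow> bool \<Rightarrow> 'v passignment" where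
  "lit_assign (Pos v) b = [v \<mapsto> b]"
| "lit_assign (Neg v) b = [v \<mapsto> \<not> b]"

definition satisfiable :: "'v clauses \<Rightarrow> bool" where
  "satisfiable F \<longleftrightarrow> (\<exists>\<phi>. \<phi> \<star> F = {})"

definition forced :: "'v literal \<Rightarrow> 'v clauses \<Rightarrow> bool" where
  "forced x F \<longleftrightarrow> \<not> satisfiable (lit_assign x False \<star> F)"


subsection \<open>Generalised unit-clause propagation and p-hardness\<close>

lemma vars_lit_assign_psubset:
  assumes "lvar x \<in> vars F"
  shows "vars (lit_assign x b \<star> F) \<subset> vars F"
proof -
  have "lvar x \<notin> vars (lit_assign x b \<star> F)"
  proof
    assume "lvar x \<in> vars (lit_assign x b \<star> F)"
    then obtain C y where y: "y \<in> C" "lvar y = lvar x" "lit_value (lit_assign x b) y \<noteq> Some False"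
      "\<forall>z\<in>C. lit_value (lit_assign x b) z \<noteq> Some True"
      by (auto simp: vars_def cvars_def apply_pass_def)
    then show False by (cases x; cases y; cases b) auto
  qed
  moreover have "vars (lit_assign x b \<star> F) \<subseteq> vars F"
    by (auto simp: vars_def cvars_def apply_pass_def)
  ultimately show ?thesis using assms by blast
qed

text \<open>
  The result does not depend on which literal is selected, so a Hilbert choice is used. The
  finiteness test holds for every clause-set; it only makes the recursion total on the type.
\<close>

function reduce :: "nat \<Rightarrow> 'v clauses \<Rightarrow> 'v clauses" where
  "reduce 0 F = (if {} \<in> F then {{}} else F)"
| "reduce (Suc k) F =
    (let L = {x. lvar x \<in> vars F \<and> reduce k (lit_assign x False \<star> F) = {{}}} in
     if finite (vars F) \<and> L \<noteq> {}
     then reduce (Suc k) (lit_assign (SOME x. x \<in> L) True \<star> F)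
     else F)"
  by pat_completeness auto

termination
proof (relation "measures [fst, \<lambda>(k, F). card (vars F)]", goal_cases)
  case (3 k F L)
  from 3(2) have "(SOME x. x \<in> L) \<in> L" using some_in_eq by blast
  then have "lvar (SOME x. x \<in> L) \<in> vars F" using 3 by blast
  then show ?case using 3 by (simp add: psubset_card_mono vars_lit_assign_psubset)
qed auto

definition phd :: "'v set \<Rightarrow> 'v clauses \<Rightarrow> nat" where
  "phd V F = (LEAST k. \<forall>\<phi>. dom \<phi> \<subseteq> V \<longrightarrow>
     (\<not> satisfiable (\<phi> \<star> F) \<longrightarrow> reduce k (\<phi> \<star> F) = {{}}) \<and>
     (satisfiable (\<phi> \<star> F) \<longrightarrow> \<not> (\<exists>x. lvar x \<in> V \<and> forced x (reduce k (\<phi> \<star> F)))))"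


subsection \<open>XOR-clause-sets\<close>

text \<open>An XOR-clause-set has the same type as a clause-set; only its semantics differs.\<close>

definition xor_satisfies :: "'v passignment \<Rightarrow> 'v clauses \<Rightarrow> bool" where
  "xor_satisfies \<phi> F \<longleftrightarrow> (\<forall>C\<in>F. even (card {x \<in> C. lit_value \<phi> x = Some True}))"

definition xor_satisfiable :: "'v clauses \<Rightarrow> bool" where
  "xor_satisfiable F \<longleftrightarrow> (\<exists>\<phi>. dom \<phi> = vars F \<and> xor_satisfies \<phi> F)"

definition num_compl :: "'v clause \<Rightarrow> nat" where
  "num_compl C = card {v. Neg v \<in> C}"

definition odd_vars :: "'v clauses \<Rightarrow> 'v set" where
  "odd_vars G = {v. odd (card {C \<in> G. v \<in> cvars C})}"

definition compl_odd :: "'v clauses \<Rightarrow> bool" where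
  "compl_odd G \<longleftrightarrow> odd (\<Sum>C\<in>G. num_compl C)"

definition xor_consistent :: "'v clauses \<Rightarrow> bool" where
  "xor_consistent G \<longleftrightarrow> \<not> (odd_vars G = {} \<and> compl_odd G)"

text \<open>The admissible sum operations: every rule for choosing the clause representing a sum.\<close>

definition is_xor_sum :: "('v clauses \<Rightarrow> 'v clause) \<Rightarrow> bool" where
  "is_xor_sum S \<longleftrightarrow> (\<forall>G. clause_set G \<and> xor_consistent G \<longrightarrow>
     is_clause (S G) \<and> cvars (S G) = odd_vars G \<and> (odd (num_compl (S G)) \<longleftrightarrow> compl_odd G))"

text \<open>One such rule: at most the least variable is complemented.\<close>

definition min_xor_sum :: "'v::linorder clauses \<Rightarrow> 'v clause" where
  "min_xor_sum G =
    (if compl_odd G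
     then insert (Neg (Min (odd_vars G))) (Pos ` (odd_vars G - {Min (odd_vars G)}))
     else Pos ` odd_vars G)"

definition xor_closure :: "('v clauses \<Rightarrow> 'v clause) \<Rightarrow> 'v clauses \<Rightarrow> 'v clauses" where
  "xor_closure S F = {S G | G. G \<subseteq> F}"


subsection \<open>Translations to CNF\<close>

definition X0_clause :: "'v clause \<Rightarrow> 'v clauses" where
  "X0_clause C = {D. is_clause D \<and> cvars D = cvars C \<and> odd (num_compl D) \<noteq> odd (num_compl C)}"

definition X0 :: "'v clauses \<Rightarrow> 'v clauses" where
  "X0 F = (\<Union>C\<in>F. X0_clause C)"

definition natural_splitting :: "'v literal list \<Rightarrow> (nat \<Rightarrow> 'v) \<Rightarrow> 'v clauses" where
  "natural_splitting xs y =
    (let n = length xs; x = (\<lambda>i. xs ! (i - 1)) in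
     if n \<le> 2 then {set xs}
     else {{x 1, x 2, Pos (y 2)}}
        \<union> {{Pos (y (i - 1)), x i, Pos (y i)} | i. 3 \<le> i \<and> i \<le> n - 1}
        \<union> {{Pos (y (n - 1)), x n}})"

text \<open>
  The choices behind \<open>X\<^sub>1\<close>: \<open>ord C\<close> lists the literals of \<open>C\<close>, and \<open>y C 2, \<dots>, y C (card C - 1)\<close>
  are the new variables for \<open>C\<close>.
\<close>

definition splitting_choice ::
    "'v clauses \<Rightarrow> ('v clause \<Rightarrow> 'v literal list) \<Rightarrow> ('v clause \<Rightarrow> nat \<Rightarrow> 'v) \<Rightarrow> bool" where
  "splitting_choice F ord y \<longleftrightarrow>
    (\<forall>C\<in>F. distinct (ord C) \<and> set (ord C) = C) \<and>
    (let I = (SIGMA C:F. {2..card C - 1}) in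
     inj_on (\<lambda>(C, i). y C i) I \<and> (\<lambda>(C, i). y C i) ` I \<inter> vars F = {})"

definition X1 ::
    "('v clause \<Rightarrow> 'v literal list) \<Rightarrow> ('v clause \<Rightarrow> nat \<Rightarrow> 'v) \<Rightarrow> 'v clauses \<Rightarrow> 'v clauses" where
  "X1 ord y F = (\<Union>C\<in>F. X0 (natural_splitting (ord C) (y C)))"

definition CNF_representation :: "'v clauses \<Rightarrow> 'v clauses \<Rightarrow> bool" where
  "CNF_representation F F' \<longleftrightarrow> clause_set F' \<and> vars F \<subseteq> vars F' \<and>
    (\<forall>\<phi>. dom \<phi> = vars F \<longrightarrow> (satisfiable (\<phi> \<star> F') \<longleftrightarrow> xor_satisfies \<phi> F))"

definition forcing_representation :: "'v clauses \<Rightarrow> 'v clauses \<Rightarrow> bool" where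
  "forcing_representation F F' \<longleftrightarrow> CNF_representation F F' \<and> phd (vars F) F' \<le> 1 \<and>
    (\<forall>\<phi>. dom \<phi> = vars F \<and> satisfiable (\<phi> \<star> F') \<longrightarrow> reduce 1 (\<phi> \<star> F') = {})"


subsection \<open>Running time\<close>

text \<open>
  Random access machines with addition, truncated subtraction and comparison at unit cost,
  as structured programs. The memory consists of arrays of natural numbers, of which a program
  uses finitely many; since it also contains finitely many expressions, evaluating
  an expression costs one unit.
\<close>

type_synonym memory = "nat \<Rightarrow> nat \<Rightarrow> nat"

datatype aexp = Const nat | Load nat aexp | Add aexp aexp | Sub aexp aexp
datatype bexp = Less aexp aexp | Equal aexp aexp
datatype com = Skip | Store nat aexp aexp | Seq com com | Cond bexp com com | While bexp com

fun aval :: "aexp \<Rightarrow> memory \<Rightarrow> nat" where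
  "aval (Const n) m = n"
| "aval (Load A a) m = m A (aval a m)"
| "aval (Add a b) m = aval a m + aval b m"
| "aval (Sub a b) m = aval a m - aval b m"

fun bval :: "bexp \<Rightarrow> memory \<Rightarrow> bool" where
  "bval (Less a b) m \<longleftrightarrow> aval a m < aval b m"
| "bval (Equal a b) m \<longleftrightarrow> aval a m = aval b m"

inductive exec :: "com \<Rightarrow> memory \<Rightarrow> nat \<Rightarrow> memory \<Rightarrow> bool" where
  Skip: "exec Skip m 1 m"
| Store: "exec (Store A a b) m 1 (m(A := (m A)(aval a m := aval b m)))"
| Seq: "exec P m s m' \<Longrightarrow> exec Q m' t m'' \<Longrightarrow> exec (Seq P Q) m (s + t) m''"
| Cond_True: "bval b m \<Longrightarrow> exec P m t m' \<Longrightarrow> exec (Cond b P Q) m (t + 1) m'"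
| Cond_False: "\<not> bval b m \<Longrightarrow> exec Q m t m' \<Longrightarrow> exec (Cond b P Q) m (t + 1) m'"
| While_False: "\<not> bval b m \<Longrightarrow> exec (While b P) m 1 m"
| While_True: "bval b m \<Longrightarrow> exec P m s m' \<Longrightarrow> exec (While b P) m' t m'' \<Longrightarrow>
    exec (While b P) m (s + t + 1) m''"

definition lists_clauses :: "'v literal list list \<Rightarrow> 'v clauses \<Rightarrow> bool" where
  "lists_clauses xss F \<longleftrightarrow> distinct (map set xss) \<and> (\<forall>xs\<in>set xss. distinct xs) \<and> set (map set xss) = F"

fun encode_literal :: "nat literal \<Rightarrow> nat list" where
  "encode_literal (Pos v) = [v, 0]"
| "encode_literal (Neg v) = [v, 1]"

definition encode_clause :: "nat literal list \<Rightarrow> nat list" where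
  "encode_clause xs = length xs # concat (map encode_literal xs)"

definition encode_clauses :: "nat literal list list \<Rightarrow> nat list" where
  "encode_clauses xss = length xss # concat (map encode_clause xss)"

definition input_memory :: "nat list \<Rightarrow> memory" where
  "input_memory e = (\<lambda>A i. if A = 0 \<and> i < length e then e ! i else 0)"

definition outputs :: "memory \<Rightarrow> nat list \<Rightarrow> bool" where
  "outputs m e \<longleftrightarrow> (\<forall>i<length e. m 1 i = e ! i)"

text \<open>
  On the domain \<open>D\<close>, \<open>f\<close> is computable in time \<open>O(T)\<close>. The summand 1 only matters for
  inputs with \<open>T F = 0\<close>.
\<close>

definition computable_in_time ::
    "(nat clauses \<Rightarrow> bool) \<Rightarrow> (nat clauses \<Rightarrow> nat clauses) \<Rightarrow> (nat clauses \<Rightarrow> nat) \<Rightarrow> bool" where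
  "computable_in_time D f T \<longleftrightarrow>
    (\<exists>P K. \<forall>F xss. D F \<and> lists_clauses xss F \<longrightarrow>
      (\<exists>t m yss. exec P (input_memory (encode_clauses xss)) t m \<and>
         t \<le> K * (T F + 1) \<and>
         lists_clauses yss (f F) \<and> outputs m (encode_clauses yss)))"

end

theory Submission imports Defs begin

text \<open>
  Forcing. Let \<open>\<psi>\<close> be the assignment reached by unit propagation on \<open>X\<^sub>1(F\<^sup>*)\<close>. Along a natural
  splitting, propagation determines everything as soon as at most one variable of the split clause
  is unassigned. Hence, if no conflict arises, every sum of clauses of \<open>F\<close> has either all its
  variables assigned, and then it is satisfied, or at least two of them unassigned. Any unassigned
  variable may then be given any value without creating a violated sum over assigned
  variables, and a value for the next variable can always be chosen: two sums that determine it
  agree, since their symmetric difference is a sum over assigned variables. So \<open>F\<close> has a solution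
  with the given values, and its extension to the new variables is compatible with \<open>\<psi>\<close>, because
  \<open>\<psi>\<close> was obtained by inference.

  Computation. The sums are produced without repetition by adding each input clause to all sums
  found so far; the new sums are discarded if one of them is empty, since then the clause is itself a
  sum of earlier ones. By consistency, a sum is determined by its set of variables.
\<close>

section \<open>Parities of XOR-clauses\<close>

text \<open>Unit propagation never adds two XOR-constraints, so on \<open>F\<close> alone it misses
  linear consequences; once every sum is present, any consequence of a partial assignment for a
  single variable can be read off one clause. What then has to be controlled is the splitting, where
  such a clause is spread over several small ones. Since the rule behind \<open>S\<close> is
  arbitrary, the truth of \<open>S G\<close> is expressed throughout by the parity of the number of
  falsified clauses of \<open>G\<close>.

  For the running time the obstacle is repetition: comparing each new sum with all earlier ones
  could take quadratically many comparisons. The test for an empty sum replaces all of them. A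
  symmetric difference of clauses is formed in linear time with one mark per variable, without
  sorting. A sum has at most \<open>num_literals F\<close> literals and the number of sums at most
  doubles with each input clause, so the costs form a geometric series dominated by its last
  term.\<close>

fun lit_holds :: "('v \<Rightarrow> bool) \<Rightarrow> 'v literal \<Rightarrow> bool" where
  "lit_holds \<tau> (Pos v) = \<tau> v"
| "lit_holds \<tau> (Neg v) = (\<not> \<tau> v)"

text \<open>Total assignments are used because in \<open>xor_satisfies\<close> both literals of an
  unassigned variable count as not true, which would spoil parity arguments.\<close>

definition xor_holds :: "('v \<Rightarrow> bool) \<Rightarrow> 'v clause \<Rightarrow> bool" where
  "xor_holds \<tau> C \<longleftrightarrow> even (card {x \<in> C. lit_holds \<tau> x})"

text \<open>The common part is counted twice on the right and cancels modulo 2.\<close>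

lemma odd_sum_sym_diff:
  fixes f :: "'a \<Rightarrow> nat"
  assumes "finite A" "finite B"
  shows "odd (sum f (sym_diff A B)) \<longleftrightarrow> odd (sum f A) \<noteq> odd (sum f B)"
proof -
  have "sum f (sym_diff A B) = sum f (A - B) + sum f (B - A)"
    using assms by (intro sum.union_disjoint) auto
  moreover have "sum f A = sum f (A - B) + sum f (A \<inter> B)"
    using assms by (metis add.commute sum.Int_Diff)
  moreover have "sum f B = sum f (B - A) + sum f (A \<inter> B)"
    using assms by (metis add.commute sum.Int_Diff inf.commute)
  ultimately show ?thesis by auto
qed

lemma odd_card_sym_diff:
  assumes "finite A" "finite B"
  shows "odd (card (sym_diff A B)) \<longleftrightarrow> odd (card A) \<noteq> odd (card B)"
  using odd_sum_sym_diff[OF assms, of "\<lambda>_. 1"] by simp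

lemma odd_vars_sym_diff:
  assumes "finite G" "finite H"
  shows "odd_vars (sym_diff G H) = sym_diff (odd_vars G) (odd_vars H)"
proof -
  have "{C \<in> sym_diff G H. v \<in> cvars C} = sym_diff {C \<in> G. v \<in> cvars C} {C \<in> H. v \<in> cvars C}" for v
    by auto
  then show ?thesis
    using assms unfolding odd_vars_def by (auto simp: odd_card_sym_diff)
qed

lemma compl_odd_sym_diff:
  assumes "finite G" "finite H"
  shows "compl_odd (sym_diff G H) \<longleftrightarrow> compl_odd G \<noteq> compl_odd H"
  using assms by (simp add: compl_odd_def odd_sum_sym_diff)

lemma odd_vars_empty [simp]: "odd_vars {} = {}"
  by (simp add: odd_vars_def)

lemma compl_odd_empty [simp]: "\<not> compl_odd {}"
  by (simp add: compl_odd_def)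

lemma odd_vars_singleton [simp]: "odd_vars {C} = cvars C"
proof -
  have "{D \<in> {C}. v \<in> cvars D} = (if v \<in> cvars C then {C} else {})" for v by auto
  then show ?thesis by (auto simp: odd_vars_def)
qed

lemma odd_vars_insert:
  assumes "finite G" "C \<notin> G"
  shows "odd_vars (insert C G) = sym_diff (odd_vars G) (cvars C)"
proof -
  have "insert C G = sym_diff G {C}" using assms by auto
  then show ?thesis using assms by (metis odd_vars_sym_diff odd_vars_singleton finite.intros)
qed

lemma compl_odd_insert:
  assumes "finite G" "C \<notin> G"
  shows "compl_odd (insert C G) \<longleftrightarrow> compl_odd G \<noteq> odd (num_compl C)"
  using assms by (simp add: compl_odd_def) blast

lemma odd_vars_subset: "odd_vars G \<subseteq> vars G"
proof
  fix v assume "v \<in> odd_vars G"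
  then have "card {C \<in> G. v \<in> cvars C} \<noteq> 0" by (auto simp: odd_vars_def intro: Nat.gr0I)
  then have "{C \<in> G. v \<in> cvars C} \<noteq> {}" by (metis card.empty)
  then show "v \<in> vars G" by (auto simp: vars_def)
qed

lemma finite_cvars: "is_clause C \<Longrightarrow> finite (cvars C)"
  by (simp add: is_clause_def cvars_def)

lemma finite_vars: "clause_set F \<Longrightarrow> finite (vars F)"
  by (auto simp: clause_set_def vars_def finite_cvars)

lemma clause_set_subset: "clause_set F \<Longrightarrow> G \<subseteq> F \<Longrightarrow> clause_set G"
  by (auto simp: clause_set_def finite_subset)

lemma is_clause_iff_inj_on: "is_clause C \<longleftrightarrow> finite C \<and> inj_on lvar C"
proof -
  have "inj_on lvar C \<longleftrightarrow> \<not> (\<exists>v. Pos v \<in> C \<and> Neg v \<in> C)"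
  proof
    assume "inj_on lvar C"
    then show "\<not> (\<exists>v. Pos v \<in> C \<and> Neg v \<in> C)"
      by (metis inj_onD literal.distinct(1) literal.sel)
  next
    assume no: "\<not> (\<exists>v. Pos v \<in> C \<and> Neg v \<in> C)"
    show "inj_on lvar C"
    proof (rule inj_onI)
      fix x y assume "x \<in> C" "y \<in> C" "lvar x = lvar y"
      then show "x = y" using no by (cases x; cases y) auto
    qed
  qed
  then show ?thesis by (auto simp: is_clause_def)
qed

lemma cvars_eq_Pos_Neg:
  "cvars C = {v. Pos v \<in> C} \<union> {v. Neg v \<in> C}"
proof -
  have "v \<in> cvars C \<longleftrightarrow> Pos v \<in> C \<or> Neg v \<in> C" for v
  proof
    assume "v \<in> cvars C"
    then obtain x where "x \<in> C" "v = lvar x" by (auto simp: cvars_def)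
    then show "Pos v \<in> C \<or> Neg v \<in> C" by (cases x) auto
  next
    assume "Pos v \<in> C \<or> Neg v \<in> C"
    then show "v \<in> cvars C" unfolding cvars_def by (elim disjE) (drule imageI[where f = lvar], simp)+
  qed
  then show ?thesis by auto
qed

lemma finite_odd_vars: "clause_set G \<Longrightarrow> finite (odd_vars G)"
  using finite_subset[OF odd_vars_subset finite_vars] .

text \<open>A complemented literal has the value of its variable plus 1, so the number of true
  literals has the parity of the true variables plus the complemented literals. Thus only the
  variables and the sign of a clause matter.\<close>

lemma xor_holds_iff_vars:
  assumes "is_clause C"
  shows "xor_holds \<tau> C \<longleftrightarrow> (odd (card {v \<in> cvars C. \<tau> v}) \<longleftrightarrow> odd (num_compl C))"
proof -
  have "finite C" using assms by (simp add: is_clause_def)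
  then have fin: "finite {v. Neg v \<in> C}" "finite {v. Pos v \<in> C}"
    by (auto intro!: finite_vimageI[unfolded vimage_def] simp: inj_def)
  have inj: "inj_on lvar {x \<in> C. lit_holds \<tau> x}"
    using assms by (auto simp: is_clause_iff_inj_on intro: inj_on_subset)
  have img: "lvar ` {x \<in> C. lit_holds \<tau> x} = {v. Pos v \<in> C \<and> \<tau> v \<or> Neg v \<in> C \<and> \<not> \<tau> v}" (is "?l = ?r")
  proof
    show "?l \<subseteq> ?r"
    proof
      fix v assume "v \<in> ?l"
      then obtain x where "v = lvar x" "x \<in> C" "lit_holds \<tau> x" by auto
      then show "v \<in> ?r" by (cases x) auto
    qed
    show "?r \<subseteq> ?l"
    proof
      fix v assume "v \<in> ?r"
      then consider "Pos v \<in> {x \<in> C. lit_holds \<tau> x}" | "Neg v \<in> {x \<in> C. lit_holds \<tau> x}" by auto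
      then show "v \<in> ?l" by cases (drule imageI[where f = lvar], simp)+
    qed
  qed
  have "?r = sym_diff {v \<in> cvars C. \<tau> v} {v. Neg v \<in> C}"
    using assms by (auto simp: cvars_eq_Pos_Neg is_clause_def)
  moreover have "finite {v \<in> cvars C. \<tau> v}" using finite_cvars[OF assms] by simp
  ultimately have "odd (card ?r) \<longleftrightarrow> odd (card {v \<in> cvars C. \<tau> v}) \<noteq> odd (num_compl C)"
    using odd_card_sym_diff[of "{v \<in> cvars C. \<tau> v}" "{v. Neg v \<in> C}"] fin by (simp add: num_compl_def)
  then show ?thesis using card_image[OF inj] img by (auto simp: xor_holds_def)
qed

text \<open>Double counting modulo 2: a true variable contributes to the sum once for each clause
  that contains it.\<close>

lemma odd_card_odd_vars:
  assumes "finite G" "\<And>C. C \<in> G \<Longrightarrow> finite (cvars C)"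
  shows "odd (card {v \<in> odd_vars G. \<tau> v}) \<longleftrightarrow> odd (\<Sum>C\<in>G. card {v \<in> cvars C. \<tau> v})"
  using assms
proof (induction G rule: finite_induct)
  case (insert C G)
  have "finite (vars G)" using insert by (auto simp: vars_def)
  then have fin: "finite (odd_vars G)" using odd_vars_subset by (rule finite_subset[rotated])
  have "{v \<in> odd_vars (insert C G). \<tau> v} = sym_diff {v \<in> odd_vars G. \<tau> v} {v \<in> cvars C. \<tau> v}"
    using insert by (auto simp: odd_vars_insert)
  then show ?case using insert fin by (auto simp: odd_card_sym_diff)
qed simp

text \<open>The right-hand side depends on \<open>G\<close> only through \<open>odd_vars G\<close> and \<open>compl_odd G\<close>.\<close>

lemma even_falsified_iff:
  assumes "clause_set G"
  shows "even (card {C \<in> G. \<not> xor_holds \<tau> C}) \<longleftrightarrow>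
    (odd (card {v \<in> odd_vars G. \<tau> v}) \<longleftrightarrow> compl_odd G)"
proof -
  have fin: "finite G" and cl: "\<And>C. C \<in> G \<Longrightarrow> is_clause C"
    using assms by (auto simp: clause_set_def)
  have "odd (card {C \<in> G. \<not> xor_holds \<tau> C}) \<longleftrightarrow>
      odd (\<Sum>C\<in>G. card {v \<in> cvars C. \<tau> v} + num_compl C)"
    using fin cl
  proof (induction G rule: finite_induct)
    case (insert C G)
    have "{D \<in> insert C G. \<not> xor_holds \<tau> D} =
        (if xor_holds \<tau> C then {D \<in> G. \<not> xor_holds \<tau> D} else insert C {D \<in> G. \<not> xor_holds \<tau> D})"
      by auto
    then show ?case using insert xor_holds_iff_vars[of C \<tau>] by auto
  qed simp
  then show ?thesis
    using odd_card_odd_vars[OF fin, of \<tau>] cl finite_cvars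
    by (auto simp: sum.distrib compl_odd_def)
qed

text \<open>The rule behind \<open>S\<close> disappears here: an admissible sum has prescribed
  variables and a prescribed sign, and these determine its truth.\<close>

lemma xor_holds_sum_iff:
  assumes "is_xor_sum S" "clause_set G" "xor_consistent G"
  shows "xor_holds \<tau> (S G) \<longleftrightarrow> even (card {C \<in> G. \<not> xor_holds \<tau> C})"
proof -
  have "is_clause (S G)" "cvars (S G) = odd_vars G" "odd (num_compl (S G)) \<longleftrightarrow> compl_odd G"
    using assms unfolding is_xor_sum_def by blast+
  then show ?thesis by (simp add: xor_holds_iff_vars even_falsified_iff[OF assms(2)])
qed

lemma lit_value_holds:
  assumes "\<phi> (lvar x) \<noteq> None"
  shows "lit_value \<phi> x = Some True \<longleftrightarrow> lit_holds (\<lambda>v. the (\<phi> v)) x"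
  using assms by (cases x) auto

lemma xor_satisfies_iff_holds:
  assumes "vars F \<subseteq> dom \<phi>"
  shows "xor_satisfies \<phi> F \<longleftrightarrow> (\<forall>C\<in>F. xor_holds (\<lambda>v. the (\<phi> v)) C)"
proof -
  have "{x \<in> C. lit_value \<phi> x = Some True} = {x \<in> C. lit_holds (\<lambda>v. the (\<phi> v)) x}" if "C \<in> F" for C
  proof -
    have "\<phi> (lvar x) \<noteq> None" if "x \<in> C" for x
      using assms \<open>C \<in> F\<close> that by (auto simp: vars_def cvars_def)
    then show ?thesis using lit_value_holds by blast
  qed
  then show ?thesis by (simp add: xor_satisfies_def xor_holds_def)
qed

text \<open>A solution of \<open>F\<close> falsifies no clause of \<open>G\<close>; if no variable
  is left in the sum, the parity count then excludes an odd sign.\<close>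

lemma xor_satisfiable_consistent:
  assumes "clause_set F" "xor_satisfiable F" "G \<subseteq> F"
  shows "xor_consistent G"
proof -
  obtain \<phi> where "dom \<phi> = vars F" "xor_satisfies \<phi> F"
    using assms by (auto simp: xor_satisfiable_def)
  then have "\<forall>C\<in>F. xor_holds (\<lambda>v. the (\<phi> v)) C" by (simp add: xor_satisfies_iff_holds)
  then have "{C \<in> G. \<not> xor_holds (\<lambda>v. the (\<phi> v)) C} = {}" using assms by auto
  then show ?thesis
    using even_falsified_iff[OF clause_set_subset[OF assms(1,3)], of "\<lambda>v. the (\<phi> v)"]
    by (auto simp: xor_consistent_def simp del: Collect_empty_eq)
qed

section \<open>Unit propagation\<close>

definition models :: "('v \<Rightarrow> bool) \<Rightarrow> 'v clauses \<Rightarrow> bool" where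
  "models \<tau> F \<longleftrightarrow> (\<forall>C\<in>F. \<exists>x\<in>C. lit_holds \<tau> x)"

definition extends :: "('v \<Rightarrow> bool) \<Rightarrow> 'v passignment \<Rightarrow> bool" where
  "extends \<tau> \<phi> \<longleftrightarrow> (\<forall>v b. \<phi> v = Some b \<longrightarrow> \<tau> v = b)"

lemma extends_the: "extends (\<lambda>v. the (\<phi> v)) \<phi>"
  by (simp add: extends_def)

lemma extends_lit_value:
  "extends \<tau> \<phi> \<Longrightarrow> lit_value \<phi> x = Some b \<Longrightarrow> lit_holds \<tau> x = b"
  by (cases x) (auto simp: extends_def)

lemma apply_passI:
  assumes "C \<in> F" "\<And>x. x \<in> C \<Longrightarrow> lit_value \<phi> x \<noteq> Some True"
  shows "{x \<in> C. lit_value \<phi> x \<noteq> Some False} \<in> \<phi> \<star> F"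
  unfolding apply_pass_def using assms by (intro CollectI exI[of _ C]) simp

lemma apply_passE:
  assumes "D \<in> \<phi> \<star> F"
  obtains C where "C \<in> F" "\<forall>x\<in>C. lit_value \<phi> x \<noteq> Some True"
    "D = {x \<in> C. lit_value \<phi> x \<noteq> Some False}"
proof -
  from assms obtain C where "D = {x \<in> C. lit_value \<phi> x \<noteq> Some False} \<and> C \<in> F \<and>
      (\<forall>x\<in>C. lit_value \<phi> x \<noteq> Some True)"
    unfolding apply_pass_def by (elim CollectE exE)
  then show thesis by (intro that[of C]) blast+
qed

lemma models_apply_iff:
  assumes "extends \<tau> \<phi>"
  shows "models \<tau> (\<phi> \<star> F) \<longleftrightarrow> models \<tau> F"
proof
  assume m: "models \<tau> (\<phi> \<star> F)"
  show "models \<tau> F"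
    unfolding models_def
  proof
    fix C assume C: "C \<in> F"
    show "\<exists>x\<in>C. lit_holds \<tau> x"
    proof (cases "\<exists>x\<in>C. lit_value \<phi> x = Some True")
      case True
      then show ?thesis using extends_lit_value[OF assms] by blast
    next
      case False
      then have in_F: "{x \<in> C. lit_value \<phi> x \<noteq> Some False} \<in> \<phi> \<star> F"
        using C by (auto simp: apply_pass_def)
      show ?thesis using bspec[OF m[unfolded models_def] in_F] by blast
    qed
  qed
next
  assume m: "models \<tau> F"
  show "models \<tau> (\<phi> \<star> F)"
    unfolding models_def apply_pass_def
  proof clarify
    fix C assume "C \<in> F"
    then obtain x where "x \<in> C" "lit_holds \<tau> x" using m by (auto simp: models_def)
    moreover then have "lit_value \<phi> x \<noteq> Some False" using extends_lit_value[OF assms] by blast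
    ultimately show "\<exists>x\<in>{x \<in> C. lit_value \<phi> x \<noteq> Some False}. lit_holds \<tau> x" by blast
  qed
qed

lemma satisfiable_iff_models: "satisfiable F \<longleftrightarrow> (\<exists>\<tau>. models \<tau> F)"
proof
  assume "satisfiable F"
  then obtain \<phi> where \<phi>: "\<phi> \<star> F = {}" by (auto simp: satisfiable_def)
  have "models (\<lambda>v. the (\<phi> v)) (\<phi> \<star> F)" using \<phi> by (simp add: models_def)
  then show "\<exists>\<tau>. models \<tau> F" using models_apply_iff[OF extends_the] by blast
next
  assume "\<exists>\<tau>. models \<tau> F"
  then obtain \<tau> where \<tau>: "models \<tau> F" by blast
  have "lit_value (\<lambda>v. Some (\<tau> v)) x = Some (lit_holds \<tau> x)" for x by (cases x) auto
  then have "(\<lambda>v. Some (\<tau> v)) \<star> F = {}" using \<tau> by (auto simp: apply_pass_def models_def)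
  then show "satisfiable F" by (auto simp: satisfiable_def)
qed

text \<open>The clauses of \<open>\<phi> \<star> F\<close> contain only literals over variables that
  \<open>\<phi>\<close> leaves unassigned.\<close>

lemma models_apply_None:
  assumes "models \<tau> (\<phi> \<star> F)" "\<And>v. \<phi> v = None \<Longrightarrow> \<tau>' v = \<tau> v"
  shows "models \<tau>' (\<phi> \<star> F)"
  unfolding models_def
proof
  fix D assume D: "D \<in> \<phi> \<star> F"
  then obtain C where C: "C \<in> F" "\<forall>x\<in>C. lit_value \<phi> x \<noteq> Some True"
    "D = {x \<in> C. lit_value \<phi> x \<noteq> Some False}" by (rule apply_passE)
  obtain x where "x \<in> D" "lit_holds \<tau> x"
    using assms(1) D unfolding models_def by blast
  then have x: "x \<in> C" "lit_value \<phi> x \<noteq> Some False" "lit_holds \<tau> x" using C(3) by auto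
  then have "lit_value \<phi> x = None" using C by (cases "lit_value \<phi> x") auto
  then have "lit_holds \<tau>' x" using x assms(2) by (cases x) auto
  then show "\<exists>x\<in>D. lit_holds \<tau>' x" using \<open>x \<in> D\<close> by blast
qed

lemma satisfiable_apply_iff:
  "satisfiable (\<phi> \<star> F) \<longleftrightarrow> (\<exists>\<tau>. extends \<tau> \<phi> \<and> models \<tau> F)"
proof
  assume "satisfiable (\<phi> \<star> F)"
  then obtain \<tau> where \<tau>: "models \<tau> (\<phi> \<star> F)" by (auto simp: satisfiable_iff_models)
  \<comment> \<open>No variable assigned by \<open>\<phi>\<close> occurs in
    \<open>\<phi> \<star> F\<close>, so the model may be overwritten there.\<close>
  let ?\<tau> = "\<lambda>v. case \<phi> v of None \<Rightarrow> \<tau> v | Some b \<Rightarrow> b"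
  have "models ?\<tau> (\<phi> \<star> F)" by (rule models_apply_None[OF \<tau>]) simp
  moreover have "extends ?\<tau> \<phi>" by (simp add: extends_def)
  ultimately show "\<exists>\<tau>. extends \<tau> \<phi> \<and> models \<tau> F" using models_apply_iff by blast
qed (use models_apply_iff satisfiable_iff_models in blast)

lemma vars_apply_disjoint: "v \<in> vars (\<phi> \<star> F) \<Longrightarrow> \<phi> v = None"
proof -
  assume "v \<in> vars (\<phi> \<star> F)"
  then obtain C x where x: "v = lvar x" "x \<in> C" "lit_value \<phi> x \<noteq> Some False"
      "\<forall>x\<in>C. lit_value \<phi> x \<noteq> Some True"
    by (auto simp: vars_def cvars_def apply_pass_def)
  then have "lit_value \<phi> x = None" by (cases "lit_value \<phi> x") auto
  then show ?thesis using x by (cases x) auto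
qed

lemma vars_apply_subset: "vars (\<phi> \<star> F) \<subseteq> vars F"
  by (auto simp: vars_def cvars_def apply_pass_def)

text \<open>This lets a whole run of propagation be described as one partial assignment applied to
  the original clause-set; a newly assigned variable still occurs, hence lies outside the old
  domain.\<close>

lemma apply_apply:
  assumes "dom \<phi> \<inter> dom \<chi> = {}"
  shows "\<chi> \<star> \<phi> \<star> F = (\<phi> ++ \<chi>) \<star> F"
proof -
  have val: "lit_value (\<phi> ++ \<chi>) x = Some b \<longleftrightarrow> lit_value \<phi> x = Some b \<or> lit_value \<chi> x = Some b" for x b
    using assms by (cases x) (auto simp: map_add_def dom_def split: option.splits)
  have dis: "lit_value \<phi> x = None \<or> lit_value \<chi> x = None" for x
    using assms by (cases x) auto
  show ?thesis
  proof (intro set_eqI iffI)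
    fix E assume "E \<in> \<chi> \<star> \<phi> \<star> F"
    then obtain D where D: "D \<in> \<phi> \<star> F" "\<forall>x\<in>D. lit_value \<chi> x \<noteq> Some True"
      "E = {x \<in> D. lit_value \<chi> x \<noteq> Some False}" by (rule apply_passE)
    from D(1) obtain C where C: "C \<in> F" "\<forall>x\<in>C. lit_value \<phi> x \<noteq> Some True"
      "D = {x \<in> C. lit_value \<phi> x \<noteq> Some False}" by (rule apply_passE)
    have "lit_value (\<phi> ++ \<chi>) x \<noteq> Some True" if "x \<in> C" for x
      using C(2) D(2) C(3) val[of x] dis[of x] that by auto
    then have "{x \<in> C. lit_value (\<phi> ++ \<chi>) x \<noteq> Some False} \<in> (\<phi> ++ \<chi>) \<star> F"
      by (rule apply_passI[OF C(1)])
    moreover have "E = {x \<in> C. lit_value (\<phi> ++ \<chi>) x \<noteq> Some False}"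
      unfolding D(3) C(3) val by simp
    ultimately show "E \<in> (\<phi> ++ \<chi>) \<star> F" by simp
  next
    fix E assume "E \<in> (\<phi> ++ \<chi>) \<star> F"
    then obtain C where C: "C \<in> F" "\<forall>x\<in>C. lit_value (\<phi> ++ \<chi>) x \<noteq> Some True"
      "E = {x \<in> C. lit_value (\<phi> ++ \<chi>) x \<noteq> Some False}" by (rule apply_passE)
    let ?C = "{x \<in> C. lit_value \<phi> x \<noteq> Some False}"
    have "?C \<in> \<phi> \<star> F" using C(2) val by (intro apply_passI[OF C(1)]) blast
    then have "{x \<in> ?C. lit_value \<chi> x \<noteq> Some False} \<in> \<chi> \<star> \<phi> \<star> F"
      by (rule apply_passI) (use C(2) val in auto)
    moreover have "E = {x \<in> ?C. lit_value \<chi> x \<noteq> Some False}" unfolding C(3) val by simp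
    ultimately show "E \<in> \<chi> \<star> \<phi> \<star> F" by simp
  qed
qed

section \<open>Unit clauses and the reduction at level one\<close>

lemma extends_lit_assign: "extends \<tau> (lit_assign x b) \<longleftrightarrow> lit_holds \<tau> x = b"
  by (cases x) (auto simp: extends_def)

lemma dom_lit_assign [simp]: "dom (lit_assign x b) = {lvar x}"
  by (cases x) auto

lemma not_forcedI:
  assumes "models \<tau> F" "\<not> lit_holds \<tau> x"
  shows "\<not> forced x F"
  using assms by (auto simp: forced_def satisfiable_apply_iff extends_lit_assign)

text \<open>The test by which \<open>reduce 1\<close> selects \<open>x\<close>. It succeeds for a
  unit clause \<open>{x}\<close>, but also for every \<open>x\<close> once the empty clause is
  present.\<close>

lemma empty_in_lit_assign_False_iff:
  "{} \<in> lit_assign x False \<star> F \<longleftrightarrow> (\<exists>C\<in>F. C \<subseteq> {x})"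
proof -
  have val: "lit_value (lit_assign x False) z = Some False \<longleftrightarrow> z = x" for z
    by (cases x; cases z) auto
  show ?thesis
  proof
    assume "{} \<in> lit_assign x False \<star> F"
    then obtain C where "C \<in> F"
      "\<forall>z\<in>C. lit_value (lit_assign x False) z \<noteq> Some True"
      "{} = {z \<in> C. lit_value (lit_assign x False) z \<noteq> Some False}"
      by (rule apply_passE)
    then show "\<exists>C\<in>F. C \<subseteq> {x}" unfolding val by blast
  next
    assume "\<exists>C\<in>F. C \<subseteq> {x}"
    then obtain C where C: "C \<in> F" "C \<subseteq> {x}" by blast
    have "lit_value (lit_assign x False) z \<noteq> Some True" if "z \<in> C" for z
      using C that val[of z] by auto
    then have "{z \<in> C. lit_value (lit_assign x False) z \<noteq> Some False} \<in> lit_assign x False \<star> F"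
      by (rule apply_passI[OF C(1)])
    moreover have "{z \<in> C. lit_value (lit_assign x False) z \<noteq> Some False} = {}"
      unfolding val using C(2) by auto
    ultimately show "{} \<in> lit_assign x False \<star> F" by simp
  qed
qed

lemma reduce_0_eq_iff: "reduce 0 F = {{}} \<longleftrightarrow> {} \<in> F"
  by auto

text \<open>Subsets of a singleton are the unit clauses and the empty clause, so freeness from
  conflicts is included.\<close>

definition unit_free :: "'v clauses \<Rightarrow> bool" where
  "unit_free F \<longleftrightarrow> (\<forall>C\<in>F. \<forall>x. \<not> C \<subseteq> {x})"

text \<open>Every literal that is set follows from \<open>F\<close> and the assignment so far, hence
  models of \<open>F\<close> extending \<open>\<phi>\<close> extend \<open>\<psi>\<close> too. This
  holds whichever literal the choice operator selects, so confluence is avoided. After a conflict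
  every remaining literal passes the test, and the process ends only in \<open>{{}}\<close>.\<close>

lemma reduce_1_is_apply:
  assumes "finite (vars F)"
  shows "\<exists>\<psi>. reduce 1 (\<phi> \<star> F) = \<psi> \<star> F \<and> \<phi> \<subseteq>\<^sub>m \<psi> \<and>
    (\<forall>\<tau>. extends \<tau> \<phi> \<and> models \<tau> F \<longrightarrow> extends \<tau> \<psi>) \<and>
    (\<psi> \<star> F = {{}} \<or> unit_free (\<psi> \<star> F))"
proof (induction "card (vars (\<phi> \<star> F))" arbitrary: \<phi> rule: less_induct)
  case less
  let ?G = "\<phi> \<star> F"
  let ?L = "{x. lvar x \<in> vars ?G \<and> reduce 0 (lit_assign x False \<star> ?G) = {{}}}"
  have fin: "finite (vars ?G)" using assms vars_apply_subset by (rule finite_subset[rotated])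
  show ?case
  proof (cases "?L = {}")
    case True
    then have red: "reduce 1 ?G = ?G" by (simp del: reduce.simps(1) add: Let_def)
    have no: "\<not> C \<subseteq> {x}" if "C \<in> ?G" "lvar x \<in> vars ?G" for C x
      using True that by (auto simp: reduce_0_eq_iff empty_in_lit_assign_False_iff simp del: reduce.simps)
    have "?G = {{}} \<or> unit_free ?G"
    \<comment> \<open>Without variables only the empty clause can occur. With a variable present, an
      empty clause would let its literals pass the test.\<close>
    proof (cases "vars ?G = {}")
      case True
      then have "?G \<subseteq> {{}}" by (auto simp: vars_def cvars_def)
      then show ?thesis by (auto simp: unit_free_def)
    next
      case False
      then obtain z where z: "lvar z \<in> vars ?G" by (metis ex_in_conv literal.sel(1))
      have "\<not> C \<subseteq> {x}" if C: "C \<in> ?G" for C x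
      proof
        assume sub: "C \<subseteq> {x}"
        show False
        proof (cases "C = {}")
          case True
          then show ?thesis using no[OF C z] by simp
        next
          case False
          then have "lvar x \<in> vars ?G" using sub C by (auto simp: vars_def cvars_def)
          then show ?thesis using no[OF C] sub by simp
        qed
      qed
      then show ?thesis by (simp add: unit_free_def)
    qed
    then show ?thesis using red by (intro exI[of _ \<phi>]) simp
  next
    case False
    define x where "x = (SOME x. x \<in> ?L)"
    have "x \<in> ?L" unfolding x_def some_in_eq using False .
    then have x: "lvar x \<in> vars ?G" "{} \<in> lit_assign x False \<star> ?G"
      by (auto simp: reduce_0_eq_iff simp del: reduce.simps)
    have red: "reduce 1 ?G = reduce 1 (lit_assign x True \<star> ?G)"
      unfolding One_nat_def reduce.simps(2)[of 0 ?G] Let_def x_def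
      by (rule if_P) (use False fin in blast)
    let ?\<phi> = "\<phi> ++ lit_assign x True"
    have eq: "lit_assign x True \<star> ?G = ?\<phi> \<star> F"
      using vars_apply_disjoint[OF x(1)] by (intro apply_apply) auto
    have "card (vars (?\<phi> \<star> F)) < card (vars ?G)"
      using vars_lit_assign_psubset[OF x(1), of True] fin by (simp add: eq psubset_card_mono)
    from less[OF this] obtain \<psi> where "reduce 1 (?\<phi> \<star> F) = \<psi> \<star> F \<and> ?\<phi> \<subseteq>\<^sub>m \<psi> \<and>
      (\<forall>\<tau>. extends \<tau> ?\<phi> \<and> models \<tau> F \<longrightarrow> extends \<tau> \<psi>) \<and> (\<psi> \<star> F = {{}} \<or> unit_free (\<psi> \<star> F))" ..
    note \<psi> = conjunct1[OF this] conjunct1[OF conjunct2[OF this]]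
      conjunct1[OF conjunct2[OF conjunct2[OF this]]] conjunct2[OF conjunct2[OF conjunct2[OF this]]]
    have "extends \<tau> \<psi>" if \<tau>: "extends \<tau> \<phi>" "models \<tau> F" for \<tau>
    proof -
      have "models \<tau> ?G" using \<tau> models_apply_iff by blast
      then have "lit_holds \<tau> x" using x(2) by (auto simp: empty_in_lit_assign_False_iff models_def)
      then have "extends \<tau> ?\<phi>" using \<tau>(1) extends_lit_assign[of \<tau> x True]
        by (auto simp: extends_def map_add_def split: option.splits)
      then show ?thesis using \<psi>(3) \<tau>(2) by blast
    qed
    moreover have "reduce 1 ?G = \<psi> \<star> F" using red eq \<psi>(1) by (simp only:)
    moreover have "\<phi> \<subseteq>\<^sub>m \<psi>"
    proof (rule map_le_trans[OF _ \<psi>(2)])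
      show "\<phi> \<subseteq>\<^sub>m ?\<phi>"
        using vars_apply_disjoint[OF x(1)] by (cases x) (auto simp: map_le_def)
    qed
    ultimately show ?thesis using \<psi>(4) by (intro exI[of _ \<psi>]) simp
  qed
qed

section \<open>The CNF of a single XOR-clause\<close>

definition falsified_clause :: "('v \<Rightarrow> bool) \<Rightarrow> 'v set \<Rightarrow> 'v clause" where
  "falsified_clause \<tau> V = {x. lvar x \<in> V \<and> \<not> lit_holds \<tau> x}"

lemma literal_eqI: "lvar x = lvar y \<Longrightarrow> lit_holds \<tau> x = lit_holds \<tau> y \<Longrightarrow> x = y"
  by (cases x; cases y) auto

lemma finite_lvar_vimage: "finite V \<Longrightarrow> finite {x. lvar x \<in> V}"
proof (rule finite_subset)
  show "{x. lvar x \<in> V} \<subseteq> Pos ` V \<union> Neg ` V"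
  proof
    fix x assume "x \<in> {x. lvar x \<in> V}"
    then show "x \<in> Pos ` V \<union> Neg ` V" by (cases x) auto
  qed
qed auto

lemma is_clause_falsified: "finite V \<Longrightarrow> is_clause (falsified_clause \<tau> V)"
  using finite_lvar_vimage[of V] by (simp add: is_clause_def falsified_clause_def)

lemma cvars_falsified: "cvars (falsified_clause \<tau> V) = V"
proof
  show "V \<subseteq> cvars (falsified_clause \<tau> V)"
  proof
    fix v assume v: "v \<in> V"
    have "(if \<tau> v then Neg v else Pos v) \<in> falsified_clause \<tau> V"
      using v by (simp add: falsified_clause_def)
    then have "lvar (if \<tau> v then Neg v else Pos v) \<in> cvars (falsified_clause \<tau> V)"
      unfolding cvars_def by (rule imageI)
    then show "v \<in> cvars (falsified_clause \<tau> V)" by (simp split: if_splits)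
  qed
qed (auto simp: cvars_def falsified_clause_def)

lemma num_compl_falsified: "num_compl (falsified_clause \<tau> V) = card {v \<in> V. \<tau> v}"
  by (simp add: num_compl_def falsified_clause_def)

lemma falsified_clause_unique:
  assumes "\<forall>x\<in>D. \<not> lit_holds \<tau> x"
  shows "D = falsified_clause \<tau> (cvars D)"
proof
  show "falsified_clause \<tau> (cvars D) \<subseteq> D"
  proof
    fix x assume "x \<in> falsified_clause \<tau> (cvars D)"
    then obtain y where y: "y \<in> D" "lvar x = lvar y" and "\<not> lit_holds \<tau> x"
      by (auto simp: falsified_clause_def cvars_def)
    then have "x = y" using assms literal_eqI by blast
    then show "x \<in> D" using y by simp
  qed
qed (use assms in \<open>auto simp: falsified_clause_def cvars_def\<close>)

text \<open>The complemented literals of the falsified clause are those over the true variables, so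
  the sign condition of \<open>X0_clause\<close> compares the parity of the true variables with the
  sign of \<open>C\<close>.\<close>

lemma falsified_in_X0_clause_iff:
  assumes "is_clause C"
  shows "falsified_clause \<tau> (cvars C) \<in> X0_clause C \<longleftrightarrow> \<not> xor_holds \<tau> C"
  using is_clause_falsified[OF finite_cvars[OF assms], of \<tau>]
  by (simp add: X0_clause_def xor_holds_iff_vars[OF assms] cvars_falsified num_compl_falsified)

lemma models_X0_clause_iff:
  assumes "is_clause C"
  shows "models \<tau> (X0_clause C) \<longleftrightarrow> xor_holds \<tau> C"
proof
  assume m: "models \<tau> (X0_clause C)"
  show "xor_holds \<tau> C"
  proof (rule ccontr)
    assume "\<not> xor_holds \<tau> C"
    then have "falsified_clause \<tau> (cvars C) \<in> X0_clause C"
      by (simp only: falsified_in_X0_clause_iff[OF assms] not_False_eq_True)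
    from bspec[OF m[unfolded models_def] this] show False by (simp add: falsified_clause_def)
  qed
next
  assume h: "xor_holds \<tau> C"
  show "models \<tau> (X0_clause C)"
    unfolding models_def
  proof (rule ballI, rule ccontr)
    fix D assume D: "D \<in> X0_clause C" "\<not> (\<exists>x\<in>D. lit_holds \<tau> x)"
    then have "D = falsified_clause \<tau> (cvars C)"
      using falsified_clause_unique[of D \<tau>] by (simp add: X0_clause_def)
    then show False using D(1) h falsified_in_X0_clause_iff[OF assms, of \<tau>] by simp
  qed
qed

lemma models_X0_iff:
  assumes "\<And>C. C \<in> F \<Longrightarrow> is_clause C"
  shows "models \<tau> (X0 F) \<longleftrightarrow> (\<forall>C\<in>F. xor_holds \<tau> C)"
proof -
  have "models \<tau> (X0 F) \<longleftrightarrow> (\<forall>C\<in>F. models \<tau> (X0_clause C))"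
    by (auto simp: models_def X0_def)
  then show ?thesis using assms models_X0_clause_iff by blast
qed

lemma clause_set_X0_clause:
  assumes "is_clause C"
  shows "clause_set (X0_clause C)"
proof -
  have "X0_clause C \<subseteq> Pow {x. lvar x \<in> cvars C}"
    by (auto simp: X0_clause_def cvars_def)
  then have "finite (X0_clause C)"
    using finite_lvar_vimage[OF finite_cvars[OF assms]] by (simp add: finite_subset)
  then show ?thesis by (simp add: clause_set_def X0_clause_def)
qed

lemma vars_X0_clause:
  assumes "is_clause C"
  shows "vars (X0_clause C) = cvars C"
proof
  show "cvars C \<subseteq> vars (X0_clause C)"
  proof
    fix v assume v: "v \<in> cvars C"
    let ?V = "cvars C"
    have "{u \<in> ?V. u = v} = {v}" using v by auto
    \<comment> \<open>The two assignments differ in \<open>v\<close> only, so one of them violates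
      \<open>C\<close> and gives a clause of \<open>X0_clause C\<close> over all variables of
      \<open>C\<close>.\<close>
    then have "xor_holds (\<lambda>_. False) C \<noteq> xor_holds (\<lambda>u. u = v) C"
      by (simp add: xor_holds_iff_vars[OF assms])
    then obtain \<tau> where "falsified_clause \<tau> ?V \<in> X0_clause C"
      using falsified_in_X0_clause_iff[OF assms] by blast
    then show "v \<in> vars (X0_clause C)"
      using v cvars_falsified[of \<tau> ?V] unfolding vars_def by blast
  qed
qed (auto simp: vars_def X0_clause_def)

lemma odd_card_flip:
  assumes "finite V" "u \<in> V"
  shows "odd (card {v \<in> V. (\<tau>(u := True)) v}) \<noteq> odd (card {v \<in> V. (\<tau>(u := False)) v})"
proof -
  have "{v \<in> V. (\<tau>(u := True)) v} = insert u {v \<in> V. (\<tau>(u := False)) v}" using assms by auto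
  then show ?thesis using assms by simp
qed

text \<open>If \<open>\<tau>\<close> violated \<open>E\<close>, the clause over
  \<open>cvars E\<close> falsified by \<open>\<tau>\<close> would be in \<open>F\<close>, and after
  applying \<open>\<psi>\<close> only a literal over \<open>u\<close> could remain of it: a unit
  clause or a conflict.\<close>

lemma unit_free_xor_holds:
  assumes "X0_clause E \<subseteq> F" "is_clause E" "unit_free (\<psi> \<star> F)" "extends \<tau> \<psi>"
    and "cvars E \<subseteq> insert u (dom \<psi>)"
  shows "xor_holds \<tau> E"
proof (rule ccontr)
  assume neg: "\<not> xor_holds \<tau> E"
  let ?D = "falsified_clause \<tau> (cvars E)"
  have "?D \<in> X0_clause E" using neg by (simp only: falsified_in_X0_clause_iff[OF assms(2)] not_False_eq_True)
  then have D: "?D \<in> F" using assms(1) by blast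
  have val: "lit_value \<psi> x \<noteq> Some True" if "x \<in> ?D" for x
    using that extends_lit_value[OF assms(4), of x True] by (auto simp: falsified_clause_def)
  let ?R = "{x \<in> ?D. lit_value \<psi> x \<noteq> Some False}"
  let ?x = "if \<tau> u then Neg u else Pos u"
  have R: "?R \<in> \<psi> \<star> F" using D val by (rule apply_passI)
  have "x = ?x" if x: "x \<in> ?R" for x
  proof (rule literal_eqI)
    have "lit_value \<psi> x = None" using val x by (cases "lit_value \<psi> x") auto
    then have "lvar x \<notin> dom \<psi>" by (cases x) auto
    moreover have "lvar x \<in> cvars E" using x by (simp add: falsified_clause_def)
    ultimately show "lvar x = lvar ?x" using assms(5) by auto
    show "lit_holds \<tau> x = lit_holds \<tau> ?x" using x by (simp add: falsified_clause_def)
  qed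
  then have "?R \<subseteq> {?x}" by blast
  then show False using assms(3) R unfolding unit_free_def by blast
qed

text \<open>Were \<open>u\<close> unassigned, both of its values would satisfy \<open>E\<close>,
  although switching one variable changes the parity.\<close>

lemma unit_free_dom:
  assumes "X0_clause E \<subseteq> F" "is_clause E" "unit_free (\<psi> \<star> F)"
    and "cvars E \<subseteq> insert u (dom \<psi>)"
  shows "cvars E \<subseteq> dom \<psi>"
proof (rule ccontr)
  assume "\<not> cvars E \<subseteq> dom \<psi>"
  then have u: "u \<in> cvars E" "\<psi> u = None" using assms(4) by auto
  have "xor_holds ((\<lambda>v. the (\<psi> v))(u := b)) E" for b
  proof (rule unit_free_xor_holds[OF assms(1-3) _ assms(4)])
    show "extends ((\<lambda>v. the (\<psi> v))(u := b)) \<psi>" using u by (auto simp: extends_def)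
  qed
  then show False
    using odd_card_flip[OF finite_cvars[OF assms(2)] u(1), of "\<lambda>v. the (\<psi> v)"]
    unfolding xor_holds_iff_vars[OF assms(2)] by blast
qed

section \<open>Solvability of XOR-systems\<close>

text \<open>Gaussian elimination without matrices: \<open>A\<close> is the set of variables whose
  values are final, and it grows by one variable at a time. When it contains all variables, the
  hypothesis for the singletons \<open>{C}\<close> is the claim.\<close>

lemma xor_system_solvable:
  assumes F: "clause_set F"
    and closed: "\<And>G. G \<subseteq> F \<Longrightarrow> odd_vars G \<subseteq> A \<Longrightarrow> even (card {C \<in> G. \<not> xor_holds \<tau> C})"
  shows "\<exists>\<tau>'. (\<forall>v\<in>A. \<tau>' v = \<tau> v) \<and> (\<forall>C\<in>F. xor_holds \<tau>' C)"
  using closed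
proof (induction "card (vars F - A)" arbitrary: A \<tau> rule: less_induct)
  case less
  note closed = less.prems
  have finV: "finite (vars F)" using finite_vars[OF F] .
  have finG: "finite G" "finite (odd_vars G)" "clause_set G" if "G \<subseteq> F" for G
  proof -
    show "clause_set G" using clause_set_subset[OF F that] .
    then show "finite G" by (simp add: clause_set_def)
    show "finite (odd_vars G)"
      using finite_subset[OF odd_vars_subset finite_vars[OF \<open>clause_set G\<close>]] .
  qed
  show ?case
  proof (cases "vars F \<subseteq> A")
    case True
    have "xor_holds \<tau> C" if C: "C \<in> F" for C
    proof (rule ccontr)
      assume "\<not> xor_holds \<tau> C"
      then have "{D \<in> {C}. \<not> xor_holds \<tau> D} = {C}" by auto
      moreover have "cvars C \<subseteq> A" using True C by (auto simp: vars_def)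
      ultimately show False using closed[of "{C}"] C by simp
    qed
    then show ?thesis by blast
  next
    case False
    then obtain v where v: "v \<in> vars F" "v \<notin> A" by blast
    obtain b where b: "\<And>G. G \<subseteq> F \<Longrightarrow> odd_vars G \<subseteq> insert v A \<Longrightarrow>
        even (card {C \<in> G. \<not> xor_holds (\<tau>(v := b)) C})"
    proof -
      have old: "even (card {C \<in> G. \<not> xor_holds (\<tau>(v := b)) C})"
        if "G \<subseteq> F" "odd_vars G \<subseteq> A" for G b
      proof -
        have "{w \<in> odd_vars G. (\<tau>(v := b)) w} = {w \<in> odd_vars G. \<tau> w}" using that v by auto
        then show ?thesis
          using closed[OF that] unfolding even_falsified_iff[OF finG(3)[OF that(1)]] by simp
      qed
      show thesis
      \<comment> \<open>If no sum within \<open>insert v A\<close> involves \<open>v\<close>, its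
        value is free; otherwise a single such sum dictates it on behalf of all others.\<close>
      proof (cases "\<exists>G0\<subseteq>F. odd_vars G0 \<subseteq> insert v A \<and> v \<in> odd_vars G0")
        case False
        show thesis
        proof (rule that[of True])
          fix G assume G: "G \<subseteq> F" "odd_vars G \<subseteq> insert v A"
          then have "odd_vars G \<subseteq> A" using False by blast
          with G(1) show "even (card {C \<in> G. \<not> xor_holds (\<tau>(v := True)) C})" by (rule old)
        qed
      next
        case True
        then obtain G0 where G0: "G0 \<subseteq> F" "odd_vars G0 \<subseteq> insert v A" "v \<in> odd_vars G0" by blast
        obtain b where b: "even (card {C \<in> G0. \<not> xor_holds (\<tau>(v := b)) C})"
          using odd_card_flip[OF finG(2)[OF G0(1)] G0(3), of \<tau>]
          unfolding even_falsified_iff[OF finG(3)[OF G0(1)]] by blast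
        have "even (card {C \<in> G. \<not> xor_holds (\<tau>(v := b)) C})"
          if G: "G \<subseteq> F" "odd_vars G \<subseteq> insert v A" for G
        proof (cases "v \<in> odd_vars G")
          case False
          then show ?thesis using old G by blast
        next
          case True
          let ?H = "sym_diff G G0"
          have "odd_vars ?H \<subseteq> A"
            using True G G0 by (auto simp: odd_vars_sym_diff[OF finG(1)[OF G(1)] finG(1)[OF G0(1)]])
          moreover have "?H \<subseteq> F" using G G0 by blast
          ultimately have "even (card {C \<in> ?H. \<not> xor_holds (\<tau>(v := b)) C})" using old by blast
          moreover have "{C \<in> ?H. \<not> xor_holds (\<tau>(v := b)) C} =
              sym_diff {C \<in> G. \<not> xor_holds (\<tau>(v := b)) C} {C \<in> G0. \<not> xor_holds (\<tau>(v := b)) C}"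
            by blast
          ultimately show ?thesis
            using b odd_card_sym_diff[of "{C \<in> G. \<not> xor_holds (\<tau>(v := b)) C}"
                "{C \<in> G0. \<not> xor_holds (\<tau>(v := b)) C}"] finG(1)[OF G(1)] finG(1)[OF G0(1)]
            by simp
        qed
        then show thesis by (rule that)
      qed
    qed
    have "vars F - insert v A \<subset> vars F - A" using v by blast
    then have "card (vars F - insert v A) < card (vars F - A)"
      using finV by (intro psubset_card_mono) auto
    from less.hyps[OF this b] obtain \<tau>' where
      "\<forall>w\<in>insert v A. \<tau>' w = (\<tau>(v := b)) w" "\<forall>C\<in>F. xor_holds \<tau>' C" by blast
    then show ?thesis using v by (intro exI[of _ \<tau>']) auto
  qed
qed

section \<open>Natural splittings\<close>

lemma natural_splitting_short: "length xs \<le> 2 \<Longrightarrow> natural_splitting xs y = {set xs}"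
  by (simp add: natural_splitting_def)

text \<open>The list counts literals from 0, the definition from 1. After the shift a middle clause
  is a recursion step from \<open>y i\<close> to \<open>y (Suc i)\<close> by the literal at position
  \<open>i\<close>.\<close>

lemma natural_splitting_long:
  assumes "3 \<le> length xs"
  shows "natural_splitting xs y =
    insert {xs ! 0, xs ! 1, Pos (y 2)} (insert {Pos (y (length xs - 1)), xs ! (length xs - 1)}
      ((\<lambda>i. {Pos (y i), xs ! i, Pos (y (Suc i))}) ` {2..<length xs - 1}))"
proof -
  have "{{Pos (y (i - 1)), xs ! (i - 1), Pos (y i)} | i. 3 \<le> i \<and> i \<le> length xs - 1} =
    (\<lambda>i. {Pos (y i), xs ! i, Pos (y (Suc i))}) ` {2..<length xs - 1}" (is "?l = ?r")
  proof
    show "?l \<subseteq> ?r"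
    proof
      fix E assume "E \<in> ?l"
      then obtain i where "E = {Pos (y (i - 1)), xs ! (i - 1), Pos (y i)}" "3 \<le> i" "i \<le> length xs - 1"
        by blast
      then show "E \<in> ?r" by (intro image_eqI[of _ _ "i - 1"]) auto
    qed
    show "?r \<subseteq> ?l"
    proof
      fix E assume "E \<in> ?r"
      then obtain i where "E = {Pos (y i), xs ! i, Pos (y (Suc i))}" "2 \<le> i" "i < length xs - 1"
        by auto
      then show "E \<in> ?l" by (intro CollectI exI[of _ "Suc i"]) simp
    qed
  qed
  then show ?thesis using assms unfolding natural_splitting_def Let_def
    by (auto simp: numeral_2_eq_2)
qed

text \<open>Freshness from the point of view of one clause; that different clauses have different
  new variables matters when all splittings are satisfied simultaneously.\<close>

definition fresh_splitting :: "'v literal list \<Rightarrow> (nat \<Rightarrow> 'v) \<Rightarrow> bool" where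
  "fresh_splitting xs y \<longleftrightarrow> distinct xs \<and> is_clause (set xs) \<and>
     inj_on y {2..length xs - 1} \<and> y ` {2..length xs - 1} \<inter> cvars (set xs) = {}"

lemma fresh_splitting_lvar_eq:
  assumes "fresh_splitting xs y" "i < length xs" "j < length xs"
  shows "lvar (xs ! i) = lvar (xs ! j) \<longleftrightarrow> i = j"
  using assms unfolding fresh_splitting_def is_clause_iff_inj_on
  by (metis inj_onD nth_eq_iff_index_eq nth_mem)

lemma fresh_splitting_lvar_neq:
  assumes "fresh_splitting xs y" "i < length xs" "2 \<le> j" "j < length xs"
  shows "lvar (xs ! i) \<noteq> y j" "y j \<noteq> lvar (xs ! i)" "xs ! i \<noteq> Pos (y j)" "Pos (y j) \<noteq> xs ! i"
proof -
  have "lvar (xs ! i) \<in> cvars (set xs)" using assms by (simp add: cvars_def)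
  moreover have "y j \<in> y ` {2..length xs - 1}" using assms by auto
  ultimately show "lvar (xs ! i) \<noteq> y j" using assms unfolding fresh_splitting_def by fastforce
  then show "y j \<noteq> lvar (xs ! i)" "xs ! i \<noteq> Pos (y j)" "Pos (y j) \<noteq> xs ! i"
    by (metis literal.sel(1))+
qed

lemma fresh_splitting_y_neq:
  assumes "fresh_splitting xs y" "2 \<le> i" "Suc i < length xs"
  shows "y i \<noteq> y (Suc i)"
  using assms unfolding fresh_splitting_def inj_on_def by fastforce

lemma is_clause_natural_splitting:
  assumes fr: "fresh_splitting xs y" and E: "E \<in> natural_splitting xs y"
  shows "is_clause E"
proof (cases "length xs \<le> 2")
  case True
  then show ?thesis using assms by (simp add: natural_splitting_short fresh_splitting_def)
next
  case False
  then have n: "3 \<le> length xs" by simp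
  then have len: "0 < length xs" "1 < length xs" by linarith+
  from E[unfolded natural_splitting_long[OF n]] consider
    "E = {xs ! 0, xs ! 1, Pos (y 2)}" | "E = {Pos (y (length xs - 1)), xs ! (length xs - 1)}"
    | i where "2 \<le> i" "i < length xs - 1" "E = {Pos (y i), xs ! i, Pos (y (Suc i))}"
    by auto
  then show ?thesis
  proof cases
    case 1
    have "lvar (xs ! 0) \<noteq> lvar (xs ! 1)" using fresh_splitting_lvar_eq[OF fr, of 0 1] len by simp
    moreover have "lvar (xs ! 0) \<noteq> y 2" "lvar (xs ! 1) \<noteq> y 2"
      using fresh_splitting_lvar_neq(1)[OF fr len(1), of 2] fresh_splitting_lvar_neq(1)[OF fr len(2), of 2] n by auto
    ultimately show ?thesis unfolding 1 is_clause_iff_inj_on by auto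
  next
    case 2
    have "lvar (xs ! (length xs - 1)) \<noteq> y (length xs - 1)"
      using fresh_splitting_lvar_neq(1)[OF fr, of "length xs - 1" "length xs - 1"] n by auto
    then show ?thesis unfolding 2 is_clause_iff_inj_on by auto
  next
    case (3 i)
    have "lvar (xs ! i) \<noteq> y i" "lvar (xs ! i) \<noteq> y (Suc i)"
      using fresh_splitting_lvar_neq(1)[OF fr, of i] 3 by auto
    then show ?thesis using fresh_splitting_y_neq[OF fr, of i] 3
      unfolding 3(3) is_clause_iff_inj_on by auto
  qed
qed

lemma vars_natural_splitting:
  "vars (natural_splitting xs y) = cvars (set xs) \<union> (if 3 \<le> length xs then y ` {2..length xs - 1} else {})"
proof (cases "3 \<le> length xs")
  case False
  then show ?thesis by (simp add: natural_splitting_short vars_def)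
next
  case n: True
  have "vars (natural_splitting xs y) =
      {lvar (xs ! 0), lvar (xs ! 1), y 2} \<union> {y (length xs - 1), lvar (xs ! (length xs - 1))} \<union>
      (\<Union>i\<in>{2..<length xs - 1}. {y i, lvar (xs ! i), y (Suc i)})"
    by (simp add: natural_splitting_long[OF n] vars_def cvars_def Un_assoc insert_commute)
  also have "\<dots> = (\<lambda>i. lvar (xs ! i)) ` {..<length xs} \<union> y ` {2..length xs - 1}" (is "?l = ?r")
  proof
    show "?l \<subseteq> ?r" using n by auto
    have "lvar (xs ! i) \<in> ?l" if i: "i < length xs" for i
    proof -
      consider "i = 0" | "i = 1" | "i = length xs - 1" | "i \<in> {2..<length xs - 1}" using i by fastforce
      then show ?thesis by cases auto
    qed
    moreover have "y i \<in> ?l" if i: "i \<in> {2..length xs - 1}" for i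
    proof -
      consider "i = length xs - 1" | "i \<in> {2..<length xs - 1}" using i by fastforce
      then show ?thesis by cases auto
    qed
    ultimately show "?r \<subseteq> ?l" by blast
  qed
  also have "(\<lambda>i. lvar (xs ! i)) ` {..<length xs} = cvars (set xs)"
    by (auto simp: cvars_def set_conv_nth)
  finally show ?thesis using n by simp
qed

section \<open>Parities of prefixes\<close>

lemma xor_holds_empty [simp]: "xor_holds \<tau> {}"
  by (simp add: xor_holds_def)

lemma xor_holds_insert [simp]:
  assumes "finite C" "x \<notin> C"
  shows "xor_holds \<tau> (insert x C) \<longleftrightarrow> lit_holds \<tau> x \<noteq> xor_holds \<tau> C"
proof -
  have "{z \<in> insert x C. lit_holds \<tau> z} =
      (if lit_holds \<tau> x then insert x {z \<in> C. lit_holds \<tau> z} else {z \<in> C. lit_holds \<tau> z})" by auto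
  then show ?thesis using assms by (simp add: xor_holds_def)
qed

text \<open>The value that the splitting forces upon the new variable \<open>y i\<close>.\<close>

definition prefix_parity :: "('v \<Rightarrow> bool) \<Rightarrow> 'v literal list \<Rightarrow> nat \<Rightarrow> bool" where
  "prefix_parity \<tau> xs i \<longleftrightarrow> odd (length (filter (lit_holds \<tau>) (take i xs)))"

lemma prefix_parity_Suc:
  "i < length xs \<Longrightarrow> prefix_parity \<tau> xs (Suc i) \<longleftrightarrow> prefix_parity \<tau> xs i \<noteq> lit_holds \<tau> (xs ! i)"
  by (simp add: prefix_parity_def take_Suc_conv_app_nth)

lemma xor_holds_iff_prefix_parity:
  assumes "distinct xs"
  shows "xor_holds \<tau> (set xs) \<longleftrightarrow> \<not> prefix_parity \<tau> xs (length xs)"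
proof -
  have "card {x \<in> set xs. lit_holds \<tau> x} = length (filter (lit_holds \<tau>) xs)"
    using assms by (metis distinct_card distinct_filter set_filter)
  then show ?thesis by (simp add: xor_holds_def prefix_parity_def)
qed

text \<open>The first clause fixes \<open>y 2\<close>, each middle clause computes the next new
  variable, and the last one equates the final new variable with the last literal, which is the
  original constraint. For at most two literals the index range is empty.\<close>

lemma xor_holds_natural_splitting_iff:
  assumes fr: "fresh_splitting xs y"
  shows "(\<forall>E\<in>natural_splitting xs y. xor_holds \<tau> E) \<longleftrightarrow>
    xor_holds \<tau> (set xs) \<and> (\<forall>i\<in>{2..length xs - 1}. \<tau> (y i) \<longleftrightarrow> prefix_parity \<tau> xs i)"
proof (cases "length xs \<le> 2")
  case True
  then show ?thesis by (simp add: natural_splitting_short)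
next
  case False
  then have n: "3 \<le> length xs" by simp
  then have len: "0 < length xs" "1 < length xs" by linarith+
  let ?n = "length xs" and ?p = "prefix_parity \<tau> xs" and ?h = "\<lambda>i. lit_holds \<tau> (xs ! i)"
  have dist: "distinct xs" using fr by (simp add: fresh_splitting_def)
  have p2: "?p 2 \<longleftrightarrow> ?h 0 \<noteq> ?h 1"
  proof -
    have "\<not> ?p 0" by (simp add: prefix_parity_def)
    then show ?thesis
      using prefix_parity_Suc[OF len(1), of \<tau>] prefix_parity_Suc[OF len(2), of \<tau>]
      by (simp add: numeral_2_eq_2)
  qed
  have pn: "?p ?n \<longleftrightarrow> ?p (?n - 1) \<noteq> ?h (?n - 1)"
    using prefix_parity_Suc[of "?n - 1" xs \<tau>] len(1) by simp
  have first: "xor_holds \<tau> {xs ! 0, xs ! 1, Pos (y 2)} \<longleftrightarrow> (\<tau> (y 2) \<longleftrightarrow> ?p 2)"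
  proof -
    have "xs ! 0 \<noteq> xs ! 1" using nth_eq_iff_index_eq[OF dist len] by simp
    moreover have "xs ! 0 \<noteq> Pos (y 2)" "xs ! 1 \<noteq> Pos (y 2)"
      using fresh_splitting_lvar_neq(3)[OF fr len(1), of 2] fresh_splitting_lvar_neq(3)[OF fr len(2), of 2] n by auto
    ultimately show ?thesis using p2 by auto
  qed
  have last: "xor_holds \<tau> {Pos (y (?n - 1)), xs ! (?n - 1)} \<longleftrightarrow> (\<tau> (y (?n - 1)) \<longleftrightarrow> ?h (?n - 1))"
    using fresh_splitting_lvar_neq(4)[OF fr, of "?n - 1" "?n - 1"] n by auto
  have mid: "xor_holds \<tau> {Pos (y i), xs ! i, Pos (y (Suc i))} \<longleftrightarrow>
      (\<tau> (y (Suc i)) \<longleftrightarrow> \<tau> (y i) \<noteq> ?h i)" if "2 \<le> i" "i < ?n - 1" for i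
  proof -
    have "xs ! i \<noteq> Pos (y (Suc i))" "Pos (y i) \<noteq> xs ! i"
      using fresh_splitting_lvar_neq(3,4)[OF fr, of i] that by auto
    moreover have "y i \<noteq> y (Suc i)" using fresh_splitting_y_neq[OF fr, of i] that by auto
    ultimately show ?thesis by auto
  qed
  have "(\<forall>E\<in>natural_splitting xs y. xor_holds \<tau> E) \<longleftrightarrow> (\<tau> (y 2) \<longleftrightarrow> ?p 2) \<and>
      (\<tau> (y (?n - 1)) \<longleftrightarrow> ?h (?n - 1)) \<and>
      (\<forall>i\<in>{2..<?n - 1}. \<tau> (y (Suc i)) \<longleftrightarrow> \<tau> (y i) \<noteq> ?h i)" (is "_ \<longleftrightarrow> ?R")
    unfolding natural_splitting_long[OF n] ball_simps first last using mid by simp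
  also have "?R \<longleftrightarrow> \<not> ?p ?n \<and> (\<forall>i\<in>{2..?n - 1}. \<tau> (y i) \<longleftrightarrow> ?p i)"
  proof
    assume R: ?R
    have *: "\<tau> (y i) \<longleftrightarrow> ?p i" if "2 \<le> i" "i \<le> ?n - 1" for i
      using that
    proof (induction i rule: nat_induct_at_least)
      case (Suc i)
      then show ?case using R prefix_parity_Suc[of i xs \<tau>] by auto
    qed (use R in simp)
    then show "\<not> ?p ?n \<and> (\<forall>i\<in>{2..?n - 1}. \<tau> (y i) \<longleftrightarrow> ?p i)" using pn R n by simp
  next
    assume R: "\<not> ?p ?n \<and> (\<forall>i\<in>{2..?n - 1}. \<tau> (y i) \<longleftrightarrow> ?p i)"
    have "\<tau> (y (Suc i)) \<longleftrightarrow> \<tau> (y i) \<noteq> ?h i" if "i \<in> {2..<?n - 1}" for i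
    proof -
      have "i < length xs" using that unfolding atLeastLessThan_iff by linarith
      then show ?thesis using R that prefix_parity_Suc[of i xs \<tau>] by auto
    qed
    then show ?R using R pn n by auto
  qed
  finally show ?thesis by (simp add: xor_holds_iff_prefix_parity[OF dist])
qed

text \<open>
  Unit propagation along the chain: values move right from the first literal and left from the
  last one, and meet at the only literal that may still be unassigned.
\<close>

lemma unit_free_natural_splitting:
  assumes fr: "fresh_splitting xs y" and X: "X0 (natural_splitting xs y) \<subseteq> F"
    and uf: "unit_free (\<psi> \<star> F)" and dom: "cvars (set xs) \<subseteq> insert u (dom \<psi>)"
  shows "vars (natural_splitting xs y) \<subseteq> dom \<psi>"
proof -
  have propagate: "cvars E \<subseteq> dom \<psi>" if "E \<in> natural_splitting xs y" "cvars E \<subseteq> insert w (dom \<psi>)" for E w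
  proof (rule unit_free_dom[OF _ _ uf that(2)])
    show "X0_clause E \<subseteq> F" using X that(1) by (auto simp: X0_def)
    show "is_clause E" using is_clause_natural_splitting[OF fr that(1)] .
  qed
  have "y i \<in> dom \<psi>" if n: "3 \<le> length xs" and i: "2 \<le> i" "i \<le> length xs - 1" for i
  proof -
    let ?n = "length xs"
    note long = natural_splitting_long[OF n, of y]
    have left: "y i \<in> dom \<psi>" if "2 \<le> i" "i \<le> ?n - 1" "\<And>j. j < i \<Longrightarrow> lvar (xs ! j) \<in> dom \<psi>" for i
      using that
    proof (induction i rule: nat_induct_at_least)
      case base
      have "cvars {xs ! 0, xs ! 1, Pos (y 2)} \<subseteq> dom \<psi>"
        by (rule propagate[of _ "y 2"]) (use base in \<open>simp_all add: long cvars_def\<close>)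
      then show ?case by (simp add: cvars_def)
    next
      case (Suc i)
      have "y i \<in> dom \<psi>" using Suc by simp
      then have "cvars {Pos (y i), xs ! i, Pos (y (Suc i))} \<subseteq> dom \<psi>"
        using Suc by (intro propagate[of _ "y (Suc i)"]) (auto simp: long cvars_def)
      then show ?case by (simp add: cvars_def)
    qed
    have right: "y i \<in> dom \<psi>" if "i \<le> ?n - 1" "2 \<le> i" "\<And>j. i \<le> j \<Longrightarrow> j < ?n \<Longrightarrow> lvar (xs ! j) \<in> dom \<psi>" for i
      using that
    proof (induction i rule: inc_induct)
      case base
      have "cvars {Pos (y (?n - 1)), xs ! (?n - 1)} \<subseteq> dom \<psi>"
        by (rule propagate[of _ "y (?n - 1)"]) (use base n in \<open>simp_all add: long cvars_def\<close>)
      then show ?case by (simp add: cvars_def)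
    next
      case (step i)
      have "y (Suc i) \<in> dom \<psi>" using step by simp
      then have "cvars {Pos (y i), xs ! i, Pos (y (Suc i))} \<subseteq> dom \<psi>"
        using step by (intro propagate[of _ "y i"]) (auto simp: long cvars_def)
      then show ?case by (simp add: cvars_def)
    qed
    have in_dom: "lvar (xs ! j) \<in> dom \<psi>" if "j < ?n" "lvar (xs ! j) \<noteq> u" for j
      using dom that nth_mem[of j xs] unfolding cvars_def by blast
    show ?thesis
    proof (cases "\<exists>k<?n. lvar (xs ! k) = u")
      case False
      have "lvar (xs ! j) \<in> dom \<psi>" if "j < i" for j
        using in_dom[of j] False that i by auto
      then show ?thesis using left i by blast
    next
      case True
      then obtain k where k: "k < ?n" "lvar (xs ! k) = u" by blast
      have "lvar (xs ! j) \<in> dom \<psi>" if "j < ?n" "j \<noteq> k" for j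
        using in_dom[of j] fresh_splitting_lvar_eq[OF fr, of j k] k that by auto
      \<comment> \<open>\<open>y i\<close> summarises the positions below \<open>i\<close>, so from
        the left it is reached if \<open>i \<le> k\<close>, and from the right, using the positions
        from \<open>i\<close> on, if \<open>k < i\<close>.\<close>
      then show ?thesis using left[of i] right[of i] i k(1) by (cases "i \<le> k") auto
    qed
  qed
  then have "y ` {2..length xs - 1} \<subseteq> dom \<psi>" if "3 \<le> length xs"
    using that by (intro image_subsetI) simp
  \<comment> \<open>Now only \<open>u\<close> can be missing, and one more propagation inside a
    clause of the splitting assigns it.\<close>
  then have sub: "vars (natural_splitting xs y) \<subseteq> insert u (dom \<psi>)"
    using dom unfolding vars_natural_splitting by auto
  have "cvars E \<subseteq> dom \<psi>" if "E \<in> natural_splitting xs y" for E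
    using propagate[OF that, of u] sub that by (auto simp: vars_def)
  then show ?thesis by (auto simp: vars_def)
qed

section \<open>The forcing representation\<close>

lemma splitting_choice_fresh:
  assumes sc: "splitting_choice H ord y" and H: "clause_set H" and C: "C \<in> H"
  shows "fresh_splitting (ord C) (y C)"
proof -
  have ord: "distinct (ord C)" "set (ord C) = C" using sc C by (auto simp: splitting_choice_def)
  then have len: "length (ord C) = card C" using distinct_card by force
  let ?I = "SIGMA C:H. {2..card C - 1}"
  have inj: "inj_on (\<lambda>(C, i). y C i) ?I" and disj: "(\<lambda>(C, i). y C i) ` ?I \<inter> vars H = {}"
    using sc by (simp_all add: splitting_choice_def Let_def)
  have "inj_on (y C) {2..card C - 1}"
  proof (rule inj_onI)
    fix i j assume "i \<in> {2..card C - 1}" "j \<in> {2..card C - 1}" "y C i = y C j"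
    then show "i = j" using inj_onD[OF inj, of "(C, i)" "(C, j)"] C by simp
  qed
  moreover have "y C i \<notin> cvars C" if "i \<in> {2..card C - 1}" for i
  proof -
    have "(C, i) \<in> ?I" using that C by simp
    then have "y C i \<in> (\<lambda>(C, i). y C i) ` ?I" by (metis (no_types, lifting) case_prod_conv image_eqI)
    then show ?thesis using disj C unfolding vars_def by blast
  qed
  ultimately show ?thesis using ord len H C by (auto simp: fresh_splitting_def clause_set_def)
qed

lemma models_X1_iff:
  assumes "splitting_choice H ord y" "clause_set H"
  shows "models \<tau> (X1 ord y H) \<longleftrightarrow>
    (\<forall>C\<in>H. \<forall>E\<in>natural_splitting (ord C) (y C). xor_holds \<tau> E)"
proof -
  have "models \<tau> (X1 ord y H) \<longleftrightarrow> (\<forall>C\<in>H. models \<tau> (X0 (natural_splitting (ord C) (y C))))"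
    by (auto simp: models_def X1_def)
  moreover have "models \<tau> (X0 (natural_splitting (ord C) (y C))) \<longleftrightarrow>
      (\<forall>E\<in>natural_splitting (ord C) (y C). xor_holds \<tau> E)" if "C \<in> H" for C
    using is_clause_natural_splitting[OF splitting_choice_fresh[OF assms that]]
    by (rule models_X0_iff)
  ultimately show ?thesis by blast
qed

lemma models_X1_xor_holds:
  assumes "splitting_choice H ord y" "clause_set H" "models \<tau> (X1 ord y H)" "C \<in> H"
  shows "xor_holds \<tau> C"
proof -
  have "set (ord C) = C" using assms by (auto simp: splitting_choice_def)
  then show ?thesis
    using assms(3,4) xor_holds_natural_splitting_iff[OF splitting_choice_fresh[OF assms(1,2,4)], of \<tau>]
    unfolding models_X1_iff[OF assms(1,2)] by simp
qed

lemma lit_holds_cong: "\<tau> (lvar x) = \<tau>' (lvar x) \<Longrightarrow> lit_holds \<tau> x = lit_holds \<tau>' x"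
  by (cases x) auto

lemma xor_holds_cong: 
  assumes "\<And>v. v \<in> cvars C \<Longrightarrow> \<tau> v = \<tau>' v"
  shows "xor_holds \<tau> C = xor_holds \<tau>' C"
proof -
  have "{x \<in> C. lit_holds \<tau> x} = {x \<in> C. lit_holds \<tau>' x}"
    using lit_holds_cong[of \<tau> _ \<tau>'] assms unfolding cvars_def by blast
  then show ?thesis by (simp add: xor_holds_def)
qed

text \<open>The new variables receive their prefix parities, computed from the values of the
  original variables.\<close>

lemma extend_to_model_X1:
  assumes sc: "splitting_choice H ord y" and H: "clause_set H" and holds: "\<forall>C\<in>H. xor_holds \<tau> C"
  shows "\<exists>\<tau>'. (\<forall>v\<in>vars H. \<tau>' v = \<tau> v) \<and> models \<tau>' (X1 ord y H)"
proof -
  let ?I = "SIGMA C:H. {2..card C - 1}" and ?y = "\<lambda>(C, i). y C i"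
  have inj: "inj_on ?y ?I" and disj: "?y ` ?I \<inter> vars H = {}"
    using sc by (simp_all add: splitting_choice_def Let_def)
  \<comment> \<open>A new variable determines its clause and index because the new variables of
    different clauses are disjoint; \<open>the_inv_into\<close> recovers both.\<close>
  define \<tau>' where "\<tau>' v = (if v \<in> ?y ` ?I
      then (\<lambda>(C, i). prefix_parity \<tau> (ord C) i) (the_inv_into ?I ?y v) else \<tau> v)" for v
  have old: "\<tau>' v = \<tau> v" if "v \<in> vars H" for v
    using disj that unfolding \<tau>'_def by (subst if_not_P) auto
  have new: "\<tau>' (y C i) \<longleftrightarrow> prefix_parity \<tau> (ord C) i" if "C \<in> H" "i \<in> {2..card C - 1}" for C i
  proof -
    have CI: "(C, i) \<in> ?I" using that by simp
    then have "?y (C, i) \<in> ?y ` ?I" by (rule imageI)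
    moreover have "the_inv_into ?I ?y (?y (C, i)) = (C, i)" by (rule the_inv_into_f_f[OF inj CI])
    ultimately show ?thesis unfolding \<tau>'_def by simp
  qed
  have "models \<tau>' (X1 ord y H)"
    unfolding models_X1_iff[OF sc H]
  proof
    fix C assume C: "C \<in> H"
    have ord: "distinct (ord C)" "set (ord C) = C" using sc C by (auto simp: splitting_choice_def)
    then have len: "length (ord C) = card C" using distinct_card by force
    have old_C: "\<tau>' v = \<tau> v" if "v \<in> cvars C" for v using old C that by (auto simp: vars_def)
    then have "xor_holds \<tau>' C" using holds C xor_holds_cong[of C \<tau>' \<tau>] by blast
    moreover have "prefix_parity \<tau>' (ord C) i = prefix_parity \<tau> (ord C) i" for i
    proof -
      have "lit_holds \<tau>' x = lit_holds \<tau> x" if "x \<in> set (take i (ord C))" for x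
      proof (rule lit_holds_cong)
        have "x \<in> C" using in_set_takeD[OF that] ord by simp
        then show "\<tau>' (lvar x) = \<tau> (lvar x)" using old_C by (simp add: cvars_def)
      qed
      then have "filter (lit_holds \<tau>') (take i (ord C)) = filter (lit_holds \<tau>) (take i (ord C))"
        by (rule filter_cong[OF refl])
      then show ?thesis by (simp add: prefix_parity_def)
    qed
    ultimately show "\<forall>E\<in>natural_splitting (ord C) (y C). xor_holds \<tau>' E"
      using xor_holds_natural_splitting_iff[OF splitting_choice_fresh[OF sc H C], of \<tau>']
        new[OF C] ord len by simp
  qed
  then show ?thesis using old by blast
qed

lemma clause_set_X1:
  assumes "splitting_choice H ord y" "clause_set H"
  shows "clause_set (X1 ord y H)"
proof -
  have "clause_set (X0_clause E)" if "C \<in> H" "E \<in> natural_splitting (ord C) (y C)" for C E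
    using clause_set_X0_clause is_clause_natural_splitting[OF splitting_choice_fresh[OF assms]] that
    by blast
  moreover have "finite (natural_splitting xs z)" for xs and z :: "nat \<Rightarrow> 'a"
    by (cases "length xs \<le> 2") (simp_all add: natural_splitting_short natural_splitting_long)
  ultimately show ?thesis
    using assms(2) unfolding clause_set_def X1_def X0_def by auto
qed

lemma vars_X1:
  assumes "splitting_choice H ord y" "clause_set H"
  shows "vars (X1 ord y H) = (\<Union>C\<in>H. vars (natural_splitting (ord C) (y C)))"
proof -
  have "vars (X1 ord y H) = (\<Union>C\<in>H. \<Union>E\<in>natural_splitting (ord C) (y C). vars (X0_clause E))"
    unfolding vars_def X1_def X0_def by blast
  also have "\<dots> = (\<Union>C\<in>H. \<Union>E\<in>natural_splitting (ord C) (y C). cvars E)"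
    using vars_X0_clause[OF is_clause_natural_splitting[OF splitting_choice_fresh[OF assms]]] by simp
  finally show ?thesis by (simp add: vars_def)
qed

lemma card_xor_closure_le: "finite F \<Longrightarrow> card (xor_closure S F) \<le> 2 ^ card F"
proof -
  assume "finite F"
  moreover have "xor_closure S F = S ` Pow F" by (auto simp: xor_closure_def)
  ultimately show ?thesis using card_image_le[of "Pow F" S] by (simp add: card_Pow)
qed

lemma forcing_representation_X1:
  assumes F: "clause_set F" and sat: "xor_satisfiable F" and S: "is_xor_sum S"
    and sc: "splitting_choice (xor_closure S F) ord y"
  shows "forcing_representation F (X1 ord y (xor_closure S F))"
proof -
  let ?H = "xor_closure S F"
  let ?X = "X1 ord y ?H"
  have G: "clause_set G" "xor_consistent G" if "G \<subseteq> F" for G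
    using clause_set_subset[OF F that] xor_satisfiable_consistent[OF F sat that] .
  have SG: "is_clause (S G)" "cvars (S G) = odd_vars G" if "G \<subseteq> F" for G
    using S G[OF that] unfolding is_xor_sum_def by blast+
  have sum_iff: "xor_holds \<tau> (S G) \<longleftrightarrow> even (card {C \<in> G. \<not> xor_holds \<tau> C})" if "G \<subseteq> F" for G \<tau>
    using xor_holds_sum_iff[OF S G[OF that]] .
  have S_in: "S G \<in> ?H" if "G \<subseteq> F" for G using that by (auto simp: xor_closure_def)
  have "finite ?H" using F unfolding xor_closure_def clause_set_def by simp
  then have H: "clause_set ?H" using SG by (auto simp: clause_set_def xor_closure_def)
  have X: "clause_set ?X" using clause_set_X1[OF sc H] .
  have vars_H: "vars ?H = vars F"
  proof
    show "vars ?H \<subseteq> vars F"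
    proof
      fix v assume "v \<in> vars ?H"
      then obtain G where "G \<subseteq> F" "v \<in> odd_vars G" using SG by (auto simp: vars_def xor_closure_def)
      then show "v \<in> vars F" using odd_vars_subset[of G] unfolding vars_def by blast
    qed
    show "vars F \<subseteq> vars ?H"
    proof
      fix v assume "v \<in> vars F"
      then obtain C where C: "C \<in> F" "v \<in> cvars C" by (auto simp: vars_def)
      then have "v \<in> cvars (S {C})" using SG(2)[of "{C}"] by simp
      then show "v \<in> vars ?H" using S_in[of "{C}"] C by (auto simp: vars_def)
    qed
  qed
  \<comment> \<open>\<open>C\<close> itself need not belong to the closure; \<open>S {C}\<close>
    represents it, possibly with other literals complemented.\<close>
  have F_of_X: "xor_holds \<tau> C" if "models \<tau> ?X" "C \<in> F" for \<tau> C
  proof (rule ccontr)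
    assume "\<not> xor_holds \<tau> C"
    then have "{D \<in> {C}. \<not> xor_holds \<tau> D} = {C}" by auto
    moreover have "xor_holds \<tau> (S {C})"
      by (rule models_X1_xor_holds[OF sc H that(1) S_in]) (use that in simp)
    ultimately show False using sum_iff[of "{C}" \<tau>] that by simp
  qed
  have X_of_F: "\<exists>\<tau>'. (\<forall>v\<in>vars F. \<tau>' v = \<tau> v) \<and> models \<tau>' ?X" if "\<forall>C\<in>F. xor_holds \<tau> C" for \<tau>
  proof -
    have "xor_holds \<tau> (S G)" if "G \<subseteq> F" for G
    proof -
      have "{C \<in> G. \<not> xor_holds \<tau> C} = {}" using \<open>\<forall>C\<in>F. xor_holds \<tau> C\<close> that by auto
      then show ?thesis using sum_iff[OF that, of \<tau>] by (metis card.empty even_zero)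
    qed
    then have "\<forall>C\<in>?H. xor_holds \<tau> C" by (auto simp: xor_closure_def)
    then show ?thesis using extend_to_model_X1[OF sc H] vars_H by simp
  qed
  have split_dom: "vars (natural_splitting (ord C) (y C)) \<subseteq> dom \<psi>"
    if uf: "unit_free (\<psi> \<star> ?X)" and C: "C \<in> ?H" "cvars C \<subseteq> insert u (dom \<psi>)" for \<psi> C u
  proof (rule unit_free_natural_splitting[OF splitting_choice_fresh[OF sc H C(1)] _ uf])
    show "X0 (natural_splitting (ord C) (y C)) \<subseteq> ?X" using C(1) by (auto simp: X1_def)
    show "cvars (set (ord C)) \<subseteq> insert u (dom \<psi>)" using sc C by (auto simp: splitting_choice_def)
  qed
  have sum_dom: "odd_vars G \<subseteq> dom \<psi>" "extends \<tau> \<psi> \<Longrightarrow> even (card {C \<in> G. \<not> xor_holds \<tau> C})"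
    if uf: "unit_free (\<psi> \<star> ?X)" and sub: "G \<subseteq> F" "odd_vars G \<subseteq> insert u (dom \<psi>)" for \<psi> G u \<tau>
  proof -
    let ?C = "S G"
    have C: "?C \<in> ?H" using S_in sub by blast
    have ord: "set (ord ?C) = ?C" using sc C by (auto simp: splitting_choice_def)
    have dom: "vars (natural_splitting (ord ?C) (y ?C)) \<subseteq> dom \<psi>"
      using split_dom[OF uf C, of u] SG(2)[OF sub(1)] sub(2) by simp
    then show "odd_vars G \<subseteq> dom \<psi>"
      using SG(2)[OF sub(1)] ord unfolding vars_natural_splitting by simp
    assume ext: "extends \<tau> \<psi>"
    have "xor_holds \<tau> E" if E: "E \<in> natural_splitting (ord ?C) (y ?C)" for E
    proof (rule unit_free_xor_holds[OF _ _ uf ext])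
      show "X0_clause E \<subseteq> ?X" using C E by (auto simp: X1_def X0_def)
      show "is_clause E" using is_clause_natural_splitting[OF splitting_choice_fresh[OF sc H C] E] .
      \<comment> \<open>Everything in \<open>E\<close> is assigned already, so the one exceptional
        variable that the rule admits can be arbitrary.\<close>
      show "cvars E \<subseteq> insert undefined (dom \<psi>)" using dom E by (auto simp: vars_def)
    qed
    then have "xor_holds \<tau> ?C"
      using xor_holds_natural_splitting_iff[OF splitting_choice_fresh[OF sc H C], of \<tau>] ord by simp
    then show "even (card {C \<in> G. \<not> xor_holds \<tau> C})" using sum_iff[OF sub(1)] by blast
  qed
  have model: "\<exists>\<tau>. extends \<tau> \<phi> \<and> models \<tau> ?X \<and> (\<psi> u = None \<longrightarrow> u \<in> vars F \<longrightarrow> \<tau> u = b)"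
    if uf: "unit_free (\<psi> \<star> ?X)" and \<phi>: "dom \<phi> \<subseteq> vars F" "\<phi> \<subseteq>\<^sub>m \<psi>"
      and ext: "\<forall>\<tau>. extends \<tau> \<phi> \<and> models \<tau> ?X \<longrightarrow> extends \<tau> \<psi>" for \<phi> \<psi> u b
  proof -
    \<comment> \<open>The default \<open>b\<close> gives an unassigned \<open>u\<close> the desired
      value. A sum over \<open>insert u (dom \<psi>)\<close> cannot contain such a \<open>u\<close>,
      so it holds for either \<open>b\<close>; the remaining defaults are not kept.\<close>
    define \<tau>0 where "\<tau>0 v = (case \<psi> v of None \<Rightarrow> b | Some c \<Rightarrow> c)" for v
    have ext0: "extends \<tau>0 \<psi>" by (simp add: extends_def \<tau>0_def)
    have "even (card {C \<in> G. \<not> xor_holds \<tau>0 C})" if "G \<subseteq> F" "odd_vars G \<subseteq> insert u (dom \<psi>)" for G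
      using sum_dom(2)[OF uf that ext0] .
    from xor_system_solvable[OF F this] obtain \<tau>1 where
      \<tau>1: "\<forall>v\<in>insert u (dom \<psi>). \<tau>1 v = \<tau>0 v" "\<forall>C\<in>F. xor_holds \<tau>1 C" by blast
    obtain \<tau> where \<tau>: "\<forall>v\<in>vars F. \<tau> v = \<tau>1 v" "models \<tau> ?X" using X_of_F[OF \<tau>1(2)] by blast
    have "extends \<tau> \<phi>"
      unfolding extends_def
    proof (intro allI impI)
      fix v c assume v: "\<phi> v = Some c"
      then have "\<psi> v = Some c" using \<phi>(2) by (metis domI map_le_def)
      moreover from this have "\<tau>1 v = \<tau>0 v" using \<tau>1(1) by blast
      ultimately have "\<tau>1 v = c" by (simp add: \<tau>0_def)
      moreover have "v \<in> vars F" using \<phi>(1) v by blast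
      ultimately show "\<tau> v = c" using \<tau>(1) by simp
    qed
    moreover have "\<tau> u = b" if "\<psi> u = None" "u \<in> vars F"
      using that \<tau>(1) \<tau>1(1) by (simp add: \<tau>0_def)
    ultimately show ?thesis using \<tau>(2) by (intro exI[of _ \<tau>]) simp
  qed
  have not_forced: "\<not> forced x (\<psi> \<star> ?X)"
    if uf: "unit_free (\<psi> \<star> ?X)" and \<phi>: "dom \<phi> \<subseteq> vars F" "\<phi> \<subseteq>\<^sub>m \<psi>"
      and ext: "\<forall>\<tau>. extends \<tau> \<phi> \<and> models \<tau> ?X \<longrightarrow> extends \<tau> \<psi>" and x: "lvar x \<in> vars F" for \<phi> \<psi> x
  proof -
    define b where "b = (\<not> lit_holds (\<lambda>_. True) x)"
    have b: "\<not> lit_holds \<tau> x" if "\<tau> (lvar x) = b" for \<tau> using that unfolding b_def by (cases x) auto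
    obtain \<tau> where \<tau>: "extends \<tau> \<phi> \<and> models \<tau> ?X \<and> (\<psi> (lvar x) = None \<longrightarrow> lvar x \<in> vars F \<longrightarrow> \<tau> (lvar x) = b)"
      using model[OF uf \<phi> ext, of "lvar x" b] by (elim exE)
    then have m: "models \<tau> (\<psi> \<star> ?X)" using ext models_apply_iff by blast
    \<comment> \<open>Either \<open>\<psi>\<close> leaves the variable of \<open>x\<close> open and
      \<open>\<tau>\<close> has the value \<open>b\<close> there, or the variable has disappeared
      from \<open>\<psi> \<star> ?X\<close> and may be switched freely.\<close>
    have "models (\<tau>(lvar x := b)) (\<psi> \<star> ?X)"
    proof (rule models_apply_None[OF m])
      fix v assume "\<psi> v = None"
      then show "(\<tau>(lvar x := b)) v = \<tau> v" using \<tau> x by auto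
    qed
    moreover have "\<not> lit_holds (\<tau>(lvar x := b)) x" by (rule b) simp
    ultimately show ?thesis by (rule not_forcedI)
  qed
  have red: "\<exists>\<psi>. reduce 1 (\<phi> \<star> ?X) = \<psi> \<star> ?X \<and> \<phi> \<subseteq>\<^sub>m \<psi> \<and>
    (\<forall>\<tau>. extends \<tau> \<phi> \<and> models \<tau> ?X \<longrightarrow> extends \<tau> \<psi>) \<and>
    (\<psi> \<star> ?X = {{}} \<or> unit_free (\<psi> \<star> ?X))" for \<phi>
    using reduce_1_is_apply[OF finite_vars[OF X]] .
  have not_empty: "\<psi> \<star> ?X \<noteq> {{}}"
    if sat_\<phi>: "satisfiable (\<phi> \<star> ?X)" and ext: "\<forall>\<tau>. extends \<tau> \<phi> \<and> models \<tau> ?X \<longrightarrow> extends \<tau> \<psi>" for \<phi> \<psi>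
  proof
    assume empty: "\<psi> \<star> ?X = {{}}"
    obtain \<tau> where \<tau>: "extends \<tau> \<phi>" "models \<tau> ?X" using sat_\<phi> unfolding satisfiable_apply_iff by blast
    then have "models \<tau> (\<psi> \<star> ?X)" using ext models_apply_iff by blast
    then show False unfolding empty by (simp add: models_def)
  qed
  have "vars F \<subseteq> vars ?X"
  proof -
    have "cvars C \<subseteq> vars (natural_splitting (ord C) (y C))" if "C \<in> ?H" for C
      using sc that by (auto simp: vars_natural_splitting splitting_choice_def)
    then show ?thesis unfolding vars_X1[OF sc H] vars_H[symmetric] by (auto simp: vars_def[of ?H])
  qed
  moreover have "satisfiable (\<phi> \<star> ?X) \<longleftrightarrow> xor_satisfies \<phi> F" if dom: "dom \<phi> = vars F" for \<phi>
  proof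
    assume "satisfiable (\<phi> \<star> ?X)"
    then obtain \<tau> where \<tau>: "extends \<tau> \<phi>" "models \<tau> ?X" unfolding satisfiable_apply_iff by blast
    have "xor_holds (\<lambda>v. the (\<phi> v)) C" if C: "C \<in> F" for C
    proof -
      have "the (\<phi> v) = \<tau> v" if "v \<in> cvars C" for v
      proof -
        have "v \<in> dom \<phi>" using dom C that by (auto simp: vars_def)
        then show ?thesis using \<tau>(1) by (auto simp: extends_def)
      qed
      then show ?thesis using F_of_X[OF \<tau>(2) C] xor_holds_cong[of C "\<lambda>v. the (\<phi> v)" \<tau>] by blast
    qed
    then show "xor_satisfies \<phi> F" using dom by (simp add: xor_satisfies_iff_holds)
  next
    assume "xor_satisfies \<phi> F"
    then have "\<forall>C\<in>F. xor_holds (\<lambda>v. the (\<phi> v)) C" using dom by (simp add: xor_satisfies_iff_holds)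
    from X_of_F[OF this] obtain \<tau> where \<tau>: "\<forall>v\<in>vars F. \<tau> v = the (\<phi> v)" "models \<tau> ?X" by blast
    have "extends \<tau> \<phi>"
      unfolding extends_def
    proof (intro allI impI)
      fix v c assume v: "\<phi> v = Some c"
      then have "v \<in> vars F" using dom by blast
      then show "\<tau> v = c" using \<tau>(1) v by simp
    qed
    then show "satisfiable (\<phi> \<star> ?X)" using \<tau>(2) unfolding satisfiable_apply_iff by blast
  qed
  moreover have "phd (vars F) ?X \<le> 1"
    unfolding phd_def
  proof (rule Least_le, intro allI impI conjI)
    fix \<phi> :: "'a passignment" assume dom: "dom \<phi> \<subseteq> vars F"
    obtain \<psi> where \<psi>: "reduce 1 (\<phi> \<star> ?X) = \<psi> \<star> ?X" "\<phi> \<subseteq>\<^sub>m \<psi>"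
      "\<forall>\<tau>. extends \<tau> \<phi> \<and> models \<tau> ?X \<longrightarrow> extends \<tau> \<psi>"
      "\<psi> \<star> ?X = {{}} \<or> unit_free (\<psi> \<star> ?X)"
      using red[of \<phi>] by (elim exE conjE)
    {
      assume unsat: "\<not> satisfiable (\<phi> \<star> ?X)"
      show "reduce 1 (\<phi> \<star> ?X) = {{}}"
      proof (rule ccontr)
        assume "reduce 1 (\<phi> \<star> ?X) \<noteq> {{}}"
        then have uf: "unit_free (\<psi> \<star> ?X)" using \<psi>(1,4) by simp
        then show False using unsat model[OF uf dom \<psi>(2,3)] unfolding satisfiable_apply_iff by blast
      qed
    next
      assume sat: "satisfiable (\<phi> \<star> ?X)"
      then have "unit_free (\<psi> \<star> ?X)" using \<psi>(3,4) not_empty by blast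
      from not_forced[OF this dom \<psi>(2,3)]
      show "\<not> (\<exists>x. lvar x \<in> vars F \<and> forced x (reduce 1 (\<phi> \<star> ?X)))" unfolding \<psi>(1) by blast
    }
  qed
  moreover have "reduce 1 (\<phi> \<star> ?X) = {}" if dom: "dom \<phi> = vars F" and sat: "satisfiable (\<phi> \<star> ?X)" for \<phi>
  proof -
    obtain \<psi> where \<psi>: "reduce 1 (\<phi> \<star> ?X) = \<psi> \<star> ?X" "\<phi> \<subseteq>\<^sub>m \<psi>"
      "\<forall>\<tau>. extends \<tau> \<phi> \<and> models \<tau> ?X \<longrightarrow> extends \<tau> \<psi>"
      "\<psi> \<star> ?X = {{}} \<or> unit_free (\<psi> \<star> ?X)"
      using red[of \<phi>] by (elim exE conjE)
    have uf: "unit_free (\<psi> \<star> ?X)" using \<psi>(3,4) not_empty[OF sat] by blast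
    have dom_\<psi>: "vars F \<subseteq> dom \<psi>" using map_le_implies_dom_le[OF \<psi>(2)] dom by simp
    have "vars (natural_splitting (ord C) (y C)) \<subseteq> dom \<psi>" if C: "C \<in> ?H" for C
    proof (rule split_dom[OF uf C])
      have "cvars C \<subseteq> vars ?H" using C by (auto simp: vars_def)
      then show "cvars C \<subseteq> insert undefined (dom \<psi>)" using dom_\<psi> unfolding vars_H by (rule subset_insertI2[OF subset_trans])
    qed
    then have "vars ?X \<subseteq> dom \<psi>" unfolding vars_X1[OF sc H] by blast
    then have "vars (\<psi> \<star> ?X) = {}"
      using vars_apply_disjoint[of _ \<psi> ?X] vars_apply_subset[of \<psi> ?X] by fastforce
    then have "C = {}" if "C \<in> \<psi> \<star> ?X" for C using that by (auto simp: vars_def cvars_def)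
    \<comment> \<open>Only empty clauses are possible without variables, and
      \<open>unit_free\<close> excludes them.\<close>
    then have "\<psi> \<star> ?X = {}" using uf unfolding unit_free_def by blast
    then show ?thesis using \<psi>(1) by simp
  qed
  ultimately show ?thesis
    unfolding forcing_representation_def CNF_representation_def using X by blast
qed

section \<open>Sums without repetition\<close>

text \<open>The two data that determine \<open>min_xor_sum\<close> are made explicit. Unlike there,
  an empty \<open>V\<close> gives the empty clause for either sign, so the two agree for consistent
  sets.\<close>

definition signed_literals :: "bool \<Rightarrow> nat set \<Rightarrow> nat clause" where
  "signed_literals b V = (\<lambda>v. if b \<and> v = Min V then Neg v else Pos v) ` V"

lemma min_xor_sum_eq:
  assumes "clause_set G" "xor_consistent G"
  shows "min_xor_sum G = signed_literals (compl_odd G) (odd_vars G)"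
proof (cases "compl_odd G")
  case True
  then have "odd_vars G \<noteq> {}" using assms(2) by (simp add: xor_consistent_def)
  then have "Min (odd_vars G) \<in> odd_vars G" using finite_odd_vars[OF assms(1)] by simp
  then show ?thesis using True unfolding min_xor_sum_def signed_literals_def by auto
qed (simp add: min_xor_sum_def signed_literals_def)

lemma signed_literals_props:
  assumes "finite V"
  shows "is_clause (signed_literals b V)" "cvars (signed_literals b V) = V"
    "num_compl (signed_literals b V) = (if b \<and> V \<noteq> {} then 1 else 0)"
proof -
  show "is_clause (signed_literals b V)"
    using assms by (auto simp: is_clause_def signed_literals_def split: if_splits)
  have pos: "{v. Pos v \<in> signed_literals b V} = {v \<in> V. \<not> (b \<and> v = Min V)}"
    and neg: "{v. Neg v \<in> signed_literals b V} = {v \<in> V. b \<and> v = Min V}"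
    by (auto simp: signed_literals_def split: if_splits)
  show "cvars (signed_literals b V) = V" unfolding cvars_eq_Pos_Neg pos neg by blast
  have "{v \<in> V. b \<and> v = Min V} = (if b \<and> V \<noteq> {} then {Min V} else {})"
  proof (cases "V = {}")
    case False
    then show ?thesis using Min_in[OF assms] by auto
  qed simp
  then show "num_compl (signed_literals b V) = (if b \<and> V \<noteq> {} then 1 else 0)"
    unfolding num_compl_def neg by simp
qed

lemma is_xor_sum_min_xor_sum: "is_xor_sum (min_xor_sum :: nat clauses \<Rightarrow> nat clause)"
  unfolding is_xor_sum_def
proof (intro allI impI)
  fix G :: "nat clauses" assume G: "clause_set G \<and> xor_consistent G"
  note props = signed_literals_props[OF finite_odd_vars, of G "compl_odd G"]
  show "is_clause (min_xor_sum G) \<and> cvars (min_xor_sum G) = odd_vars G \<and>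
      odd (num_compl (min_xor_sum G)) = compl_odd G"
    using props G by (auto simp: min_xor_sum_eq xor_consistent_def)
qed

section \<open>Sums as lists of literals\<close>

fun lit_sign :: "'v literal \<Rightarrow> nat" where
  "lit_sign (Pos v) = 0"
| "lit_sign (Neg v) = 1"

definition sign_sum :: "'v literal list \<Rightarrow> nat" where
  "sign_sum xs = sum_list (map lit_sign xs)"

lemma sign_sum_eq_num_compl:
  assumes "distinct xs"
  shows "sign_sum xs = num_compl (set xs)"
  using assms
proof (induction xs)
  case (Cons x xs)
  show ?case
  proof (cases x)
    case (Neg v)
    have "{u. Neg u \<in> set (x # xs)} = insert v {u. Neg u \<in> set xs}" using Neg by auto
    moreover have "v \<notin> {u. Neg u \<in> set xs}" using Neg Cons by auto
    moreover have "finite {u. Neg u \<in> set xs}"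
      by (rule finite_vimageI[unfolded vimage_def]) (auto simp: inj_def)
    ultimately show ?thesis using Neg Cons by (simp add: num_compl_def sign_sum_def)
  qed (use Cons in \<open>simp add: num_compl_def sign_sum_def\<close>)
qed (simp add: num_compl_def sign_sum_def)

text \<open>The order is that of the program: first what survives of the old sum, then what survives
  of the input clause.\<close>

definition xor_vars :: "nat literal list \<Rightarrow> nat literal list \<Rightarrow> nat list" where
  "xor_vars xs ys = filter (\<lambda>v. v \<notin> lvar ` set ys) (map lvar xs) @
     filter (\<lambda>v. v \<notin> lvar ` set xs) (map lvar ys)"

definition signed_list :: "bool \<Rightarrow> nat list \<Rightarrow> nat literal list" where
  "signed_list b vs = map (\<lambda>v. if b \<and> v = Min (set vs) then Neg v else Pos v) vs"

definition xor_list :: "nat literal list \<Rightarrow> nat literal list \<Rightarrow> nat literal list" where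
  "xor_list ys xs = signed_list (odd (sign_sum xs + sign_sum ys)) (xor_vars xs ys)"

lemma set_xor_vars: "set (xor_vars xs ys) = sym_diff (cvars (set xs)) (cvars (set ys))"
  by (auto simp: xor_vars_def cvars_def)

lemma set_signed_list: "set (signed_list b vs) = signed_literals b (set vs)"
  by (auto simp: signed_list_def signed_literals_def)

lemma length_xor_list: "length (xor_list ys xs) \<le> length xs + length ys"
proof -
  have "length (filter P (map lvar xs)) \<le> length xs" for P and xs :: "nat literal list"
    by (metis length_filter_le length_map)
  then show ?thesis unfolding xor_list_def signed_list_def xor_vars_def by (simp add: add_mono)
qed

definition closure_step :: "nat literal list list \<Rightarrow> nat literal list \<Rightarrow> nat literal list list" where
  "closure_step Ds ys = (if [] \<in> set (map (xor_list ys) Ds) then Ds else Ds @ map (xor_list ys) Ds)"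

lemma distinct_map_lvar:
  assumes "distinct xs" "is_clause (set xs)"
  shows "distinct (map lvar xs)"
  using assms by (simp add: distinct_map is_clause_iff_inj_on)

lemma distinct_xor_list:
  assumes "distinct (map lvar xs)" "distinct (map lvar ys)"
  shows "distinct (xor_list ys xs)"
proof -
  have "distinct (xor_vars xs ys)" using assms by (auto simp: xor_vars_def)
  moreover have "inj (\<lambda>v::nat. if b \<and> v = c then Neg v else Pos v)" for b c
    by (auto simp: inj_def split: if_splits)
  ultimately show ?thesis
    unfolding xor_list_def signed_list_def distinct_map using inj_on_subset[OF _ subset_UNIV] by blast
qed

lemma set_xor_list:
  assumes cs: "clause_set (insert C F)" and con: "\<And>G. G \<subseteq> insert C F \<Longrightarrow> xor_consistent G"
    and G: "G \<subseteq> F" "C \<notin> F" and xs: "distinct xs" "set xs = min_xor_sum G"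
    and ys: "distinct ys" "set ys = C"
  shows "set (xor_list ys xs) = min_xor_sum (insert C G)"
proof -
  have csG: "clause_set G" "clause_set (insert C G)" using cs G by (auto intro: clause_set_subset)
  have conG: "xor_consistent G" "xor_consistent (insert C G)" using G by (auto intro!: con)
  have min_G: "cvars (min_xor_sum G) = odd_vars G" "odd (num_compl (min_xor_sum G)) \<longleftrightarrow> compl_odd G"
    using is_xor_sum_min_xor_sum csG(1) conG(1) unfolding is_xor_sum_def by blast+
  have fin: "finite G" using csG by (simp add: clause_set_def)
  have "C \<notin> G" using G by blast
  note ins = odd_vars_insert[OF fin this] compl_odd_insert[OF fin this]
  have "set (xor_vars xs ys) = odd_vars (insert C G)"
    unfolding set_xor_vars xs ys ins min_G ..
  moreover have "odd (sign_sum xs + sign_sum ys) \<longleftrightarrow> compl_odd (insert C G)"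
    unfolding ins sign_sum_eq_num_compl[OF xs(1)] sign_sum_eq_num_compl[OF ys(1)] xs(2) ys(2)
    using min_G by auto
  ultimately show ?thesis
    unfolding xor_list_def set_signed_list min_xor_sum_eq[OF csG(2) conG(2)] by simp
qed

text \<open>The sets \<open>odd_vars G\<close> with \<open>G \<subseteq> F\<close> are closed under
  symmetric difference. Translation by \<open>cvars C\<close> is injective and yields a coset, which
  equals this family if it contains the empty set and is disjoint from it otherwise.\<close>

lemma lists_clauses_closure_step:
  assumes cs: "clause_set (insert C F)" and con: "\<And>G. G \<subseteq> insert C F \<Longrightarrow> xor_consistent G"
    and C: "C \<notin> F" and Ds: "lists_clauses Ds (xor_closure min_xor_sum F)"
    and ys: "distinct ys" "set ys = C"
  shows "lists_clauses (closure_step Ds ys) (xor_closure min_xor_sum (insert C F))"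
proof -
  let ?m = "min_xor_sum :: nat clauses \<Rightarrow> nat clause"
  let ?N = "map (xor_list ys) Ds"
  have csG: "clause_set G" if "G \<subseteq> insert C F" for G using clause_set_subset[OF cs that] .
  have finG: "finite G" if "G \<subseteq> insert C F" for G using csG[OF that] by (simp add: clause_set_def)
  have m: "is_clause (?m G)" "cvars (?m G) = odd_vars G" if "G \<subseteq> insert C F" for G
    using is_xor_sum_min_xor_sum csG[OF that] con[OF that] unfolding is_xor_sum_def by blast+
  \<comment> \<open>Two sums over the same variables with opposite signs would add up to an
    inconsistent subset.\<close>
  have m_eqI: "?m G = ?m G'" if "odd_vars G = odd_vars G'" "G \<subseteq> insert C F" "G' \<subseteq> insert C F" for G G'
  proof -
    have sub: "sym_diff G G' \<subseteq> insert C F" using that by blast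
    have "odd_vars (sym_diff G G') = {}"
      using that(1) odd_vars_sym_diff[OF finG[OF that(2)] finG[OF that(3)]] by simp
    then have "\<not> compl_odd (sym_diff G G')" using con[OF sub] by (simp add: xor_consistent_def)
    then have "compl_odd G = compl_odd G'"
      using compl_odd_sym_diff[OF finG[OF that(2)] finG[OF that(3)]] by simp
    then show ?thesis
      using that min_xor_sum_eq[OF csG con] by simp
  qed
  have Ds': "distinct (map set Ds)" "\<And>D. D \<in> set Ds \<Longrightarrow> distinct D" "set ` set Ds = ?m ` Pow F"
    using Ds by (auto simp: lists_clauses_def xor_closure_def)
  have D_ex: "\<exists>G\<subseteq>F. set D = ?m G \<and> set (xor_list ys D) = ?m (insert C G)" if D: "D \<in> set Ds" for D
  proof -
    have "set D \<in> ?m ` Pow F" using D Ds'(3) by blast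
    then obtain G where G: "G \<subseteq> F" "set D = ?m G" by blast
    then have "set (xor_list ys D) = ?m (insert C G)"
      by (intro set_xor_list[OF cs con _ C Ds'(2)[OF D] _ ys])
    then show ?thesis using G by (intro exI[of _ G]) simp
  qed
  have G_ex: "\<exists>D\<in>set Ds. set D = ?m G \<and> set (xor_list ys D) = ?m (insert C G)" if G: "G \<subseteq> F" for G
  proof -
    have "?m G \<in> set ` set Ds" using G Ds'(3) by blast
    then obtain D where D: "D \<in> set Ds" "set D = ?m G" by auto
    moreover from this have "set (xor_list ys D) = ?m (insert C G)"
      by (intro set_xor_list[OF cs con G C Ds'(2) _ ys])
    ultimately show ?thesis by (intro bexI[of _ D]) simp_all
  qed
  have closure_insert: "xor_closure ?m (insert C F) = ?m ` Pow F \<union> (\<lambda>G. ?m (insert C G)) ` Pow F"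
  proof -
    have "xor_closure ?m (insert C F) = ?m ` Pow (insert C F)" by (auto simp: xor_closure_def)
    then show ?thesis by (simp add: Pow_insert image_Un image_image)
  qed
  have N_eq: "set ` set ?N = (\<lambda>G. ?m (insert C G)) ` Pow F"
  proof
    show "set ` set ?N \<subseteq> (\<lambda>G. ?m (insert C G)) ` Pow F"
    proof
      fix E assume "E \<in> set ` set ?N"
      then obtain D where "D \<in> set Ds" "E = set (xor_list ys D)" by auto
      then show "E \<in> (\<lambda>G. ?m (insert C G)) ` Pow F" using D_ex[of D] by auto
    qed
    show "(\<lambda>G. ?m (insert C G)) ` Pow F \<subseteq> set ` set ?N"
    proof
      fix E assume "E \<in> (\<lambda>G. ?m (insert C G)) ` Pow F"
      then obtain G where "G \<subseteq> F" "E = ?m (insert C G)" by auto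
      then show "E \<in> set ` set ?N" using G_ex[of G] by (auto simp: image_image)
    qed
  qed
  show ?thesis
  proof (cases "[] \<in> set ?N")
    case True
    then obtain D where D: "D \<in> set Ds" "xor_list ys D = []" by auto
    then obtain G where G: "G \<subseteq> F" "?m (insert C G) = {}" using D_ex by force
    then have odd_G: "odd_vars (insert C G) = {}" using m(2)[of "insert C G"] by (auto simp: cvars_def)
    have "?m (insert C G') \<in> ?m ` Pow F" if G': "G' \<subseteq> F" for G'
    proof
      \<comment> \<open>As \<open>insert C G\<close> sums to the empty clause, \<open>C\<close> may
        be replaced by \<open>G\<close> in every sum.\<close>
      show "sym_diff G G' \<in> Pow F" using G G' by blast
      have fin: "finite (insert C G)" "finite (insert C G')" using finG G G' by blast+
      have "sym_diff (insert C G) (insert C G') = sym_diff G G'" using C G G' by blast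
      then have "odd_vars (sym_diff G G') = odd_vars (insert C G')"
        using odd_vars_sym_diff[OF fin] odd_G by simp
      then show "?m (insert C G') = ?m (sym_diff G G')" using G G' by (intro m_eqI) auto
    qed
    then have "xor_closure ?m (insert C F) = ?m ` Pow F" unfolding closure_insert by blast
    then show ?thesis using True Ds' by (simp add: closure_step_def lists_clauses_def)
  next
    case False
    have nonempty: "odd_vars (insert C G) \<noteq> {}" if G: "G \<subseteq> F" for G
    proof
      assume "odd_vars (insert C G) = {}"
      then have "?m (insert C G) = {}" using m(2)[of "insert C G"] G by (auto simp: cvars_def)
      then show False using G_ex[OF G] False by force
    qed
    have inj_N: "inj_on set (xor_list ys ` set Ds)" "inj_on (xor_list ys) (set Ds)"
    proof -
      have "D = D'" if D: "D \<in> set Ds" "D' \<in> set Ds" "set (xor_list ys D) = set (xor_list ys D')" for D D'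
      proof -
        obtain G where G: "G \<subseteq> F" "set D = ?m G" "set (xor_list ys D) = ?m (insert C G)"
          using D_ex[OF D(1)] by blast
        obtain G' where G': "G' \<subseteq> F" "set D' = ?m G'" "set (xor_list ys D') = ?m (insert C G')"
          using D_ex[OF D(2)] by blast
        have "odd_vars (insert C G) = odd_vars (insert C G')"
          using m(2)[OF insert_mono[OF G(1)]] m(2)[OF insert_mono[OF G'(1)]] G(3) G'(3) D(3) by simp
        then have "sym_diff (odd_vars G) (cvars C) = sym_diff (odd_vars G') (cvars C)"
          using odd_vars_insert[OF finG[OF subset_insertI2[OF G(1)]], of C]
            odd_vars_insert[OF finG[OF subset_insertI2[OF G'(1)]], of C] G(1) G'(1) C by auto
        then have "odd_vars G = odd_vars G'" by blast
        then have "set D = set D'"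
          using m_eqI[OF _ subset_insertI2[OF G(1)] subset_insertI2[OF G'(1)]] G(2) G'(2) by simp
        then show ?thesis using Ds'(1) D by (simp add: distinct_map inj_on_def)
      qed
      then show "inj_on set (xor_list ys ` set Ds)" "inj_on (xor_list ys) (set Ds)"
        by (auto simp: inj_on_def)
    qed
    have "set ` set Ds \<inter> set ` set ?N = {}"
    proof (rule ccontr)
      assume "set ` set Ds \<inter> set ` set ?N \<noteq> {}"
      then obtain G G' where G: "G \<subseteq> F" "G' \<subseteq> F" "?m G = ?m (insert C G')"
        unfolding Ds'(3) N_eq by auto
      then have "odd_vars G = odd_vars (insert C G')"
        using m(2)[of G] m(2)[of "insert C G'"] by auto
      \<comment> \<open>If an old and a new sum coincided, adding them would give an empty new
        sum.\<close>
      moreover have "insert C (sym_diff G G') = sym_diff G (insert C G')" using G C by blast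
      ultimately have "odd_vars (insert C (sym_diff G G')) = {}"
        using odd_vars_sym_diff[of G "insert C G'"] finG[of G] finG[of "insert C G'"] G by auto
      then show False using nonempty[of "sym_diff G G'"] G by blast
    qed
    moreover have "distinct (map set ?N)"
      using inj_N Ds'(1) by (simp add: distinct_map comp_inj_on)
    ultimately have "distinct (map set (Ds @ ?N))" using Ds'(1) by (simp add: image_image)
    moreover have "distinct D" if "D \<in> set (Ds @ ?N)" for D
    proof -
      have "distinct (map lvar ys)" using ys cs by (intro distinct_map_lvar) (auto simp: clause_set_def)
      moreover have "distinct (map lvar D)" if D: "D \<in> set Ds" for D
      proof (rule distinct_map_lvar[OF Ds'(2)[OF D]])
        obtain G where G: "G \<subseteq> F" "set D = ?m G" using D_ex[OF D] by blast
        show "is_clause (set D)" unfolding G(2) by (rule m(1)[OF subset_insertI2[OF G(1)]])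
      qed
      ultimately show ?thesis using that Ds'(2) distinct_xor_list by auto
    qed
    moreover have "set ` set (Ds @ ?N) = xor_closure ?m (insert C F)"
      unfolding closure_insert using Ds'(3) N_eq by (simp add: image_Un)
    ultimately show ?thesis using False by (simp add: closure_step_def lists_clauses_def image_Un image_image)
  qed
qed

lemma lists_clauses_closure:
  assumes "clause_set F" "xor_satisfiable F" "lists_clauses xss F"
  shows "lists_clauses (foldl closure_step [[]] xss) (xor_closure min_xor_sum F)"
proof -
  have con: "xor_consistent G" if "G \<subseteq> F" for G using xor_satisfiable_consistent[OF assms(1,2) that] .
  have "set (map set xss) = F" using assms(3) by (simp add: lists_clauses_def)
  then have "\<And>C. C \<in> set ` set xss \<Longrightarrow> is_clause C" "\<And>G. G \<subseteq> set ` set xss \<Longrightarrow> xor_consistent G"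
    using assms(1) con by (auto simp: clause_set_def)
  moreover have "distinct (map set xss)" "\<forall>xs\<in>set xss. distinct xs"
    using assms(3) by (auto simp: lists_clauses_def)
  ultimately have "lists_clauses (foldl closure_step [[]] xss) (xor_closure min_xor_sum (set ` set xss))"
  proof (induction xss rule: rev_induct)
    case Nil
    have "xor_closure min_xor_sum {} = {{} :: nat clause}" by (simp add: xor_closure_def min_xor_sum_def)
    then show ?case by (simp add: lists_clauses_def)
  next
    case (snoc ys xss)
    have IH: "lists_clauses (foldl closure_step [[]] xss) (xor_closure min_xor_sum (set ` set xss))"
      using snoc.prems by (intro snoc.IH) auto
    have eq: "set ` set (xss @ [ys]) = insert (set ys) (set ` set xss)" by simp
    have "lists_clauses (closure_step (foldl closure_step [[]] xss) ys)
       (xor_closure min_xor_sum (insert (set ys) (set ` set xss)))"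
    proof (rule lists_clauses_closure_step[OF _ _ _ IH])
      show "clause_set (insert (set ys) (set ` set xss))"
        using snoc.prems(1) by (simp add: clause_set_def)
      show "xor_consistent G" if "G \<subseteq> insert (set ys) (set ` set xss)" for G
        using snoc.prems(2)[of G] that by simp
      show "set ys \<notin> set ` set xss" "distinct ys" "set ys = set ys" using snoc.prems(3,4) by auto
    qed
    then show ?case by simp
  qed
  then show ?thesis using assms(3) by (simp add: lists_clauses_def)
qed

section \<open>Running programs\<close>

text \<open>A weakest-precondition form in which the postcondition sees the elapsed time:
  termination, time and final memory are derived together by backward chaining.\<close>

definition runs :: "com \<Rightarrow> memory \<Rightarrow> (nat \<Rightarrow> memory \<Rightarrow> bool) \<Rightarrow> bool" where
  "runs P m Q \<longleftrightarrow> (\<exists>t m'. exec P m t m' \<and> Q t m')"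

lemma runs_conseq: "runs P m Q \<Longrightarrow> (\<And>t m'. Q t m' \<Longrightarrow> Q' t m') \<Longrightarrow> runs P m Q'"
  by (auto simp: runs_def)

lemma runs_Skip: "Q 1 m \<Longrightarrow> runs Skip m Q"
  unfolding runs_def using exec.Skip by blast

lemma runs_Store:
  "Q 1 (m(A := (m A)(aval a m := aval b m))) \<Longrightarrow> runs (Store A a b) m Q"
  unfolding runs_def using exec.Store by blast

lemma runs_Seq: "runs P m (\<lambda>s m'. runs R m' (\<lambda>t. Q (s + t))) \<Longrightarrow> runs (Seq P R) m Q"
  unfolding runs_def using exec.Seq by blast

lemma runs_Cond:
  "(bval b m \<Longrightarrow> runs P m (\<lambda>t. Q (t + 1))) \<Longrightarrow> (\<not> bval b m \<Longrightarrow> runs R m (\<lambda>t. Q (t + 1))) \<Longrightarrow>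
    runs (Cond b P R) m Q"
  unfolding runs_def using exec.Cond_True exec.Cond_False by blast

lemma runs_Cond_True: "bval b m \<Longrightarrow> runs P m (\<lambda>t. Q (t + 1)) \<Longrightarrow> runs (Cond b P R) m Q"
  by (rule runs_Cond) auto

lemma runs_Cond_False: "\<not> bval b m \<Longrightarrow> runs R m (\<lambda>t. Q (t + 1)) \<Longrightarrow> runs (Cond b P R) m Q"
  by (rule runs_Cond) auto

lemma runs_While_False: "\<not> bval b m \<Longrightarrow> Q 1 m \<Longrightarrow> runs (While b P) m Q"
  unfolding runs_def using exec.While_False by blast

lemma runs_While_True:
  "bval b m \<Longrightarrow> runs P m (\<lambda>s m'. runs (While b P) m' (\<lambda>t. Q (s + t + 1))) \<Longrightarrow> runs (While b P) m Q"
  unfolding runs_def using exec.While_True by blast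

text \<open>The closing \<open>Skip\<close> costs one unit, which is included in the step counts
  below.\<close>

fun block :: "com list \<Rightarrow> com" where
  "block [] = Skip"
| "block (P # Ps) = Seq P (block Ps)"

lemma runs_block_Nil: "Q 1 m \<Longrightarrow> runs (block []) m Q"
  by (simp add: runs_Skip)

lemma runs_block_Cons:
  "runs P m (\<lambda>s m'. runs (block Ps) m' (\<lambda>t. Q (s + t))) \<Longrightarrow> runs (block (P # Ps)) m Q"
  by (simp add: runs_Seq)

section \<open>Lists in memory\<close>

fun stored :: "(nat \<Rightarrow> nat) \<Rightarrow> nat \<Rightarrow> nat list \<Rightarrow> bool" where
  "stored f p [] = True"
| "stored f p (w # ws) = (f p = w \<and> stored f (Suc p) ws)"

lemma stored_append [simp]: "stored f p (us @ ws) \<longleftrightarrow> stored f p us \<and> stored f (p + length us) ws"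
  by (induction us arbitrary: p) auto

lemma stored_iff_nth: "stored f p ws \<longleftrightarrow> (\<forall>i<length ws. f (p + i) = ws ! i)"
  by (induction ws arbitrary: p) (auto simp: less_Suc_eq_0_disj nth_Cons')

lemma stored_cong:
  "(\<And>a. p \<le> a \<Longrightarrow> a < p + length ws \<Longrightarrow> f a = g a) \<Longrightarrow> stored f p ws = stored g p ws"
  by (simp add: stored_iff_nth)

definition encode_literals :: "nat literal list \<Rightarrow> nat list" where
  "encode_literals xs = concat (map encode_literal xs)"

lemma encode_literals_simps [simp]:
  "encode_literals [] = []"
  "encode_literals (x # xs) = lvar x # lit_sign x # encode_literals xs"
  by (simp_all add: encode_literals_def) (cases x; simp)

lemma length_encode_literals [simp]: "length (encode_literals xs) = 2 * length xs"
  by (induction xs) simp_all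

lemma encode_clause_eq: "encode_clause xs = length xs # encode_literals xs"
  by (simp add: encode_clause_def encode_literals_def)

lemma stored_encode_literals_iff:
  "stored f p (encode_literals xs) \<longleftrightarrow>
    (\<forall>i<length xs. f (p + 2 * i) = lvar (xs ! i) \<and> f (p + 2 * i + 1) = lit_sign (xs ! i))"
proof (induction xs arbitrary: p)
  case (Cons x xs)
  have "(\<forall>i<length (x # xs). f (p + 2 * i) = lvar ((x # xs) ! i) \<and> f (p + 2 * i + 1) = lit_sign ((x # xs) ! i)) \<longleftrightarrow>
    (f p = lvar x \<and> f (p + 1) = lit_sign x) \<and> 
    (\<forall>i<length xs. f (p + 2 + 2 * i) = lvar (xs ! i) \<and> f (p + 2 + 2 * i + 1) = lit_sign (xs ! i))"
    unfolding length_Cons All_less_Suc2 by simp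
  then show ?case using Cons.IH[of "p + 2"] by simp
qed simp

declare One_nat_def [simp del] \<comment> \<open>keeps the index 1 of arrays and registers as a numeral\<close>

text \<open>
  Array 0 holds the input, array 1 the output, array 2 the registers, and array 3 a mark for each
  variable, all marks being 0 between the sums.
\<close>

abbreviation (input) "rQ \<equiv> 0 :: nat" \<comment> \<open>read pointer\<close>
abbreviation (input) "rN \<equiv> 1 :: nat" \<comment> \<open>literals left to read\<close>
abbreviation (input) "rP \<equiv> 2 :: nat" \<comment> \<open>parity of the complemented literals\<close>
abbreviation (input) "rE \<equiv> 3 :: nat" \<comment> \<open>end of the output\<close>
abbreviation (input) "rL \<equiv> 4 :: nat" \<comment> \<open>length of the sum\<close>
abbreviation (input) "rB \<equiv> 5 :: nat" \<comment> \<open>position of the least variable of the sum\<close>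
abbreviation (input) "rS \<equiv> 6 :: nat" \<comment> \<open>start of the sum\<close>
abbreviation (input) "rK \<equiv> 7 :: nat" \<comment> \<open>old sums left\<close>
abbreviation (input) "rD \<equiv> 8 :: nat" \<comment> \<open>position of the current old sum\<close>
abbreviation (input) "rC \<equiv> 9 :: nat" \<comment> \<open>position of the current input clause\<close>
abbreviation (input) "rH \<equiv> 10 :: nat" \<comment> \<open>input clauses left\<close>
abbreviation (input) "rT \<equiv> 11 :: nat" \<comment> \<open>number of sums\<close>
abbreviation (input) "rZ \<equiv> 12 :: nat" \<comment> \<open>1 if the empty sum occurred\<close>
abbreviation (input) "rF \<equiv> 13 :: nat" \<comment> \<open>end of the output before the current input clause\<close>

section \<open>Computing one sum\<close>

abbreviation reg :: "nat \<Rightarrow> aexp" where "reg r \<equiv> Load 2 (Const r)"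
abbreviation set_reg :: "nat \<Rightarrow> aexp \<Rightarrow> com" where "set_reg r a \<equiv> Store 2 (Const r) a"
abbreviation cur :: "nat \<Rightarrow> aexp" where "cur A \<equiv> Load A (reg rQ)"
abbreviation cur_sign :: "nat \<Rightarrow> aexp" where "cur_sign A \<equiv> Load A (Add (reg rQ) (Const 1))"

text \<open>Flipping marks clause by clause leaves mark 1 exactly on the symmetric difference. The
  parity becomes the absolute difference of parity and sign, written as two truncated subtractions
  of which one is 0.\<close>

definition toggle :: "nat \<Rightarrow> com" where
  "toggle A = While (Less (Const 0) (reg rN)) (block [
     Store 3 (cur A) (Sub (Const 1) (Load 3 (cur A))),
     set_reg rP (Add (Sub (reg rP) (cur_sign A)) (Sub (cur_sign A) (reg rP))),
     set_reg rQ (Add (reg rQ) (Const 2)),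
     set_reg rN (Sub (reg rN) (Const 1))])"

definition toggle_marks :: "nat literal list \<Rightarrow> (nat \<Rightarrow> nat) \<Rightarrow> nat \<Rightarrow> nat" where
  "toggle_marks xs f = (\<lambda>v. if v \<in> lvar ` set xs then 1 - f v else f v)"

text \<open>Six units per literal: the loop test, four stores and the closing \<open>Skip\<close>;
  one more for the failing test.\<close>

lemma runs_toggle:
  assumes "stored (m A) (m 2 rQ) (encode_literals xs)" "m 2 rN = length xs" "m 2 rP \<le> 1"
    "A \<notin> {2, 3}" "distinct (map lvar xs)"
  shows "runs (toggle A) m (\<lambda>t m'. t = 6 * length xs + 1 \<and>
    m' = m(2 := (m 2)(rQ := m 2 rQ + 2 * length xs, rN := 0, rP := (m 2 rP + sign_sum xs) mod 2),
           3 := toggle_marks xs (m 3)))"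
  using assms
proof (induction xs arbitrary: m)
  case Nil
  have "m(2 := (m 2)(rQ := m 2 rQ, rN := 0, rP := m 2 rP mod 2), 3 := m 3) = m"
    using Nil by (auto simp: fun_eq_iff)
  then show ?case unfolding toggle_def
    by (intro runs_While_False) (use Nil in \<open>simp_all add: sign_sum_def toggle_marks_def del: fun_upd_apply\<close>)
next
  case (Cons x xs)
  let ?p = "(m 2 rP + lit_sign x) mod 2"
  let ?m = "m(2 := (m 2)(rQ := m 2 rQ + 2, rN := length xs, rP := ?p),
     3 := (m 3)(lvar x := 1 - m 3 (lvar x)))"
  have p: "m 2 rP - lit_sign x + (lit_sign x - m 2 rP) = ?p"
  proof -
    have "m 2 rP = 0 \<or> m 2 rP = 1" using Cons.prems(3) by auto
    then show ?thesis by (cases x) auto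
  qed
  have sign: "m A (m 2 rQ + 1) = lit_sign x" using Cons.prems(1) by (simp add: One_nat_def)
  have IH: "runs (toggle A) ?m (\<lambda>t m'. t = 6 * length xs + 1 \<and>
    m' = ?m(2 := (?m 2)(rQ := ?m 2 rQ + 2 * length xs, rN := 0, rP := (?m 2 rP + sign_sum xs) mod 2),
           3 := toggle_marks xs (?m 3)))"
    by (rule Cons.IH) (use Cons.prems in auto)
  \<comment> \<open>Variables do not repeat within a clause, so flipping literal by literal amounts
    to \<open>toggle_marks\<close>.\<close>
  have fin: "?m(2 := (?m 2)(rQ := ?m 2 rQ + 2 * length xs, rN := 0, rP := (?m 2 rP + sign_sum xs) mod 2),
           3 := toggle_marks xs (?m 3)) =
     m(2 := (m 2)(rQ := m 2 rQ + 2 * length (x # xs), rN := 0, rP := (m 2 rP + sign_sum (x # xs)) mod 2),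
           3 := toggle_marks (x # xs) (m 3))"
    using Cons.prems(5) by (auto simp: fun_eq_iff toggle_marks_def sign_sum_def mod_simps ac_simps)
  have step: "runs (block [
     Store 3 (cur A) (Sub (Const 1) (Load 3 (cur A))),
     set_reg rP (Add (Sub (reg rP) (cur_sign A)) (Sub (cur_sign A) (reg rP))),
     set_reg rQ (Add (reg rQ) (Const 2)),
     set_reg rN (Sub (reg rN) (Const 1))]) m (\<lambda>t m'. t = 5 \<and> m' = ?m)"
    by (intro runs_block_Cons runs_Store runs_block_Nil) (use Cons.prems p sign in \<open>auto simp: fun_eq_iff\<close>)
  show ?case
    unfolding toggle_def
  proof (rule runs_While_True, goal_cases)
    case 2
    show ?case
    proof (rule runs_conseq[OF step], elim conjE, simp only:, fold toggle_def, rule runs_conseq[OF IH], goal_cases)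
      case (1 t m' t' m'')
      then show ?case unfolding fin by (elim conjE) (intro conjI; simp del: fun_upd_apply)
    qed
  qed (use Cons.prems in simp)
qed

text \<open>Which variable is least is known only after the last one, so all literals are written
  uncomplemented and the position of the current minimum is kept for the sign.\<close>

definition append_cur :: "nat \<Rightarrow> com" where
  "append_cur A = block [
     Store 1 (reg rE) (cur A),
     Store 1 (Add (reg rE) (Const 1)) (Const 0),
     Cond (Equal (reg rL) (Const 0)) (set_reg rB (reg rE))
       (Cond (Less (cur A) (Load 1 (reg rB))) (set_reg rB (reg rE)) Skip),
     set_reg rE (Add (reg rE) (Const 2)),
     set_reg rL (Add (reg rL) (Const 1))]"

definition collected :: "memory \<Rightarrow> nat \<Rightarrow> nat list \<Rightarrow> bool" where
  "collected m s vs \<longleftrightarrow> stored (m 1) s (encode_literals (map Pos vs)) \<and>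
     m 2 rE = s + 2 * length vs \<and> m 2 rL = length vs \<and>
     (vs \<noteq> [] \<longrightarrow> (\<exists>j<length vs. m 2 rB = s + 2 * j \<and> vs ! j = Min (set vs)))"

lemma collected_cong:
  assumes "m' 1 = m 1" "m' 2 rE = m 2 rE" "m' 2 rL = m 2 rL" "m' 2 rB = m 2 rB"
  shows "collected m' s vs \<longleftrightarrow> collected m s vs"
  unfolding collected_def assms ..

lemma encode_literals_append [simp]: "encode_literals (xs @ ys) = encode_literals xs @ encode_literals ys"
  by (simp add: encode_literals_def)

text \<open>For \<open>A = 1\<close> reading and writing happen in the same array; the read pointer
  lies below the start \<open>s\<close> of the new literals, so nothing still to be read is
  overwritten.\<close>

lemma runs_append_cur:
  assumes col: "collected m s vs" and A: "A \<notin> {2, 3}" "A = 1 \<Longrightarrow> m 2 rQ < s"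
  shows "runs (append_cur A) m (\<lambda>t m'. t \<le> 8 \<and> collected m' s (vs @ [m A (m 2 rQ)]) \<and>
    (\<forall>r. r \<notin> {rE, rL, rB} \<longrightarrow> m' 2 r = m 2 r) \<and> (\<forall>a<s. m' 1 a = m 1 a) \<and>
    (\<forall>B. B \<notin> {1, 2} \<longrightarrow> m' B = m B))"
proof -
  let ?E = "m 2 rE" and ?w = "m A (m 2 rQ)"
  have col': "stored (m 1) s (encode_literals (map Pos vs))" "?E = s + 2 * length vs"
    "m 2 rL = length vs" "vs \<noteq> [] \<Longrightarrow> \<exists>j<length vs. m 2 rB = s + 2 * j \<and> vs ! j = Min (set vs)"
    using col by (auto simp: collected_def)
  have B: "m 1 (m 2 rB) = Min (set vs)" "m 2 rB < ?E" "m 2 rB \<noteq> ?E + 1" if ne: "vs \<noteq> []"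
  proof -
    obtain j where j: "j < length vs" "m 2 rB = s + 2 * j" "vs ! j = Min (set vs)"
      using col'(4)[OF ne] by blast
    show "m 1 (m 2 rB) = Min (set vs)" using col'(1) j by (simp add: stored_encode_literals_iff)
    show "m 2 rB < ?E" "m 2 rB \<noteq> ?E + 1" using j col'(2) by auto
  qed
  have Q: "A = 1 \<Longrightarrow> m 2 rQ < ?E" using A(2) col'(2) by simp
  let ?new = "vs = [] \<or> ?w < Min (set vs)"
  let ?m = "m(1 := (m 1)(?E := ?w, ?E + 1 := 0),
    2 := (m 2)(rB := if ?new then ?E else m 2 rB, rE := ?E + 2, rL := length vs + 1))"
  have run: "runs (append_cur A) m (\<lambda>t m'. t \<le> 8 \<and> m' = ?m)"
    unfolding append_cur_def
    apply (intro runs_block_Cons runs_Store runs_Cond runs_Skip runs_block_Nil)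
    subgoal using col'(3) A Q by (cases "A = 1") (auto simp: fun_eq_iff)
    subgoal using col'(3) A Q B by (cases "A = 1") (auto simp: fun_eq_iff)
    subgoal using col'(3) A Q B by (cases "A = 1") (auto simp: fun_eq_iff)
    done
  have "collected ?m s (vs @ [?w])"
  proof -
    have "stored ((m 1)(?E := ?w, ?E + 1 := 0)) s (encode_literals (map Pos vs)) \<longleftrightarrow>
        stored (m 1) s (encode_literals (map Pos vs))"
      using col'(2) by (intro stored_cong) simp
    then have "stored (?m 1) s (encode_literals (map Pos (vs @ [?w])))"
      using col'(1,2) by (simp add: One_nat_def)
    moreover have "\<exists>j<length (vs @ [?w]). ?m 2 rB = s + 2 * j \<and> (vs @ [?w]) ! j = Min (set (vs @ [?w]))"
    proof (cases ?new)
      case True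
      then have "Min (set (vs @ [?w])) = ?w"
        by (cases "vs = []") (auto simp: Min_insert2)
      then show ?thesis using True col'(2) by (intro exI[of _ "length vs"]) simp
    next
      case False
      then obtain j where j: "j < length vs" "m 2 rB = s + 2 * j" "vs ! j = Min (set vs)"
        using col'(4) by blast
      have "Min (insert ?w (set vs)) = Min (set vs)" using False by (subst Min_insert) auto
      then have "Min (set (vs @ [?w])) = Min (set vs)" by simp
      then show ?thesis using False j by (intro exI[of _ j]) (simp add: nth_append)
    qed
    ultimately show ?thesis using col'(2) unfolding collected_def by simp
  qed
  then have fin: "collected ?m s (vs @ [?w]) \<and>
    (\<forall>r. r \<notin> {rE, rL, rB} \<longrightarrow> ?m 2 r = m 2 r) \<and> (\<forall>a<s. ?m 1 a = m 1 a) \<and>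
    (\<forall>B. B \<notin> {1, 2} \<longrightarrow> ?m B = m B)"
    using col'(2) by (intro conjI) auto
  show ?thesis
  proof (rule runs_conseq[OF run], elim conjE, hypsubst)
    fix t :: nat assume "t \<le> 8"
    then show "t \<le> 8 \<and> collected ?m s (vs @ [?w]) \<and>
      (\<forall>r. r \<notin> {rE, rL, rB} \<longrightarrow> ?m 2 r = m 2 r) \<and> (\<forall>a<s. ?m 1 a = m 1 a) \<and>
      (\<forall>B. B \<notin> {1, 2} \<longrightarrow> ?m B = m B)"
      using fin by (rule conjI)
  qed
qed

text \<open>Clearing just the marks that are read restores the all-zero state in time linear in the
  clause, however large the variable indices are.\<close>

definition collect :: "nat \<Rightarrow> com" where
  "collect A = While (Less (Const 0) (reg rN)) (block [
     Cond (Equal (Load 3 (cur A)) (Const 1)) (append_cur A) Skip,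
     Store 3 (cur A) (Const 0),
     set_reg rQ (Add (reg rQ) (Const 2)),
     set_reg rN (Sub (reg rN) (Const 1))])"

text \<open>At most 14 units per literal: 9 for the conditional append, 4 for the rest of the block
  and 1 for the loop test.\<close>

lemma runs_collect:
  assumes "collected m s vs" "A \<notin> {2, 3}" "A = 1 \<Longrightarrow> m 2 rQ + 2 * length xs \<le> s"
    "stored (m A) (m 2 rQ) (encode_literals xs)" "m 2 rN = length xs" "distinct (map lvar xs)"
  shows "runs (collect A) m (\<lambda>t m'. t \<le> 14 * length xs + 1 \<and>
    collected m' s (vs @ filter (\<lambda>v. m 3 v = 1) (map lvar xs)) \<and>
    m' 3 = (\<lambda>v. if v \<in> lvar ` set xs then 0 else m 3 v) \<and> m' 2 rQ = m 2 rQ + 2 * length xs \<and>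
    (\<forall>r. r \<notin> {rQ, rN, rE, rL, rB} \<longrightarrow> m' 2 r = m 2 r) \<and> (\<forall>a<s. m' 1 a = m 1 a) \<and>
    (\<forall>B. B \<notin> {1, 2, 3} \<longrightarrow> m' B = m B))"
  using assms
proof (induction xs arbitrary: m vs)
  case Nil
  then show ?case unfolding collect_def by (intro runs_While_False) auto
next
  case (Cons x xs)
  let ?v = "lvar x"
  have v: "m A (m 2 rQ) = ?v" using Cons.prems(4) by simp
  let ?vs = "vs @ (if m 3 ?v = 1 then [?v] else [])"
  let ?step = "\<lambda>m'. collected m' s ?vs \<and> m' 3 = (m 3)(?v := 0) \<and> m' 2 rQ = m 2 rQ + 2 \<and> m' 2 rN = length xs \<and>
    (\<forall>r. r \<notin> {rQ, rN, rE, rL, rB} \<longrightarrow> m' 2 r = m 2 r) \<and> (\<forall>a<s. m' 1 a = m 1 a) \<and>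
    (\<forall>B. B \<notin> {1, 2, 3} \<longrightarrow> m' B = m B)"
  have rest: "runs (block [
     Store 3 (cur A) (Const 0),
     set_reg rQ (Add (reg rQ) (Const 2)),
     set_reg rN (Sub (reg rN) (Const 1))]) m1 (\<lambda>t m'. t = 4 \<and> ?step m')"
    if m1: "collected m1 s ?vs" "\<forall>r. r \<notin> {rE, rL, rB} \<longrightarrow> m1 2 r = m 2 r" "\<forall>a<s. m1 1 a = m 1 a"
      "\<forall>B. B \<notin> {1, 2} \<longrightarrow> m1 B = m B" for m1
  proof -
    have v1: "m1 A (m1 2 rQ) = ?v"
      using m1 Cons.prems(2,3) v by (cases "A = 1") auto
    let ?m = "m1(3 := (m1 3)(?v := 0), 2 := (m1 2)(rQ := m 2 rQ + 2, rN := length xs))"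
    have "collected ?m s ?vs" using m1(1) collected_cong[of ?m m1 s ?vs] by simp
    then have "?step ?m" using m1(2-4) by simp
    moreover have "runs (block [
      Store 3 (cur A) (Const 0),
      set_reg rQ (Add (reg rQ) (Const 2)),
      set_reg rN (Sub (reg rN) (Const 1))]) m1 (\<lambda>t m'. t = 4 \<and> m' = ?m)"
      by (intro runs_block_Cons runs_Store runs_block_Nil)
        (use m1(2) v1 Cons.prems(2,5) in \<open>auto simp: fun_eq_iff\<close>)
    ultimately show ?thesis by (elim runs_conseq) (elim conjE, simp only:)
  qed
  have step: "runs (block [
     Cond (Equal (Load 3 (cur A)) (Const 1)) (append_cur A) Skip,
     Store 3 (cur A) (Const 0),
     set_reg rQ (Add (reg rQ) (Const 2)),
     set_reg rN (Sub (reg rN) (Const 1))]) m (\<lambda>t m'. t \<le> 13 \<and> ?step m')"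
  proof (rule runs_block_Cons, rule runs_Cond, goal_cases)
    case 1
    then have vs: "?vs = vs @ [m A (m 2 rQ)]" using v by simp
    show ?case
    proof (rule runs_conseq[OF runs_append_cur[OF Cons.prems(1,2)]], goal_cases)
      case 1
      then show ?case using Cons.prems(3) by simp
    next
      case (2 t m')
      then show ?case
        by (intro runs_conseq[OF rest]) (unfold vs, (elim conjE, assumption)+, simp)
    qed
  next
    case 2
    then have vs: "?vs = vs" using v by simp
    show ?case
    proof (rule runs_Skip, rule runs_conseq[OF rest], goal_cases)
      case 1
      show ?case unfolding vs by (rule Cons.prems(1))
    qed simp_all
  qed
  show ?case
    unfolding collect_def
  proof (rule runs_While_True, goal_cases)
    case 2
    show ?case
    proof (rule runs_conseq[OF step], fold collect_def, goal_cases)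
      case (1 t m')
      note st = conjunct2[OF 1]
      have "runs (collect A) m' (\<lambda>t m''. t \<le> 14 * length xs + 1 \<and>
        collected m'' s (?vs @ filter (\<lambda>v. m' 3 v = 1) (map lvar xs)) \<and>
        m'' 3 = (\<lambda>v. if v \<in> lvar ` set xs then 0 else m' 3 v) \<and> m'' 2 rQ = m' 2 rQ + 2 * length xs \<and>
        (\<forall>r. r \<notin> {rQ, rN, rE, rL, rB} \<longrightarrow> m'' 2 r = m' 2 r) \<and> (\<forall>a<s. m'' 1 a = m' 1 a) \<and>
        (\<forall>B. B \<notin> {1, 2, 3} \<longrightarrow> m'' B = m' B))"
      proof (rule Cons.IH)
        show "collected m' s ?vs" using st by blast
        show "A \<notin> {2, 3}" using Cons.prems(2) .
        show "m' 2 rQ + 2 * length xs \<le> s" if "A = 1" using st Cons.prems(3) that by simp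
        show "m' 2 rN = length xs" "distinct (map lvar xs)" using st Cons.prems(6) by auto
        have "stored (m A) (m 2 rQ + 2) (encode_literals xs)" using Cons.prems(4) by simp
        moreover have "stored (m' A) (m 2 rQ + 2) (encode_literals xs) \<longleftrightarrow>
            stored (m A) (m 2 rQ + 2) (encode_literals xs)"
          using st Cons.prems(2,3) by (cases "A = 1"; intro stored_cong) auto
        ultimately show "stored (m' A) (m' 2 rQ) (encode_literals xs)" using st by simp
      qed
      moreover have "?vs @ filter (\<lambda>v. m' 3 v = 1) (map lvar xs) =
          vs @ filter (\<lambda>v. m 3 v = 1) (map lvar (x # xs))"
      proof -
        have "z \<noteq> ?v" if "z \<in> set (map lvar xs)" for z
          using Cons.prems(6) that unfolding list.map distinct.simps by blast
        then have "filter (\<lambda>v. m' 3 v = 1) (map lvar xs) = filter (\<lambda>v. m 3 v = 1) (map lvar xs)"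
          using st by (intro filter_cong refl) simp
        then show ?thesis by simp
      qed
      moreover have "(\<lambda>v. if v \<in> lvar ` set xs then 0 else m' 3 v) =
          (\<lambda>v. if v \<in> lvar ` set (x # xs) then 0 else m 3 v)"
        using st by (auto simp: fun_eq_iff)
      ultimately show ?case using 1 by (elim runs_conseq) simp
    qed
  qed (use Cons.prems in simp)
qed

lemma runs_memory_cong: "m = m' \<Longrightarrow> runs P m' Q \<Longrightarrow> runs P m Q"
  by simp

lemma runs_block_step:
  assumes "runs P m R" "\<And>s m'. R s m' \<Longrightarrow> runs (block Ps) m' (\<lambda>t. Q (s + t))"
  shows "runs (block (P # Ps)) m Q"
  using assms by (intro runs_block_Cons) (rule runs_conseq)

lemma stored_encode_clause:
  "stored f p (encode_clause xs) \<longleftrightarrow> f p = length xs \<and> stored f (p + 1) (encode_literals xs)"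
  by (simp add: encode_clause_eq One_nat_def)

definition on_clause :: "nat \<Rightarrow> nat \<Rightarrow> com \<Rightarrow> com" where
  "on_clause A r P =
     Seq (set_reg rQ (Add (reg r) (Const 1))) (Seq (set_reg rN (Load A (reg r))) P)"

lemma runs_on_clause:
  assumes "stored (m A) (m 2 r) (encode_clause xs)" "A \<noteq> 2" "r \<notin> {rQ, rN}"
    and "runs P (m(2 := (m 2)(rQ := m 2 r + 1, rN := length xs))) (\<lambda>t. Q (t + 2))"
  shows "runs (on_clause A r P) m Q"
  unfolding on_clause_def
  by (intro runs_Seq runs_Store) (use assms in \<open>simp add: stored_encode_clause ac_simps\<close>)

lemma runs_toggle_clause:
  assumes xs: "stored (m A) (m 2 r) (encode_clause xs)" "distinct (map lvar xs)"
    and A: "A \<notin> {2, 3}" "r \<notin> {rQ, rN}" and P: "m 2 rP \<le> 1"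
  shows "runs (on_clause A r (toggle A)) m (\<lambda>t m'. t = 6 * length xs + 3 \<and>
    m' 3 = toggle_marks xs (m 3) \<and> m' 2 rP = (m 2 rP + sign_sum xs) mod 2 \<and>
    (\<forall>r. r \<notin> {rQ, rN, rP} \<longrightarrow> m' 2 r = m 2 r) \<and> (\<forall>B. B \<notin> {2, 3} \<longrightarrow> m' B = m B))"
proof (rule runs_on_clause[OF xs(1) _ A(2)])
  let ?m = "m(2 := (m 2)(rQ := m 2 r + 1, rN := length xs))"
  have "runs (toggle A) ?m (\<lambda>t m'. t = 6 * length xs + 1 \<and>
    m' = ?m(2 := (?m 2)(rQ := ?m 2 rQ + 2 * length xs, rN := 0, rP := (?m 2 rP + sign_sum xs) mod 2),
           3 := toggle_marks xs (?m 3)))"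
    by (rule runs_toggle) (use assms in \<open>auto simp: stored_encode_clause\<close>)
  then show "runs (toggle A) ?m (\<lambda>t m'. t + 2 = 6 * length xs + 3 \<and>
    m' 3 = toggle_marks xs (m 3) \<and> m' 2 rP = (m 2 rP + sign_sum xs) mod 2 \<and>
    (\<forall>r. r \<notin> {rQ, rN, rP} \<longrightarrow> m' 2 r = m 2 r) \<and> (\<forall>B. B \<notin> {2, 3} \<longrightarrow> m' B = m B))"
    by (rule runs_conseq) auto
qed (use A in simp)

lemma runs_collect_clause:
  assumes col: "collected m s vs" and xs: "stored (m A) (m 2 r) (encode_clause xs)" "distinct (map lvar xs)"
    and A: "A \<notin> {2, 3}" "r \<notin> {rQ, rN}" "A = 1 \<Longrightarrow> m 2 r + 1 + 2 * length xs \<le> s"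
  shows "runs (on_clause A r (collect A)) m (\<lambda>t m'. t \<le> 14 * length xs + 3 \<and>
    collected m' s (vs @ filter (\<lambda>v. m 3 v = 1) (map lvar xs)) \<and>
    m' 3 = (\<lambda>v. if v \<in> lvar ` set xs then 0 else m 3 v) \<and> m' 2 rQ = m 2 r + 1 + 2 * length xs \<and>
    (\<forall>r. r \<notin> {rQ, rN, rE, rL, rB} \<longrightarrow> m' 2 r = m 2 r) \<and> (\<forall>a<s. m' 1 a = m 1 a) \<and>
    (\<forall>B. B \<notin> {1, 2, 3} \<longrightarrow> m' B = m B))"
proof (rule runs_on_clause[OF xs(1) _ A(2)])
  let ?m = "m(2 := (m 2)(rQ := m 2 r + 1, rN := length xs))"
  have "collected ?m s vs" using col collected_cong[of ?m m s vs] by simp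
  then have "runs (collect A) ?m (\<lambda>t m'. t \<le> 14 * length xs + 1 \<and>
    collected m' s (vs @ filter (\<lambda>v. ?m 3 v = 1) (map lvar xs)) \<and>
    m' 3 = (\<lambda>v. if v \<in> lvar ` set xs then 0 else ?m 3 v) \<and> m' 2 rQ = ?m 2 rQ + 2 * length xs \<and>
    (\<forall>r. r \<notin> {rQ, rN, rE, rL, rB} \<longrightarrow> m' 2 r = ?m 2 r) \<and> (\<forall>a<s. m' 1 a = ?m 1 a) \<and>
    (\<forall>B. B \<notin> {1, 2, 3} \<longrightarrow> m' B = ?m B))"
    by (rule runs_collect) (use assms in \<open>auto simp: stored_encode_clause\<close>)
  then show "runs (collect A) ?m (\<lambda>t m'. t + 2 \<le> 14 * length xs + 3 \<and>
    collected m' s (vs @ filter (\<lambda>v. m 3 v = 1) (map lvar xs)) \<and>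
    m' 3 = (\<lambda>v. if v \<in> lvar ` set xs then 0 else m 3 v) \<and> m' 2 rQ = m 2 r + 1 + 2 * length xs \<and>
    (\<forall>r. r \<notin> {rQ, rN, rE, rL, rB} \<longrightarrow> m' 2 r = m 2 r) \<and> (\<forall>a<s. m' 1 a = m 1 a) \<and>
    (\<forall>B. B \<notin> {1, 2, 3} \<longrightarrow> m' B = m B))"
    by (rule runs_conseq) auto
qed (use A in simp)

definition mark_sum :: com where
  "mark_sum = block [set_reg rP (Const 0), on_clause 1 rD (toggle 1), on_clause 0 rC (toggle 0)]"

lemma runs_mark_sum:
  assumes D: "stored (m 1) (m 2 rD) (encode_clause D)" "distinct (map lvar D)"
    and ys: "stored (m 0) (m 2 rC) (encode_clause ys)" "distinct (map lvar ys)"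
  shows "runs mark_sum m (\<lambda>t m'. t = 6 * (length D + length ys) + 8 \<and>
    m' 3 = toggle_marks ys (toggle_marks D (m 3)) \<and> m' 2 rP = (sign_sum D + sign_sum ys) mod 2 \<and>
    (\<forall>r. r \<notin> {rQ, rN, rP} \<longrightarrow> m' 2 r = m 2 r) \<and> (\<forall>B. B \<notin> {2, 3} \<longrightarrow> m' B = m B))"
  unfolding mark_sum_def
proof (rule runs_block_Cons, rule runs_Store, rule runs_block_step[OF runs_toggle_clause[where xs = D]], goal_cases)
  case (6 t1 m1)
  show ?case
  proof (rule runs_block_step[OF runs_toggle_clause[where xs = ys]], goal_cases)
    case (6 t2 m2)
    show ?case
      by (rule runs_block_Nil) (use 6 \<open>t1 = _ \<and> _\<close> in \<open>auto simp: mod_simps ac_simps\<close>)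
  qed (use 6 ys in auto)
qed (use D in auto)

text \<open>One cell is left free in front of the literals for the length, which is known only at
  the end. Having passed the old sum, the read pointer is the position of the next one and is saved
  in \<open>rD\<close>.\<close>

definition collect_sum :: com where
  "collect_sum = block [
     set_reg rS (reg rE), set_reg rE (Add (reg rE) (Const 1)), set_reg rL (Const 0),
     on_clause 1 rD (collect 1), set_reg rD (reg rQ), on_clause 0 rC (collect 0)]"

lemma runs_collect_sum:
  assumes D: "stored (m 1) (m 2 rD) (encode_clause D)" "distinct (map lvar D)"
      "m 2 rD + 1 + 2 * length D \<le> m 2 rE"
    and ys: "stored (m 0) (m 2 rC) (encode_clause ys)" "distinct (map lvar ys)"
    and marks: "m 3 = toggle_marks ys (toggle_marks D (\<lambda>_. 0))"
  shows "runs collect_sum m (\<lambda>t m'. t \<le> 14 * (length D + length ys) + 11 \<and>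
    collected m' (m 2 rE + 1) (xor_vars D ys) \<and> m' 3 = (\<lambda>_. 0) \<and>
    m' 2 rD = m 2 rD + 1 + 2 * length D \<and> m' 2 rS = m 2 rE \<and>
    (\<forall>r. r \<notin> {rQ, rN, rE, rL, rB, rD, rS} \<longrightarrow> m' 2 r = m 2 r) \<and> (\<forall>a<m 2 rE. m' 1 a = m 1 a) \<and>
    (\<forall>B. B \<notin> {1, 2, 3} \<longrightarrow> m' B = m B))"
proof -
  \<comment> \<open>A variable of one clause has mark 1 exactly if it is missing from the other.
    Clearing the marks of \<open>D\<close> first does not disturb the test for \<open>ys\<close>,
    since common variables have mark 0 anyway.\<close>
  have f1: "filter (\<lambda>v. m 3 v = 1) (map lvar D) = filter (\<lambda>v. v \<notin> lvar ` set ys) (map lvar D)"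
    by (rule filter_cong) (auto simp: marks toggle_marks_def)
  have f2: "filter (\<lambda>v. (if v \<in> lvar ` set D then 0 else m 3 v) = 1) (map lvar ys) =
      filter (\<lambda>v. v \<notin> lvar ` set D) (map lvar ys)"
    by (rule filter_cong) (auto simp: marks toggle_marks_def)
  have f3: "(\<lambda>v. if v \<in> lvar ` set ys then 0 else if v \<in> lvar ` set D then 0 else m 3 v) = (\<lambda>_. 0)"
    by (auto simp: marks toggle_marks_def fun_eq_iff)
  let ?m = "m(2 := (m 2)(rS := m 2 rE, rE := m 2 rE + 1, rL := 0))"
  have col: "collected ?m (m 2 rE + 1) []" by (simp add: collected_def)
  have rest: "runs (block [on_clause 1 rD (collect 1), set_reg rD (reg rQ), on_clause 0 rC (collect 0)]) ?m
    (\<lambda>t m'. t \<le> 14 * (length D + length ys) + 8 \<and>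
    collected m' (m 2 rE + 1) (xor_vars D ys) \<and> m' 3 = (\<lambda>_. 0) \<and>
    m' 2 rD = m 2 rD + 1 + 2 * length D \<and> m' 2 rS = m 2 rE \<and>
    (\<forall>r. r \<notin> {rQ, rN, rE, rL, rB, rD, rS} \<longrightarrow> m' 2 r = m 2 r) \<and> (\<forall>a<m 2 rE. m' 1 a = m 1 a) \<and>
    (\<forall>B. B \<notin> {1, 2, 3} \<longrightarrow> m' B = m B))"
  proof (rule runs_block_step[OF runs_collect_clause[OF col, where xs = D]], goal_cases)
    case (6 t1 m1)
    then have t1: "t1 \<le> 14 * length D + 3"
      and m1: "collected m1 (m 2 rE + 1) (filter (\<lambda>v. v \<notin> lvar ` set ys) (map lvar D))"
       "m1 3 = (\<lambda>v. if v \<in> lvar ` set D then 0 else m 3 v)" "m1 2 rQ = m 2 rD + 1 + 2 * length D"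
       "\<forall>r. r \<notin> {rQ, rN, rE, rL, rB} \<longrightarrow> m1 2 r = ?m 2 r" "\<forall>a<m 2 rE + 1. m1 1 a = m 1 a"
       "\<forall>B. B \<notin> {1, 2, 3} \<longrightarrow> m1 B = m B"
      by (simp_all add: f1 cong: if_cong)
    let ?m1 = "m1(2 := (m1 2)(rD := m1 2 rQ))"
    have col1: "collected ?m1 (m 2 rE + 1) (filter (\<lambda>v. v \<notin> lvar ` set ys) (map lvar D))"
      using m1(1) collected_cong[of ?m1 m1] by simp
    show ?case
    proof (rule runs_block_Cons, rule runs_Store, simp only: aval.simps,
        rule runs_block_step[OF runs_collect_clause[OF col1, where xs = ys]], goal_cases)
      case (6 t2 m2)
      show ?case
      proof (rule runs_block_Nil)
        have "filter (\<lambda>v. ?m1 3 v = 1) (map lvar ys) = filter (\<lambda>v. v \<notin> lvar ` set D) (map lvar ys)"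
          using m1(2) f2 by simp
        then have "collected m2 (m 2 rE + 1) (xor_vars D ys)" using 6 by (simp add: xor_vars_def)
        moreover have "m2 3 = (\<lambda>_. 0)" using 6 m1(2) f3 by (simp cong: if_cong)
        ultimately show "t1 + (1 + (t2 + 1)) \<le> 14 * (length D + length ys) + 8 \<and>
          collected m2 (m 2 rE + 1) (xor_vars D ys) \<and> m2 3 = (\<lambda>_. 0) \<and>
          m2 2 rD = m 2 rD + 1 + 2 * length D \<and> m2 2 rS = m 2 rE \<and>
          (\<forall>r. r \<notin> {rQ, rN, rE, rL, rB, rD, rS} \<longrightarrow> m2 2 r = m 2 r) \<and> (\<forall>a<m 2 rE. m2 1 a = m 1 a) \<and>
          (\<forall>B. B \<notin> {1, 2, 3} \<longrightarrow> m2 B = m B)"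
          using t1 6 m1(3-6) by simp
      qed
    qed (use ys m1 in simp_all)
  qed (use D in \<open>simp_all\<close>)
  show ?thesis
    unfolding collect_sum_def
  proof (rule runs_block_Cons, rule runs_Store, rule runs_block_Cons, rule runs_Store,
      rule runs_block_Cons, rule runs_Store, rule runs_memory_cong[of _ ?m], goal_cases)
    case 2
    show ?case by (rule runs_conseq[OF rest]) simp
  qed (auto simp: fun_eq_iff)
qed

definition finish_sum :: com where
  "finish_sum = block [
     Store 1 (reg rS) (reg rL),
     Cond (Less (Const 0) (reg rL))
       (Cond (Equal (reg rP) (Const 1)) (Store 1 (Add (reg rB) (Const 1)) (Const 1)) Skip)
       (set_reg rZ (Const 1))]"

text \<open>The minimum occurs at one position only, so a single store into its sign cell, one
  behind the variable, complements the right literal.\<close>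

lemma stored_signed_list:
  assumes "stored f p (encode_literals (map Pos vs))" "distinct vs"
    and "j < length vs" "vs ! j = Min (set vs)"
  shows "stored (f(p + 2 * j + 1 := 1)) p (encode_literals (signed_list True vs))"
  unfolding stored_encode_literals_iff
proof (intro allI impI)
  fix i assume "i < length (signed_list True vs)"
  then have i: "i < length vs" by (simp add: signed_list_def)
  then have f: "f (p + 2 * i) = vs ! i" "f (p + 2 * i + 1) = 0"
    using assms(1) by (simp_all add: stored_encode_literals_iff)
  have "vs ! i = Min (set vs) \<longleftrightarrow> i = j" using assms i nth_eq_iff_index_eq by metis
  moreover have "p + 2 * i \<noteq> p + 2 * j + 1" by presburger
  ultimately show "(f(p + 2 * j + 1 := 1)) (p + 2 * i) = lvar (signed_list True vs ! i) \<and>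
    (f(p + 2 * j + 1 := 1)) (p + 2 * i + 1) = lit_sign (signed_list True vs ! i)"
    using i f by (simp add: signed_list_def)
qed

lemma runs_finish_sum:
  assumes col: "collected m (m 2 rS + 1) vs" "distinct vs"
  shows "runs finish_sum m (\<lambda>t m'. t \<le> 5 \<and>
    stored (m' 1) (m 2 rS) (encode_clause (signed_list (m 2 rP = 1) vs)) \<and>
    m' 2 rZ = (if vs = [] then 1 else m 2 rZ) \<and> (\<forall>r. r \<noteq> rZ \<longrightarrow> m' 2 r = m 2 r) \<and>
    (\<forall>a<m 2 rS. m' 1 a = m 1 a) \<and> (\<forall>B. B \<notin> {1, 2} \<longrightarrow> m' B = m B))"
proof -
  let ?s = "m 2 rS"
  have c: "stored (m 1) (?s + 1) (encode_literals (map Pos vs))" "m 2 rL = length vs"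
    "vs \<noteq> [] \<Longrightarrow> \<exists>j<length vs. m 2 rB = ?s + 1 + 2 * j \<and> vs ! j = Min (set vs)"
    using col by (auto simp: collected_def)
  have c1: "stored ((m 1)(?s := length vs)) (?s + 1) (encode_literals (map Pos vs))"
    using c(1) stored_cong[of "?s + 1" "encode_literals (map Pos vs)" "(m 1)(?s := length vs)" "m 1"] by simp
  have pos: "signed_list False vs = map Pos vs" by (simp add: signed_list_def)
  have len: "length (signed_list b vs) = length vs" for b by (simp add: signed_list_def)
  show ?thesis
    unfolding finish_sum_def
  proof (intro runs_block_Cons runs_Store runs_Cond runs_Skip runs_block_Nil, goal_cases)
    case 1
    then have "vs \<noteq> []" "m 2 rP = 1" using c(2) by auto
    then obtain j where j: "j < length vs" "m 2 rB = ?s + 1 + 2 * j" "vs ! j = Min (set vs)" using c(3) by blast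
    have "stored ((m 1)(?s := length vs, ?s + 1 + 2 * j + 1 := 1)) (?s + 1) (encode_literals (signed_list True vs))"
      by (rule stored_signed_list[OF c1 col(2) j(1,3)])
    then show ?case using j c(2) \<open>vs \<noteq> []\<close> \<open>m 2 rP = 1\<close> by (simp add: stored_encode_clause len)
  next
    case 2
    then show ?case using c c1 by (auto simp: stored_encode_clause len pos)
  next
    case 3
    then show ?case using c c1 by (auto simp: stored_encode_clause len signed_list_def)
  qed
qed

definition sum_body :: com where
  "sum_body = block [mark_sum, collect_sum, finish_sum, set_reg rK (Sub (reg rK) (Const 1))]"

lemma map_lvar_xor_list: "map lvar (xor_list ys xs) = xor_vars xs ys"
  by (auto simp: xor_list_def signed_list_def intro!: map_idI)

lemma distinct_xor_vars:
  "distinct (map lvar xs) \<Longrightarrow> distinct (map lvar ys) \<Longrightarrow> distinct (xor_vars xs ys)"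
  by (auto simp: xor_vars_def)

text \<open>The factor is 6 for marking plus 14 for collecting; the constant is 8 + 11 + 5 for the
  three parts plus 2 for the counter and the closing \<open>Skip\<close>.\<close>

lemma runs_sum_body:
  assumes D: "stored (m 1) (m 2 rD) (encode_clause D)" "distinct (map lvar D)"
      "m 2 rD + 1 + 2 * length D \<le> m 2 rE"
    and ys: "stored (m 0) (m 2 rC) (encode_clause ys)" "distinct (map lvar ys)"
    and marks: "m 3 = (\<lambda>_. 0)"
  shows "runs sum_body m (\<lambda>t m'. t \<le> 20 * (length D + length ys) + 26 \<and>
    stored (m' 1) (m 2 rE) (encode_clause (xor_list ys D)) \<and>
    m' 2 rE = m 2 rE + length (encode_clause (xor_list ys D)) \<and> m' 3 = (\<lambda>_. 0) \<and>
    m' 2 rD = m 2 rD + length (encode_clause D) \<and> m' 2 rK = m 2 rK - 1 \<and>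
    m' 2 rZ = (if xor_list ys D = [] then 1 else m 2 rZ) \<and>
    (\<forall>r\<in>{rC, rH, rT, rF}. m' 2 r = m 2 r) \<and> (\<forall>a<m 2 rE. m' 1 a = m 1 a) \<and> m' 0 = m 0)"
  unfolding sum_body_def
proof (rule runs_block_step[OF runs_mark_sum[OF D(1,2) ys]], goal_cases)
  case (1 t1 m1)
  then have t1: "t1 = 6 * (length D + length ys) + 8"
    and m1: "m1 3 = toggle_marks ys (toggle_marks D (\<lambda>_. 0))" "m1 2 rP = (sign_sum D + sign_sum ys) mod 2"
      "\<forall>r. r \<notin> {rQ, rN, rP} \<longrightarrow> m1 2 r = m 2 r" "\<forall>B. B \<notin> {2, 3} \<longrightarrow> m1 B = m B"
    by (simp_all add: marks)
  show ?case
  proof (rule runs_block_step[OF runs_collect_sum[where D = D and ys = ys]], goal_cases)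
    case (7 t2 m2)
    then have t2: "t2 \<le> 14 * (length D + length ys) + 11"
      and m2: "collected m2 (m2 2 rS + 1) (xor_vars D ys)" "m2 3 = (\<lambda>_. 0)"
        "m2 2 rD = m 2 rD + 1 + 2 * length D" "m2 2 rS = m 2 rE"
        "\<forall>r. r \<notin> {rQ, rN, rE, rL, rB, rD, rS} \<longrightarrow> m2 2 r = m1 2 r" "\<forall>a<m 2 rE. m2 1 a = m 1 a"
        "m2 0 = m 0"
      using m1(3,4) by simp_all
    have E: "m2 2 rE = m 2 rE + length (encode_clause (xor_list ys D))"
      using m2(1,4) map_lvar_xor_list[of ys D, THEN arg_cong[where f = length]]
      by (simp add: collected_def encode_clause_eq One_nat_def)
    have P: "(m2 2 rP = 1) = odd (sign_sum D + sign_sum ys)"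
    proof -
      have "m2 2 rP = (sign_sum D + sign_sum ys) mod 2" using m2(5) m1(2) by simp
      then show ?thesis by (simp only: odd_iff_mod_2_eq_one)
    qed
    have nil: "xor_vars D ys = [] \<longleftrightarrow> xor_list ys D = []" by (simp add: xor_list_def signed_list_def)
    show ?case
    proof (rule runs_block_step[OF runs_finish_sum[OF m2(1) distinct_xor_vars[OF D(2) ys(2)]]], goal_cases)
      case (1 t3 m3)
      then have t3: "t3 \<le> 5"
        and m3: "stored (m3 1) (m 2 rE) (encode_clause (xor_list ys D))"
          "m3 2 rZ = (if xor_list ys D = [] then 1 else m2 2 rZ)" "\<forall>r. r \<noteq> rZ \<longrightarrow> m3 2 r = m2 2 r"
          "\<forall>a<m 2 rE. m3 1 a = m2 1 a" "\<forall>B. B \<notin> {1, 2} \<longrightarrow> m3 B = m2 B"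
        using P nil m2(4) by (simp_all add: xor_list_def)
      show ?case
        by (intro runs_block_Cons runs_Store runs_block_Nil)
          (use t1 t2 t3 m1(3) m2(2-) m3 E in \<open>simp add: encode_clause_eq One_nat_def\<close>)
    qed
  qed (use D ys m1 in simp_all)
qed

section \<open>Loops over the sums and the input clauses\<close>

definition sum_loop :: com where
  "sum_loop = While (Less (Const 0) (reg rK)) sum_body"

abbreviation encode_list :: "nat literal list list \<Rightarrow> nat list" where
  "encode_list xss \<equiv> concat (map encode_clause xss)"

text \<open>New sums are appended behind the old ones while these are being read; the counter
  \<open>rK\<close>, fixed in advance, stops the loop before it reaches the new ones.\<close>

lemma runs_sum_loop:
  assumes "stored (m 1) (m 2 rD) (encode_list Ds)" "m 2 rD + length (encode_list Ds) \<le> m 2 rE"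
    "\<And>D. D \<in> set Ds \<Longrightarrow> distinct (map lvar D) \<and> length D \<le> l"
    "stored (m 0) (m 2 rC) (encode_clause ys)" "distinct (map lvar ys)"
    "m 3 = (\<lambda>_. 0)" "m 2 rK = length Ds"
  shows "runs sum_loop m (\<lambda>t m'. t \<le> length Ds * (20 * (l + length ys) + 27) + 1 \<and>
    stored (m' 1) (m 2 rE) (encode_list (map (xor_list ys) Ds)) \<and>
    m' 2 rE = m 2 rE + length (encode_list (map (xor_list ys) Ds)) \<and> m' 3 = (\<lambda>_. 0) \<and>
    m' 2 rZ = (if [] \<in> set (map (xor_list ys) Ds) then 1 else m 2 rZ) \<and>
    (\<forall>r\<in>{rC, rH, rT, rF}. m' 2 r = m 2 r) \<and> (\<forall>a<m 2 rE. m' 1 a = m 1 a) \<and> m' 0 = m 0)"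
  using assms
proof (induction Ds arbitrary: m)
  case Nil
  then show ?case unfolding sum_loop_def by (intro runs_While_False) simp_all
next
  case (Cons D Ds)
  have D: "stored (m 1) (m 2 rD) (encode_clause D)" "distinct (map lvar D)"
      "m 2 rD + 1 + 2 * length D \<le> m 2 rE" "length D \<le> l"
    using Cons.prems(1,2,3) by (simp_all add: encode_clause_eq One_nat_def)
  show ?case
    unfolding sum_loop_def
  proof (rule runs_While_True, goal_cases)
    case 2
    show ?case
    proof (rule runs_conseq[OF runs_sum_body[OF D(1-3) Cons.prems(4-6)]], fold sum_loop_def, goal_cases)
      case (1 t1 m1)
      then have t1: "t1 \<le> 20 * (length D + length ys) + 26"
        and m1: "stored (m1 1) (m 2 rE) (encode_clause (xor_list ys D))"
          "m1 2 rE = m 2 rE + length (encode_clause (xor_list ys D))" "m1 3 = (\<lambda>_. 0)"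
          "m1 2 rD = m 2 rD + length (encode_clause D)" "m1 2 rK = m 2 rK - 1"
          "m1 2 rZ = (if xor_list ys D = [] then 1 else m 2 rZ)"
          "\<forall>r\<in>{rC, rH, rT, rF}. m1 2 r = m 2 r" "\<forall>a<m 2 rE. m1 1 a = m 1 a" "m1 0 = m 0"
        by blast+
      have st: "stored (m1 1) (m1 2 rD) (encode_list Ds)"
      proof -
        have "stored (m 1) (m1 2 rD) (encode_list Ds)" using Cons.prems(1) m1(4) by simp
        moreover have "stored (m1 1) (m1 2 rD) (encode_list Ds) = stored (m 1) (m1 2 rD) (encode_list Ds)"
          using m1(4,8) Cons.prems(2) by (intro stored_cong) simp
        ultimately show ?thesis by simp
      qed
      show ?case
      proof (rule runs_conseq[OF Cons.IH[OF st]], goal_cases)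
        case (7 t2 m2)
        then have t2: "t2 \<le> length Ds * (20 * (l + length ys) + 27) + 1"
          and m2: "stored (m2 1) (m1 2 rE) (encode_list (map (xor_list ys) Ds))"
            "m2 2 rE = m1 2 rE + length (encode_list (map (xor_list ys) Ds))" "m2 3 = (\<lambda>_. 0)"
            "m2 2 rZ = (if [] \<in> set (map (xor_list ys) Ds) then 1 else m1 2 rZ)"
            "\<forall>r\<in>{rC, rH, rT, rF}. m2 2 r = m1 2 r" "\<forall>a<m1 2 rE. m2 1 a = m1 1 a" "m2 0 = m1 0"
          by blast+
        have "stored (m2 1) (m 2 rE) (encode_clause (xor_list ys D)) =
            stored (m1 1) (m 2 rE) (encode_clause (xor_list ys D))"
          using m2(6) m1(2) by (intro stored_cong) simp
        then have "stored (m2 1) (m 2 rE) (encode_list (map (xor_list ys) (D # Ds)))"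
          using m1(1,2) m2(1) by simp
        moreover have "20 * (length D + length ys) \<le> 20 * (l + length ys)" using D(4) by simp
        then have "t1 + t2 + 1 \<le> length (D # Ds) * (20 * (l + length ys) + 27) + 1"
          using t1 t2 unfolding length_Cons mult_Suc by linarith
        moreover have "m2 2 rZ = (if [] \<in> set (map (xor_list ys) (D # Ds)) then 1 else m 2 rZ)"
          using m2(4) m1(6) by auto
        ultimately show ?case using m1(2,7-9) m2(2,3,5-7) by simp
      qed (use Cons.prems m1 in simp_all)
    qed
  qed (use Cons.prems in simp)
qed

text \<open>New sums are discarded in constant time by resetting the end of the output. What remains
  beyond the end is harmless, as \<open>outputs\<close> inspects a prefix only.\<close>

definition clause_body :: com where
  "clause_body = block [
     set_reg rZ (Const 0), set_reg rF (reg rE), set_reg rK (reg rT), set_reg rD (Const 1), sum_loop,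
     Cond (Equal (reg rZ) (Const 1)) (set_reg rE (reg rF)) (set_reg rT (Add (reg rT) (reg rT))),
     set_reg rC (Add (reg rC) (Add (Const 1) (Add (Load 0 (reg rC)) (Load 0 (reg rC))))),
     set_reg rH (Sub (reg rH) (Const 1))]"

text \<open>Cell 0 of the output is reserved for the number of sums, which is written last; the sums
  therefore start at 1.\<close>

definition main_inv :: "memory \<Rightarrow> nat literal list list \<Rightarrow> nat literal list list \<Rightarrow> bool" where
  "main_inv m xss Ds \<longleftrightarrow> stored (m 0) (m 2 rC) (encode_list xss) \<and> m 2 rH = length xss \<and>
     stored (m 1) 1 (encode_list Ds) \<and> m 2 rE = 1 + length (encode_list Ds) \<and> m 2 rT = length Ds \<and>
     m 3 = (\<lambda>_. 0)"

text \<open>Beyond the iterations of the inner loop: 4 initial stores, 1 failing test, 2 for the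
  conditional, 2 final stores and the closing \<open>Skip\<close>.\<close>

lemma runs_clause_body:
  assumes inv: "main_inv m (ys # xss) Ds" and ys: "distinct (map lvar ys)"
    and Ds: "\<And>D. D \<in> set Ds \<Longrightarrow> distinct (map lvar D) \<and> length D \<le> l"
  shows "runs clause_body m (\<lambda>t m'. t \<le> length Ds * (20 * (l + length ys) + 27) + 10 \<and>
    main_inv m' xss (closure_step Ds ys))"
  unfolding clause_body_def
proof (rule runs_block_Cons, rule runs_Store, rule runs_block_Cons, rule runs_Store,
    rule runs_block_Cons, rule runs_Store, rule runs_block_Cons, rule runs_Store,
    rule runs_block_step[OF runs_sum_loop[where Ds = Ds and ys = ys and l = l]], goal_cases)
  case (8 t1 m1)
  have inv': "stored (m 0) (m 2 rC) (encode_clause ys)" "stored (m 0) (m 2 rC + length (encode_clause ys)) (encode_list xss)"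
    "m 2 rH = Suc (length xss)" "stored (m 1) 1 (encode_list Ds)" "m 2 rE = 1 + length (encode_list Ds)"
    "m 2 rT = length Ds"
    using inv by (simp_all add: main_inv_def)
  have t1: "t1 \<le> length Ds * (20 * (l + length ys) + 27) + 1"
    and m1: "stored (m1 1) (m 2 rE) (encode_list (map (xor_list ys) Ds))"
    "m1 2 rE = m 2 rE + length (encode_list (map (xor_list ys) Ds))" "m1 3 = (\<lambda>_. 0)"
    "m1 2 rZ = (if [] \<in> set (map (xor_list ys) Ds) then 1 else 0)"
    "m1 2 rC = m 2 rC" "m1 2 rH = m 2 rH" "m1 2 rT = m 2 rT" "m1 2 rF = m 2 rE"
    "\<forall>a<m 2 rE. m1 1 a = m 1 a" "m1 0 = m 0"
    using 8 by simp_all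
  have "stored (m1 1) 1 (encode_list Ds) = stored (m 1) 1 (encode_list Ds)"
    using m1(9) inv'(5) by (intro stored_cong) simp
  then have old: "stored (m1 1) 1 (encode_list Ds)" using inv'(4) by simp
  have C: "m 2 rC + (1 + (m 0 (m 2 rC) + m 0 (m 2 rC))) = m 2 rC + length (encode_clause ys)"
    using inv'(1) by (simp add: encode_clause_eq One_nat_def)
  show ?case
  proof (cases "[] \<in> set (map (xor_list ys) Ds)")
    case True
    then have Z: "m1 2 rZ = 1" using m1(4) by simp
    have "closure_step Ds ys = Ds" unfolding closure_step_def using True by (rule if_P)
    then show ?thesis
      by (intro runs_block_Cons runs_Cond_True runs_Store runs_block_Nil)
        (use Z t1 m1(3,5-8,10) old inv' C in \<open>simp_all add: main_inv_def\<close>)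
  next
    case False
    then have Z: "m1 2 rZ \<noteq> 1" using m1(4) by simp
    have "closure_step Ds ys = Ds @ map (xor_list ys) Ds"
      unfolding closure_step_def using False by (rule if_not_P)
    then show ?thesis
      by (intro runs_block_Cons runs_Cond_False runs_Store runs_block_Nil)
        (use Z t1 m1(1-3,5-7,10) old inv' C in \<open>simp_all add: main_inv_def\<close>)
  qed
qed (use inv ys Ds in \<open>simp_all add: main_inv_def\<close>)

definition main_loop :: com where
  "main_loop = While (Less (Const 0) (reg rH)) clause_body"

lemma closure_step_elem:
  assumes "D \<in> set (closure_step Ds ys)"
  shows "D \<in> set Ds \<or> (\<exists>D'\<in>set Ds. D = xor_list ys D')"
  using assms by (auto simp: closure_step_def split: if_splits)

lemma length_closure_step: "length (closure_step Ds ys) \<le> 2 * length Ds"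
  by (simp add: closure_step_def)

text \<open>\<open>l\<close> bounds the length of a sum plus all input still to come; this is
  invariant because adding \<open>ys\<close> lengthens a sum by at most \<open>length ys\<close>. As
  the number of sums at most doubles, the costs add up to a geometric series, whence the factor
  \<open>2 ^ length xss - 1\<close>.\<close>

lemma runs_main_loop:
  assumes "main_inv m xss Ds" "\<And>ys. ys \<in> set xss \<Longrightarrow> distinct (map lvar ys)"
    "\<And>D. D \<in> set Ds \<Longrightarrow> distinct (map lvar D) \<and> length D + sum_list (map length xss) \<le> l"
  shows "runs main_loop m (\<lambda>t m'.
    t \<le> (2 ^ length xss - 1) * (length Ds * (20 * l + 27)) + 11 * length xss + 1 \<and>
    main_inv m' [] (foldl closure_step Ds xss))"
  using assms
proof (induction xss arbitrary: m Ds)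
  case Nil
  then show ?case unfolding main_loop_def by (intro runs_While_False) (simp_all add: main_inv_def)
next
  case (Cons ys xss)
  have ys: "distinct (map lvar ys)" using Cons.prems(2) by simp
  show ?case
    unfolding main_loop_def
  proof (rule runs_While_True, goal_cases)
    case 2
    show ?case
    proof (rule runs_conseq[OF runs_clause_body[OF Cons.prems(1) ys, where l = "l - length ys"]],
        goal_cases)
      case (1 D)
      then have "distinct (map lvar D)" "length D + length ys \<le> l" using Cons.prems(3)[of D] by simp_all
      then show ?case by linarith
    next
      case (2 t1 m1)
      let ?Ds = "closure_step Ds ys"
      let ?W = "20 * l + 27"
      show ?case
      proof (fold main_loop_def, rule runs_conseq[OF Cons.IH[where Ds = ?Ds]], goal_cases)
        case 1
        show ?case using 2 by blast
      next
        case (2 zs)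
        then show ?case using Cons.prems(2) by simp
      next
        case (3 D)
        from closure_step_elem[OF this] show ?case
        proof
          assume "D \<in> set Ds"
          then show ?thesis using Cons.prems(3)[of D] by simp
        next
          assume "\<exists>D'\<in>set Ds. D = xor_list ys D'"
          then obtain D' where D': "D' \<in> set Ds" "D = xor_list ys D'" by blast
          then show ?thesis
            using Cons.prems(3)[OF D'(1)] length_xor_list[of ys D'] ys
            by (simp add: map_lvar_xor_list distinct_xor_vars)
        qed
      next
        case (4 t2 m2)
        obtain k where k: "2 ^ length xss = Suc k" using not0_implies_Suc[of "2 ^ length xss"] by auto
        \<comment> \<open>If there is a sum at all, then \<open>length ys \<le> l\<close> and the
          truncated subtraction is exact; otherwise both products vanish.\<close>
        have "length Ds * (20 * (l - length ys + length ys) + 27) = length Ds * ?W"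
        proof (cases "Ds = []")
          case False
          then obtain D where "D \<in> set Ds" by (cases Ds) auto
          then have "length ys \<le> l" using Cons.prems(3)[of D] by simp
          then show ?thesis by simp
        qed simp
        then have t1: "t1 \<le> length Ds * ?W + 10" using conjunct1[OF 2] by (simp only:)
        have "k * (length ?Ds * ?W) \<le> k * (2 * length Ds * ?W)"
          by (intro mult_le_mono le_refl length_closure_step)
        then have "k * (length ?Ds * ?W) \<le> 2 * k * (length Ds * ?W)" by (simp only: ac_simps)
        moreover have "2 ^ length xss - 1 = k" using k by simp
        then have "t2 \<le> k * (length ?Ds * ?W) + 11 * length xss + 1" using conjunct1[OF 4] by (simp only:)
        ultimately have "t2 \<le> 2 * k * (length Ds * ?W) + 11 * length xss + 1" by linarith
        moreover have "(2 ^ length (ys # xss) - 1) * (length Ds * ?W) = 2 * k * (length Ds * ?W) + length Ds * ?W"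
        proof -
          have "2 ^ length (ys # xss) - 1 = 2 * k + (1 :: nat)" using k by simp
          then show ?thesis by (simp only: add_mult_distrib mult_1)
        qed
        ultimately show ?case using t1 4 by simp
      qed
    qed
  qed (use Cons.prems in \<open>simp add: main_inv_def\<close>)
qed

text \<open>Initially the output holds just the empty sum. Its encoding is a single 0 at position 1,
  already present in the initial memory, so only the end 2 and the count 1 have to be set.\<close>

definition closure_program :: com where
  "closure_program = block [
     set_reg rH (Load 0 (Const 0)), set_reg rC (Const 1), set_reg rE (Const 2), set_reg rT (Const 1),
     main_loop, Store 1 (Const 0) (reg rT)]"

lemma runs_closure_program:
  assumes "\<And>xs. xs \<in> set xss \<Longrightarrow> distinct (map lvar xs)"
  shows "runs closure_program (input_memory (encode_clauses xss)) (\<lambda>t m'.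
    t \<le> 2 ^ length xss * (20 * sum_list (map length xss) + 27) + 11 * length xss + 7 \<and>
    outputs m' (encode_clauses (foldl closure_step [[]] xss)))"
proof -
  let ?l = "sum_list (map length xss)"
  let ?e = "encode_clauses xss"
  let ?m = "input_memory ?e"
  let ?m1 = "?m(2 := (?m 2)(rH := length xss, rC := 1, rE := 2, rT := 1))"
  have e: "?e = length xss # encode_list xss" by (simp add: encode_clauses_def)
  have "stored (?m 0) 0 ?e" by (simp add: stored_iff_nth input_memory_def)
  then have st: "?m 0 0 = length xss" "stored (?m 0) 1 (encode_list xss)"
    unfolding e by (simp_all add: One_nat_def)
  have inv: "main_inv ?m1 xss [[]]"
    using st by (simp add: main_inv_def encode_clause_def input_memory_def One_nat_def)
  have loop: "runs main_loop ?m1 (\<lambda>t m'. t \<le> (2 ^ length xss - 1) * (length ([[]] :: nat literal list list) * (20 * ?l + 27)) + 11 * length xss + 1 \<and>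
    main_inv m' [] (foldl closure_step [[]] xss))"
    by (rule runs_main_loop[OF inv]) (use assms in simp_all)
  have fin: "runs (block [main_loop, Store 1 (Const 0) (reg rT)]) ?m1 (\<lambda>t m'.
    t \<le> 2 ^ length xss * (20 * ?l + 27) + 11 * length xss + 3 \<and>
    outputs m' (encode_clauses (foldl closure_step [[]] xss)))"
  proof (rule runs_block_step[OF loop], intro runs_block_Cons runs_Store runs_block_Nil, goal_cases)
    case (1 t m')
    let ?r = "foldl closure_step [[]] xss"
    have "(2 ^ length xss - 1) * (length ([[]] :: nat literal list list) * (20 * ?l + 27)) \<le> 2 ^ length xss * (20 * ?l + 27)"
      by simp
    then have "t + (1 + 1) \<le> 2 ^ length xss * (20 * ?l + 27) + 11 * length xss + 3" using 1 by linarith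
    moreover have "stored ((m' 1)(0 := length ?r)) 0 (encode_clauses ?r)"
    proof -
      have "stored (m' 1) 1 (encode_list ?r)" using 1 by (simp add: main_inv_def)
      moreover have "stored ((m' 1)(0 := length ?r)) 1 (encode_list ?r) = stored (m' 1) 1 (encode_list ?r)"
        by (rule stored_cong) simp
      ultimately show ?thesis by (simp add: encode_clauses_def One_nat_def)
    qed
    ultimately show ?case using 1 by (simp add: main_inv_def outputs_def stored_iff_nth)
  qed
  show ?thesis
    unfolding closure_program_def
  proof (rule runs_block_Cons, rule runs_Store, rule runs_block_Cons, rule runs_Store,
      rule runs_block_Cons, rule runs_Store, rule runs_block_Cons, rule runs_Store,
      rule runs_memory_cong[of _ ?m1], goal_cases)
    case 2
    show ?case by (rule runs_conseq[OF fin]) simp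
  qed (use st(1) in \<open>auto simp: fun_eq_iff\<close>)
qed

declare One_nat_def [simp]

lemma computable_xor_closure:
  "computable_in_time (\<lambda>F. clause_set F \<and> xor_satisfiable F) (xor_closure min_xor_sum)
     (\<lambda>F. num_literals F * 2 ^ card F)"
  unfolding computable_in_time_def
proof (rule exI[of _ closure_program], rule exI[of _ 80], intro allI impI)
  fix F :: "nat clauses" and xss
  assume as: "(clause_set F \<and> xor_satisfiable F) \<and> lists_clauses xss F"
  then have F: "clause_set F" "xor_satisfiable F" and xss: "lists_clauses xss F" by auto
  have xss': "distinct (map set xss)" "\<And>xs. xs \<in> set xss \<Longrightarrow> distinct xs" "set ` set xss = F"
    using xss by (auto simp: lists_clauses_def)
  have card: "card F = length xss"
    using distinct_card[OF xss'(1)] xss'(3) by simp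
  have "num_literals F = sum_list (map card (map set xss))"
    using sum_list_distinct_conv_sum_set[OF xss'(1), of card] xss'(3) by (simp add: num_literals_def)
  also have "map card (map set xss) = map length xss"
    using xss'(2) by (simp add: distinct_card)
  finally have lits: "num_literals F = sum_list (map length xss)" .
  have "distinct (map lvar xs)" if "xs \<in> set xss" for xs
    using that xss' F(1) by (intro distinct_map_lvar) (auto simp: clause_set_def)
  from runs_closure_program[OF this] obtain t m where
    run: "exec closure_program (input_memory (encode_clauses xss)) t m"
      "t \<le> 2 ^ card F * (20 * num_literals F + 27) + 11 * card F + 7"
      "outputs m (encode_clauses (foldl closure_step [[]] xss))"
    unfolding card lits runs_def by blast
  \<comment> \<open>Without literals \<open>F\<close> has at most one clause and the left side is at
    most 72. Otherwise \<open>card F\<close> and \<open>2 ^ card F\<close> are absorbed by the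
    product, with total factor 20 + 27 + 11 = 58. The constant 80 covers both cases.\<close>
  have "2 ^ card F * (20 * num_literals F + 27) + 11 * card F + 7 \<le> 80 * (num_literals F * 2 ^ card F + 1)"
  proof (cases "num_literals F = 0")
    case True
    then have "set xs = {}" if "xs \<in> set xss" for xs using that unfolding lits by simp
    then have "F \<subseteq> {{}}" using xss'(3) by auto
    then have "card F \<le> 1" using card_mono[of "{{}}" F] by simp
    then have "card F = 0 \<or> card F = 1" by linarith
    then show ?thesis using True by auto
  next
    case False
    then have "2 ^ card F \<le> num_literals F * 2 ^ card F" by simp
    moreover have "card F \<le> 2 ^ card F" by (rule less_imp_le[OF less_exp])
    moreover have eq: "2 ^ card F * (20 * num_literals F + 27) = 20 * (num_literals F * 2 ^ card F) + 27 * 2 ^ card F"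
      by (simp add: algebra_simps)
    moreover have "20 * x + 27 * z + 11 * c + 7 \<le> 80 * (x + 1)" if "z \<le> x" "c \<le> z" for x z c :: nat
      using that by simp
    ultimately show ?thesis by presburger
  qed
  then have "t \<le> 80 * (num_literals F * 2 ^ card F + 1)" using run(2) by linarith
  then show "\<exists>t m yss. exec closure_program (input_memory (encode_clauses xss)) t m \<and>
      t \<le> 80 * (num_literals F * 2 ^ card F + 1) \<and>
      lists_clauses yss (xor_closure min_xor_sum F) \<and> outputs m (encode_clauses yss)"
    using run lists_clauses_closure[OF F xss] by blast
qed

theorem theorem12p1:
  "computable_in_time (\<lambda>F. clause_set F \<and> xor_satisfiable F) (xor_closure min_xor_sum)
     (\<lambda>F. num_literals F * 2 ^ card F) \<and>
   (\<forall>(F :: nat clauses) S. clause_set F \<and> xor_satisfiable F \<and> is_xor_sum S \<longrightarrow>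
     card (xor_closure S F) \<le> 2 ^ card F \<and>
     (\<forall>ord y. splitting_choice (xor_closure S F) ord y \<longrightarrow>
        forcing_representation F (X1 ord y (xor_closure S F))))"
proof (intro conjI allI impI computable_xor_closure; elim conjE)
  fix F :: "nat clauses" and S
  assume "clause_set F"
  then show "card (xor_closure S F) \<le> 2 ^ card F"
    by (simp add: card_xor_closure_le clause_set_def)
qed (rule forcing_representation_X1)

end
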